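(* Let $d\ge 1$, $\alpha\in(0,1]$ and $C>0$. Let $\{\theta_t\}_{t>0}$ be a family of integral operators $\theta_t f(x)=\int_{\mathbb{R}^d}k_t(x,y)f(y)\,\mathrm{d}y$ whose kernels satisfy, for all $x,y,x',y'\in\mathbb{R}^d$ and $t>0$, \[ |k_t(x,y)|\le C\frac{t^\alpha}{(t+|x-y|)^{\alpha+d}}, \qquad |k_t(x,y)-k_t(x',y')|\le C\frac{|x-x'|^\alpha+|y-y'|^\alpha}{(t+|x-y|)^{\alpha+d}}\ \text{ whenever } |x-x'|+|y-y'|<t, \] and let $Sf(x)=\left(\int_0^\infty|\theta_tf(x)|^2\frac{\mathrm{d}t}{t}\right)^{1/2}$. Assume the testing condition: there is $C_T>0$ such that for every cube $Q\subset\mathbb{R}^d$ with sides parallel to the axes, \[ \int_Q\int_0^{\ell Q}|\theta_t\mathbf{1}_Q(x)|^2\frac{\mathrm{d}t}{t}\,\mathrm{d}x\le C_T|Q|. \] Then for any pair of compactly supported functions $f,g\in L^\infty(\mathbb{R}^d)$ there exists a sparse collection $\mathscr{S}$ of dyadic cubes such that \[ \Big|\int_{\mathbb{R}^d}(Sf)^2g\,\mathrm{d}x\Big|\le C'\sum_{Q\in\mathscr{S}}\Big(\frac1{|Q|}\int_Q|f|\Big)^2\Big(\frac1{|Q|}\int_Q|g|\Big)|Q|, \] where $C'=C'(\alpha,d)$ is a positive constant independent of $f$ and $g$.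
   Context: $\mathbb{R}^d$ is equipped with the $\ell^\infty$ norm $|x|=\max_i|x_i|$. For a cube $Q$, $\ell Q$ is its side length and $|Q|$ its Lebesgue measure. A collection $\mathscr{S}$ of dyadic cubes is $\tau$-sparse ($\tau\in(0,1)$ fixed) if for every $Q\in\mathscr{S}$ there is $E_Q\subset Q$ with $|E_Q|\ge\tau|Q|$ and the sets $\{E_Q\}_{Q\in\mathscr{S}}$ pairwise disjoint; "sparse" means $\tau$-sparse for some fixed $\tau\in(0,1)$.
   Formalization: The constant C' may depend on C and C_T as well as on α and d (independence of C and C_T fails under scaling the kernel); the dyadic cubes belong to one dyadic lattice that may depend on f and g; kernels and functions are real-valued. *)

theory Defs
  imports "HOL-Analysis.Analysis"
begin

definition linf :: "real^'n \<Rightarrow> real" where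
  "linf x = Max (range (\<lambda>i. \<bar>x $ i\<bar>))"

definition cube :: "real^'n \<Rightarrow> real \<Rightarrow> (real^'n) set" where
  "cube a l = {x. \<forall>i. a $ i \<le> x $ i \<and> x $ i < a $ i + l}"

definition is_cube :: "(real^'n) set \<Rightarrow> bool" where
  "is_cube Q \<longleftrightarrow> (\<exists>a l. l > 0 \<and> Q = cube a l)"

definition dyadic_desc :: "(real^'n) set \<Rightarrow> (real^'n) set \<Rightarrow> bool" where
  "dyadic_desc Q Q' \<longleftrightarrow> (\<exists>a l b s k. l > 0 \<and> Q = cube a l \<and> Q' = cube b s \<and>
      s = l / 2 ^ k \<and> (\<forall>i. \<exists>m::int. 0 \<le> m \<and> m < 2 ^ k \<and> b $ i = a $ i + s * of_int m))"

text \<open>Dyadic lattice in the sense of Lerner--Nazarov.\<close>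
definition dyadic_lattice :: "(real^'n) set set \<Rightarrow> bool" where
  "dyadic_lattice D \<longleftrightarrow>
     (\<forall>Q\<in>D. is_cube Q) \<and>
     (\<forall>Q\<in>D. \<forall>Q'. dyadic_desc Q Q' \<longrightarrow> Q' \<in> D) \<and>
     (\<forall>Q'\<in>D. \<forall>Q''\<in>D. \<exists>Q\<in>D. dyadic_desc Q Q' \<and> dyadic_desc Q Q'') \<and>
     (\<forall>K. compact K \<longrightarrow> (\<exists>Q\<in>D. K \<subseteq> Q))"

definition sparse :: "real \<Rightarrow> (real^'n) set set \<Rightarrow> bool" where
  "sparse \<tau> S \<longleftrightarrow> (\<exists>E. (\<forall>Q\<in>S. E Q \<subseteq> Q \<and> E Q \<in> sets lebesgue \<and>
        measure lebesgue (E Q) \<ge> \<tau> * measure lebesgue Q) \<and> disjoint_family_on E S)"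

definition theta :: "(real \<Rightarrow> real^'n \<Rightarrow> real^'n \<Rightarrow> real) \<Rightarrow> real \<Rightarrow> (real^'n \<Rightarrow> real) \<Rightarrow> real^'n \<Rightarrow> real" where
  "theta k t f x = (LINT y|lborel. k t x y * f y)"

definition sqfun_sq :: "(real \<Rightarrow> real^'n \<Rightarrow> real^'n \<Rightarrow> real) \<Rightarrow> (real^'n \<Rightarrow> real) \<Rightarrow> real^'n \<Rightarrow> ennreal" where
  "sqfun_sq k f x = (\<integral>\<^sup>+ t\<in>{0<..}. ennreal ((theta k t f x)\<^sup>2 / t) \<partial>lborel)"

definition sqfun :: "(real \<Rightarrow> real^'n \<Rightarrow> real^'n \<Rightarrow> real) \<Rightarrow> (real^'n \<Rightarrow> real) \<Rightarrow> real^'n \<Rightarrow> real" where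
  "sqfun k f x = sqrt (enn2real (sqfun_sq k f x))"

definition avg :: "(real^'n \<Rightarrow> real) \<Rightarrow> (real^'n) set \<Rightarrow> real" where
  "avg f Q = (LINT y:Q|lborel. \<bar>f y\<bar>) / measure lborel Q"

definition kernel_cond :: "real \<Rightarrow> real \<Rightarrow> (real \<Rightarrow> real^'n \<Rightarrow> real^'n \<Rightarrow> real) \<Rightarrow> bool" where
  "kernel_cond \<alpha> C k \<longleftrightarrow>
     (\<lambda>p. k (fst p) (fst (snd p)) (snd (snd p))) \<in> borel_measurable borel \<and>
     (\<forall>t x y. t > 0 \<longrightarrow>
        \<bar>k t x y\<bar> \<le> C * t powr \<alpha> / (t + linf (x - y)) powr (\<alpha> + real CARD('n))) \<and>
     (\<forall>t x y x' y'. t > 0 \<longrightarrow> linf (x - x') + linf (y - y') < t \<longrightarrow>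
        \<bar>k t x y - k t x' y'\<bar> \<le>
          C * (linf (x - x') powr \<alpha> + linf (y - y') powr \<alpha>) / (t + linf (x - y)) powr (\<alpha> + real CARD('n)))"

definition testing_cond :: "real \<Rightarrow> (real \<Rightarrow> real^'n \<Rightarrow> real^'n \<Rightarrow> real) \<Rightarrow> bool" where
  "testing_cond CT k \<longleftrightarrow>
     (\<forall>a l. l > 0 \<longrightarrow>
        (\<integral>\<^sup>+ x\<in>cube a l. (\<integral>\<^sup>+ t\<in>{0<..<l}.
            ennreal ((theta k t (indicator (cube a l)) x)\<^sup>2 / t) \<partial>lborel) \<partial>lborel)
        \<le> ennreal (CT * l ^ CARD('n)))"

definition Linfty_cpt :: "(real^'n \<Rightarrow> real) \<Rightarrow> bool" where
  "Linfty_cpt f \<longleftrightarrow> f \<in> borel_measurable lborel \<and> (\<exists>B. \<forall>x. \<bar>f x\<bar> \<le> B) \<and>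
     (\<exists>K. compact K \<and> (\<forall>x. x \<notin> K \<longrightarrow> f x = 0))"

end

theory Submission
  imports Defs
begin

text \<open>
  Subtracting \<open>(\<theta>\<^sub>t 1)(x) e\<^sub>t(x, y)\<close> from the kernel, where \<open>e\<^sub>t\<close> is a normalised Poisson-like kernel,
  leaves a kernel with vanishing integral, whose square function is bounded on \<open>L\<^sup>2\<close> by almost
  orthogonality; on bounded functions the subtracted part is a Carleson term, controlled by the testing
  condition. A Calderon--Zygmund decomposition of \<open>f 1\<^bsub>3Q\<^esub>\<close> then shows that, outside a small part of a
  dyadic cube \<open>Q\<close>, both the averages of \<open>f\<close> at all smaller scales and the square function over
  \<open>\<epsilon> < t < \<ell>Q\<close> are controlled by the average of \<open>f\<close> over \<open>3Q\<close>. Stopping at the maximal cubes that meet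
  the exceptional set too much, comparing with a good point of the same cube, and iterating gives a
  pointwise sparse bound for the square function truncated at \<open>\<epsilon>\<close>. The truncation makes all families
  finite, so no differentiation theorem is needed, and it costs only a factor 2 since \<open>\<epsilon>\<close> may
  depend on \<open>f\<close> and \<open>g\<close>. Finally the tripled cubes \<open>3Q\<close> are distributed over \<open>3\<^sup>d\<close> dyadic lattices, and
  the lattice carrying the largest share of the sum is kept.
\<close>

section \<open>The maximum norm, cubes and Poisson-like kernels\<close>

text \<open>Two losses shape the argument. Second, the pointwise bound is iterated over arbitrarily
  many generations, so even a factor 2 at each of them would ruin it; the recursion therefore runs
  on an energy whose weight lies between 1 and a constant and absorbs the loss. At scales above a
  stopping cube the good point carries the estimate; below, the part of \<open>f\<close> outside the
  dilate of the cube contributes a tail of order \<open>(t / side) powr \<alpha>\<close>, square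
  integrable against dt/t. Means of \<open>f\<close> are taken over \<open>3Q\<close> but divided by
  the measure of \<open>Q\<close>. The final constant collects \<open>9 ^ d\<close> for the squared
  mean, \<open>3 ^ d\<close> for the choice of one lattice and 2 for the truncation; the sparsity
  constant \<open>1 / (2 * 3 ^ d)\<close> compares half of \<open>Q\<close> with
  \<open>3Q\<close>.\<close>

lemma linf_less_iff: "linf (x::real^'n) < r \<longleftrightarrow> (\<forall>i. \<bar>x $ i\<bar> < r)"
  unfolding linf_def by (subst Max_less_iff) auto

lemma linf_le_iff: "linf (x::real^'n) \<le> r \<longleftrightarrow> (\<forall>i. \<bar>x $ i\<bar> \<le> r)"
  unfolding linf_def by (subst Max_le_iff) auto

lemma component_le_linf: "\<bar>(x::real^'n) $ i\<bar> \<le> linf x"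
  using linf_le_iff[of x "linf x"] by auto

lemma linf_nonneg [simp]: "0 \<le> linf (x::real^'n)"
  using component_le_linf[of x undefined] by linarith

lemma linf_zero [simp]: "linf (0::real^'n) = 0"
  by (intro antisym) (auto simp: linf_le_iff)

lemma linf_minus [simp]: "linf (- x) = linf (x::real^'n)"
  by (simp add: linf_def)

lemma linf_minus_commute: "linf (x - y) = linf (y - (x::real^'n))"
  by (metis linf_minus minus_diff_eq)

lemma linf_triangle: "linf (x + y) \<le> linf x + linf (y::real^'n)"
  unfolding linf_le_iff by (smt (verit) component_le_linf vector_add_component)

lemma linf_triangle3: "linf (x - z) \<le> linf (x - y) + linf (y - (z::real^'n))"
  using linf_triangle[of "x - y" "y - z"] by simp

lemma linf_le_norm: "linf x \<le> norm (x::real^'n)"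
  unfolding linf_le_iff using component_le_norm_cart by blast

lemma borel_measurable_linf [measurable]: "linf \<in> borel_measurable (borel :: (real^'n) measure)"
proof -
  have "\<bar>linf x - linf y\<bar> \<le> norm (x - y)" for x y :: "real^'n"
    using linf_triangle[of "x - y" y] linf_triangle[of "y - x" x] linf_le_norm[of "x - y"]
      linf_minus_commute[of x y] by simp
  then have "1-lipschitz_on UNIV (linf :: real^'n \<Rightarrow> real)"
    by (intro lipschitz_onI) (auto simp: dist_norm)
  then show ?thesis
    by (intro borel_measurable_continuous_onI lipschitz_on_continuous_on)
qed

lemma cube_subset_cbox: "cube a l \<subseteq> cbox a (\<chi> i. a $ i + l)"
  by (auto simp: cube_def mem_box_cart) (metis less_imp_le)

lemma cube_borel [measurable, simp]: "cube a l \<in> sets borel"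
proof -
  have "cube a l = (\<Inter>i. {x. a $ i \<le> x $ i \<and> x $ i < a $ i + l})"
    by (auto simp: cube_def)
  also have "\<dots> \<in> sets borel"
    by (intro sets.countable_INT'') auto
  finally show ?thesis .
qed

lemma emeasure_box_eq_power:
  fixes a :: "real^'n"
  assumes "0 \<le> l"
  shows "emeasure lborel (box a (\<chi> i. a $ i + l)) = ennreal (l ^ CARD('n))"
    and "emeasure lborel (cbox a (\<chi> i. a $ i + l)) = ennreal (l ^ CARD('n))"
proof -
  let ?b = "\<chi> i. a $ i + l"
  have le: "\<forall>b\<in>Basis. a \<bullet> b \<le> ?b \<bullet> b"
    using assms by (auto simp: Basis_vec_def inner_axis)
  have "(\<Prod>b\<in>Basis. (?b - a) \<bullet> b) = (\<Prod>b\<in>(Basis :: (real^'n) set). l)"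
    by (rule prod.cong) (auto simp: Basis_vec_def inner_axis)
  then have *: "(\<Prod>b\<in>Basis. (?b - a) \<bullet> b) = l ^ CARD('n)" by simp
  show "emeasure lborel (box a ?b) = ennreal (l ^ CARD('n))"
    using le * by (simp add: emeasure_lborel_box_eq)
  show "emeasure lborel (cbox a ?b) = ennreal (l ^ CARD('n))"
    using le * by (simp add: emeasure_lborel_cbox_eq)
qed

lemma emeasure_cube: 
  fixes a :: "real^'n"
  assumes "0 \<le> l"
  shows "emeasure lborel (cube a l) = ennreal (l ^ CARD('n))"
proof (rule antisym)
  show "emeasure lborel (cube a l) \<le> ennreal (l ^ CARD('n))"
    using emeasure_mono[OF cube_subset_cbox, where M=lborel and a1=a and l1=l] by (simp add: emeasure_box_eq_power assms)
  have "box a (\<chi> i. a $ i + l) \<subseteq> cube a l"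
    by (auto simp: cube_def mem_box_cart less_imp_le)
  then show "ennreal (l ^ CARD('n)) \<le> emeasure lborel (cube a l)"
    using emeasure_mono[of "box a (\<chi> i. a $ i + l)" "cube a l" lborel] 
    by (simp add: emeasure_box_eq_power assms)
qed

lemma measure_cube:
  fixes a :: "real^'n"
  assumes "0 \<le> l"
  shows "measure lborel (cube a l) = l ^ CARD('n)"
  using emeasure_cube[OF assms, of a] assms by (simp add: measure_def)

lemma emeasure_linf_ball:
  fixes x :: "real^'n"
  assumes "0 < r"
  shows "emeasure lborel {y. linf (x - y) < r} = ennreal ((2 * r) ^ CARD('n))"
proof -
  let ?a = "\<chi> i. x $ i - r"
  have "{y. linf (x - y) < r} = box ?a (\<chi> i. ?a $ i + 2 * r)"
    unfolding set_eq_iff mem_Collect_eq linf_less_iff mem_box_cart abs_less_iff vector_minus_component vec_lambda_beta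
    by (smt (verit))
  then show ?thesis
    using emeasure_box_eq_power(1)[of "2 * r" ?a] assms by simp
qed

section \<open>The Poisson-like majorant: size, tails, mass and continuity\<close>

definition pk :: "real \<Rightarrow> real \<Rightarrow> real^'n \<Rightarrow> real^'n \<Rightarrow> real" where
  "pk \<alpha> t x y = t powr \<alpha> / (t + linf (x - y)) powr (\<alpha> + real CARD('n))"

text \<open>The sum of the dyadic series of \<open>nn_integral_pk\<close>: balls of radius
  \<open>2 ^ k * t\<close> give a geometric series of ratio \<open>2 powr - \<alpha>\<close>, and
  \<open>2 powr (\<alpha> + d)\<close> is the price of replacing the outer radius of an annulus by
  the inner one.\<close>

definition pk_const :: "nat \<Rightarrow> real \<Rightarrow> real" where
  "pk_const d \<alpha> = 2 powr (\<alpha> + real d) * 2 ^ d / (1 - 2 powr - \<alpha>)"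

lemma two_powr_minus_less_1: "0 < \<alpha> \<Longrightarrow> 2 powr - \<alpha> < (1::real)"
  by (simp add: powr_less_one)

lemma pk_const_pos: "0 < \<alpha> \<Longrightarrow> 0 < pk_const d \<alpha>"
  using two_powr_minus_less_1[of \<alpha>] by (simp add: pk_const_def)

lemma pk_nonneg [simp]: "0 \<le> pk \<alpha> t x y"
  by (simp add: pk_def)

lemma pk_sym: "pk \<alpha> t x y = pk \<alpha> t y x"
  by (simp add: pk_def linf_minus_commute)

lemma measurable_pk [measurable (raw)]:
  assumes "f \<in> borel_measurable M" "g \<in> M \<rightarrow>\<^sub>M borel" "h \<in> M \<rightarrow>\<^sub>M borel"
  shows "(\<lambda>w. pk \<alpha> (f w) (g w) (h w :: real^'n)) \<in> borel_measurable M"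
  using assms unfolding pk_def by measurable

lemma pk_far_le:
  fixes x y :: "real^'n"
  assumes "0 < t" "0 < r" "r \<le> t + linf (x - y)" "0 < \<alpha>"
  shows "pk \<alpha> t x y \<le> t powr \<alpha> * r powr (- (\<alpha> + real CARD('n)))"
  using assms unfolding pk_def powr_minus divide_inverse
  by (intro mult_left_mono le_imp_inverse_le powr_mono2) auto

lemma pk_le:
  fixes x y :: "real^'n"
  assumes "0 < t" "0 < \<alpha>"
  shows "pk \<alpha> t x y \<le> t powr (- real CARD('n))"
  using pk_far_le[of t t x y \<alpha>] assms by (simp flip: powr_add)

text \<open>Away from the diagonal \<open>t + linf (x - y)\<close> is at least half of
  \<open>r + linf (x - y)\<close>, so the scale \<open>t\<close> can be traded for the scale
  \<open>r\<close>. The gain \<open>(t / r) powr \<alpha>\<close> makes far contributions integrable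
  against dt/t near 0.\<close>

lemma pk_far:
  fixes x y :: "real^'n"
  assumes "0 < t" "0 < r" "r \<le> linf (x - y)" "0 < \<alpha>"
  shows "pk \<alpha> t x y \<le> (t / r) powr \<alpha> * 2 powr (\<alpha> + real CARD('n)) * pk \<alpha> r x y"
proof -
  let ?D = "\<alpha> + real CARD('n)"
  have "(r + linf (x - y)) / 2 \<le> t + linf (x - y)" using assms by simp
  then have "pk \<alpha> t x y \<le> t powr \<alpha> * ((r + linf (x - y)) / 2) powr (- ?D)"
    using assms by (intro pk_far_le) (auto intro: add_pos_nonneg)
  also have "((r + linf (x - y)) / 2) powr (- ?D) = 2 powr ?D / (r + linf (x - y)) powr ?D"
    unfolding powr_minus using assms by (subst powr_divide) auto
  also have "t powr \<alpha> * (2 powr ?D / (r + linf (x - y)) powr ?D) = 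
      (t / r) powr \<alpha> * 2 powr ?D * pk \<alpha> r x y"
    using assms by (simp add: pk_def powr_divide field_simps)
  finally show ?thesis .
qed

text \<open>The full moment of order \<open>\<alpha>\<close> would cancel all decay beyond the power
  \<open>d\<close> and diverge logarithmically, so only half of the exponent is spent; the other
  half keeps the kernel integrable. This is why \<open>\<alpha>/2\<close> appears in the Hoelder
  exponents below.\<close>

lemma pk_moment:
  fixes x y :: "real^'n"
  assumes "0 < t" "0 < \<alpha>"
  shows "linf (x - y) powr (\<alpha>/2) * pk \<alpha> t x y \<le> t powr (\<alpha>/2) * pk (\<alpha>/2) t x y"
proof -
  let ?u = "t + linf (x - y)"
  have u: "0 < ?u" using assms by (simp add: add_pos_nonneg)
  have "linf (x - y) powr (\<alpha>/2) * pk \<alpha> t x y \<le> ?u powr (\<alpha>/2) * pk \<alpha> t x y"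
    using assms by (intro mult_right_mono powr_mono2) auto
  also have "\<dots> = t powr (\<alpha>/2) * pk (\<alpha>/2) t x y"
  proof -
    have e: "?u powr (\<alpha> + real CARD('n)) = ?u powr (\<alpha>/2) * ?u powr (\<alpha>/2 + real CARD('n))"
      "t powr \<alpha> = t powr (\<alpha>/2) * t powr (\<alpha>/2)"
      by (simp_all flip: powr_add)
    show ?thesis unfolding pk_def e using u by simp
  qed
  finally show ?thesis .
qed

lemma nn_integral_pk:
  fixes x :: "real^'n"
  assumes t: "0 < t" and \<alpha>: "0 < \<alpha>"
  shows "(\<integral>\<^sup>+ y. ennreal (pk \<alpha> t x y) \<partial>lborel) \<le> ennreal (pk_const CARD('n) \<alpha>)"
proof -
  let ?D = "\<alpha> + real CARD('n)"
  \<comment> \<open>The factor \<open>2 powr ?D\<close> lets one formula serve the innermost ball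
    and the annuli alike: a point first reached by ball \<open>Suc j\<close> lies outside ball
    \<open>j\<close>, so only the power \<open>j\<close> is available.\<close>
  define c where "c k = t powr - real CARD('n) * 2 powr ?D * (2 powr - ?D) ^ k" for k :: nat
  define B where "B k = {y. linf (x - y) < 2 ^ k * t}" for k :: nat
  have Bm [measurable]: "B k \<in> sets borel" for k unfolding B_def by measurable
  have pointwise: "ennreal (pk \<alpha> t x y) \<le> (\<Sum>k. ennreal (c k) * indicator (B k) y)" for y
  proof -
    obtain k0 :: nat where "linf (x - y) / t < 2 ^ k0" 
      using real_arch_pow[of 2 "linf (x - y) / t"] by auto
    then have ex: "\<exists>k. y \<in> B k" using t by (auto simp: B_def field_simps)
    define k where "k = (LEAST k. y \<in> B k)"
    have k: "y \<in> B k" unfolding k_def using ex by (rule LeastI_ex)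
    have "pk \<alpha> t x y \<le> c k"
    proof (cases k)
      case 0
      have "pk \<alpha> t x y \<le> t powr - real CARD('n) * 1" using pk_le[OF t \<alpha>] by simp
      also have "\<dots> \<le> t powr - real CARD('n) * 2 powr ?D" 
        using \<alpha> by (intro mult_left_mono ge_one_powr_ge_zero) auto
      finally show ?thesis by (simp add: 0 c_def)
    next
      case (Suc j)
      have "y \<notin> B j" unfolding k_def using Suc not_less_Least[of j "\<lambda>k. y \<in> B k"] k_def by simp
      then have "2 ^ j * t \<le> t + linf (x - y)" using t by (auto simp: B_def)
      then have "pk \<alpha> t x y \<le> t powr \<alpha> * (2 ^ j * t) powr (- ?D)" using t \<alpha> by (intro pk_far_le) auto
      also have "\<dots> = t powr \<alpha> * t powr (- ?D) * (2 powr - ?D) ^ j"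
        using t by (simp add: powr_mult powr_realpow[symmetric] powr_powr mult.commute)
      also have "t powr \<alpha> * t powr (- ?D) = t powr - real CARD('n)" by (simp flip: powr_add)
      also have "t powr - real CARD('n) * (2 powr - ?D) ^ j = c k"
        by (simp add: Suc c_def flip: powr_add)
      finally show ?thesis .
    qed
    then have "ennreal (pk \<alpha> t x y) \<le> ennreal (c k) * indicator (B k) y" using k by (simp add: ennreal_leI)
    also have "\<dots> \<le> (\<Sum>k. ennreal (c k) * indicator (B k) y)"
      using sum_le_suminf[of "\<lambda>k. ennreal (c k) * indicator (B k) y" "{k}"]
      by (simp add: summableI del: sum_mult_indicator)
    finally show ?thesis .
  qed
  have term_eq: "ennreal (c k) * emeasure lborel (B k) = ennreal (2 powr ?D * 2 ^ CARD('n) * (2 powr - \<alpha>) ^ k)" for k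
  proof -
    have c0: "0 \<le> c k" by (simp add: c_def)
    have "ennreal (c k) * emeasure lborel (B k) = ennreal (c k * (2 * (2 ^ k * t)) ^ CARD('n))"
      unfolding B_def using t c0 by (subst emeasure_linf_ball) (auto simp: ennreal_mult'')
    also have "c k * (2 * (2 ^ k * t)) ^ CARD('n) = 2 powr ?D * 2 ^ CARD('n) * (2 powr - \<alpha>) ^ k"
    proof -
      have "(2 powr - ?D) ^ k * (2 ^ k) ^ CARD('n) = (2 powr - \<alpha>) ^ k"
        by (simp add: powr_realpow[symmetric] powr_powr powr_add[symmetric]) (simp add: algebra_simps)
      moreover have "t powr - real CARD('n) * t ^ CARD('n) = 1"
        using t by (simp add: powr_minus powr_realpow)
      ultimately show ?thesis by (simp add: c_def power_mult_distrib)
          (metis (no_types, opaque_lifting) mult.assoc mult.left_commute mult.right_neutral)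
    qed
    finally show ?thesis .
  qed
  have "(\<integral>\<^sup>+ y. ennreal (pk \<alpha> t x y) \<partial>lborel) \<le> (\<integral>\<^sup>+ y. (\<Sum>k. ennreal (c k) * indicator (B k) y) \<partial>lborel)"
    by (intro nn_integral_mono pointwise)
  also have "\<dots> = (\<Sum>k. ennreal (c k) * emeasure lborel (B k))"
    by (subst nn_integral_suminf) (auto simp: nn_integral_cmult_indicator)
  also have "\<dots> = ennreal (\<Sum>k. 2 powr ?D * 2 ^ CARD('n) * (2 powr - \<alpha>) ^ k)"
    unfolding term_eq using two_powr_minus_less_1[OF \<alpha>]
    by (intro suminf_ennreal2) (auto intro!: summable_mult summable_geometric)
  also have "(\<Sum>k. 2 powr ?D * 2 ^ CARD('n) * (2 powr - \<alpha>) ^ k) = pk_const CARD('n) \<alpha>"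
    using two_powr_minus_less_1[OF \<alpha>]
    by (subst suminf_mult) (auto simp: suminf_geometric summable_geometric pk_const_def)
  finally show ?thesis .
qed

lemma nn_integral_pk':
  fixes x :: "real^'n"
  assumes "0 < t" "0 < \<alpha>"
  shows "(\<integral>\<^sup>+ y. ennreal (pk \<alpha> t y x) \<partial>lborel) \<le> ennreal (pk_const CARD('n) \<alpha>)"
  using nn_integral_pk[OF assms, of x] by (simp add: pk_sym[of \<alpha> t x])

lemma integrable_pk:
  fixes x :: "real^'n"
  assumes "0 < t" "0 < \<alpha>"
  shows "integrable lborel (pk \<alpha> t x)"
  using nn_integral_pk[OF assms, of x]
  by (intro integrableI_bounded) (auto intro: le_less_trans)

text \<open>On the ball of radius \<open>t\<close> the denominator is at most
  \<open>(2 * t) powr (\<alpha> + d)\<close>, and the ball has volume \<open>(2 * t) ^ d\<close>.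
  The bound is uniform in \<open>t\<close> and \<open>x\<close>, so normalising \<open>pk\<close>
  costs only a constant.\<close>

lemma integral_pk_ge:
  fixes x :: "real^'n"
  assumes t: "0 < t" and \<alpha>: "0 < \<alpha>"
  shows "2 powr - \<alpha> \<le> (LINT y|lborel. pk \<alpha> t x y)"
proof -
  let ?B = "{y. linf (x - y) < t}"
  have e: "emeasure lborel ?B = ennreal ((2 * t) ^ CARD('n))" by (rule emeasure_linf_ball[OF t])
  have "2 powr - \<alpha> = (LINT y|lborel. t powr \<alpha> * (2 * t) powr (- (\<alpha> + real CARD('n))) * indicator ?B y)"
  proof -
    have "measure lborel ?B = (2 * t) powr real CARD('n)" 
      using e t by (simp add: measure_def powr_realpow)
    then have "(LINT y|lborel. t powr \<alpha> * (2 * t) powr (- (\<alpha> + real CARD('n))) * indicator ?B y)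
       = t powr \<alpha> * ((2 * t) powr (- (\<alpha> + real CARD('n))) * (2 * t) powr real CARD('n))"
      by simp
    also have "(2 * t) powr (- (\<alpha> + real CARD('n))) * (2 * t) powr real CARD('n) = 2 powr - \<alpha> * t powr - \<alpha>"
      using t by (simp only: powr_add[symmetric]) (simp add: powr_mult)
    also have "t powr \<alpha> * (2 powr - \<alpha> * t powr - \<alpha>) = 2 powr - \<alpha>" 
      using t by (simp add: powr_minus)
    finally show ?thesis by simp
  qed
  also have "\<dots> \<le> (LINT y|lborel. pk \<alpha> t x y)"
  proof (rule integral_mono)
    show "integrable lborel (\<lambda>y. t powr \<alpha> * (2 * t) powr (- (\<alpha> + real CARD('n))) * indicator ?B y)"
      using e by (intro integrable_mult_right) (auto simp: integrable_indicator_iff)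
    show "integrable lborel (pk \<alpha> t x)" by (rule integrable_pk[OF t \<alpha>])
    show "t powr \<alpha> * (2 * t) powr (- (\<alpha> + real CARD('n))) * indicator ?B y \<le> pk \<alpha> t x y" for y
    proof (cases "y \<in> ?B")
      case True
      have "inverse ((2 * t) powr (\<alpha> + real CARD('n))) \<le> inverse ((t + linf (x - y)) powr (\<alpha> + real CARD('n)))"
        using t \<alpha> True
        by (intro le_imp_inverse_le powr_mono2) (auto simp: add_pos_nonneg order_less_imp_not_eq2)
      then show ?thesis using True t
        by (simp only: indicator_simps pk_def powr_minus divide_inverse mult_1_right) (simp add: mult_left_mono)
    qed simp
  qed
  finally show ?thesis .
qed

lemma one_minus_powr_le:
  fixes w :: real
  assumes "0 < w" "w \<le> 1" "1 \<le> g"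
  shows "1 - w powr g \<le> g * (1 - w)"
proof -
  have d: "((\<lambda>x. x powr g) has_real_derivative g * x powr (g - 1)) (at x)" if "w \<le> x" for x
    using that assms by (auto intro!: derivative_eq_intros)
  obtain z where z: "w \<le> z" "z \<le> 1" "1 powr g - w powr g = (1 - w) * (g * z powr (g - 1))"
  proof (cases "w = 1")
    case False
    then have "w < 1" using assms by simp
    then have "\<exists>z. w < z \<and> z < 1 \<and> 1 powr g - w powr g = (1 - w) * (g * z powr (g - 1))"
      by (intro MVT2) (auto intro: d)
    then show ?thesis using that by (auto intro: less_imp_le)
  qed (use that in auto)
  have "z powr (g - 1) \<le> 1" using z assms by (intro powr_le1) auto
  then have "(1 - w) * (g * z powr (g - 1)) \<le> (1 - w) * (g * 1)" 
    using assms by (intro mult_left_mono) auto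
  with z show ?thesis by (simp add: mult.commute)
qed

text \<open>With distances shifted by \<open>s\<close>, the two kernels have quotient
  \<open>(u / v) powr (\<alpha> + d)\<close>, and \<open>1 - u / v\<close> is at most
  \<open>linf (y - z) / s\<close>, a quantity whose exponent may be lowered to
  \<open>\<alpha>/2\<close> when it is at most 1. When it exceeds 1 the estimate is trivial, so it
  holds for all pairs and not only for nearby ones.\<close>

lemma pk_holder_aux:
  fixes x y z :: "real^'n"
  assumes s: "0 < s" and \<alpha>: "0 < \<alpha>" "\<alpha> \<le> 1" and le: "linf (x - y) \<le> linf (x - z)"
  shows "pk \<alpha> s x y - pk \<alpha> s x z \<le> (\<alpha> + real CARD('n)) * (linf (y - z) / s) powr (\<alpha>/2) * pk \<alpha> s x y"
proof -
  let ?g = "\<alpha> + real CARD('n)"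
  define u where "u = s + linf (x - y)"
  define v where "v = s + linf (x - z)"
  have "1 \<le> real CARD('n)" by (simp add: Suc_le_eq)
  then have g: "1 \<le> ?g" using \<alpha> by linarith
  have u: "0 < u" "u \<le> v" "s \<le> v" using s le by (auto simp: u_def v_def add_pos_nonneg)
  have "pk \<alpha> s x y - pk \<alpha> s x z = pk \<alpha> s x y * (1 - (u / v) powr ?g)"
    using u by (simp add: pk_def u_def[symmetric] v_def[symmetric] powr_divide right_diff_distrib)
  also have "\<dots> \<le> pk \<alpha> s x y * (?g * (linf (y - z) / s) powr (\<alpha>/2))"
  proof (intro mult_left_mono pk_nonneg)
    show "1 - (u / v) powr ?g \<le> ?g * (linf (y - z) / s) powr (\<alpha>/2)"
    proof (cases "linf (y - z) \<le> s")
    case True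
    have "1 - (u / v) powr ?g \<le> ?g * (1 - u / v)" using u g by (intro one_minus_powr_le) auto
    also have "1 - u / v = (v - u) / v" using u by (simp add: diff_divide_distrib)
    also have "(v - u) / v \<le> linf (y - z) / s" 
      using u s linf_triangle3[of x z y] by (intro frac_le) (auto simp: u_def v_def)
    also have "linf (y - z) / s = (linf (y - z) / s) powr 1" using s by simp
    also have "\<dots> \<le> (linf (y - z) / s) powr (\<alpha>/2)"
      using True s \<alpha> by (intro powr_mono') auto
    finally show ?thesis using g by simp
  next
    case False
    have "1 - (u / v) powr ?g \<le> 1" by simp
    also have "1 \<le> ?g * (linf (y - z) / s) powr (\<alpha>/2)"
      using False s \<alpha> g mult_mono[OF g ge_one_powr_ge_zero[of "linf (y - z) / s" "\<alpha>/2"]] by auto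
    finally show ?thesis .
    qed
  qed
  finally show ?thesis by (simp add: mult_ac) 
qed

lemma pk_holder:
  fixes x y z :: "real^'n"
  assumes s: "0 < s" and \<alpha>: "0 < \<alpha>" "\<alpha> \<le> 1"
  shows "\<bar>pk \<alpha> s x y - pk \<alpha> s x z\<bar> \<le> (\<alpha> + real CARD('n)) * (linf (y - z) / s) powr (\<alpha>/2) * (pk \<alpha> s x y + pk \<alpha> s x z)"
proof -
  have mono: "linf (x - b) \<le> linf (x - c) \<Longrightarrow> pk \<alpha> s x c \<le> pk \<alpha> s x b" for b c :: "real^'n"
    using s \<alpha> unfolding pk_def by (intro divide_left_mono powr_mono2 mult_pos_pos) (auto simp: add_pos_nonneg order_less_imp_not_eq2)
  have C: "0 \<le> (\<alpha> + real CARD('n)) * (linf (y - z) / s) powr (\<alpha>/2)" using \<alpha> by simp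
  show ?thesis
  proof (cases "linf (x - y) \<le> linf (x - z)")
    case True
    then show ?thesis using pk_holder_aux[OF assms True] mono[OF True] 
       mult_nonneg_nonneg[OF C pk_nonneg[of \<alpha> s x z]] by (simp add: distrib_left)
  next
    case False
    then have F: "linf (x - z) \<le> linf (x - y)" by simp
    then show ?thesis using pk_holder_aux[OF assms F] mono[OF F] 
       mult_nonneg_nonneg[OF C pk_nonneg[of \<alpha> s x y]] 
       by (simp add: distrib_left linf_minus_commute[of z y])
  qed
qed

section \<open>Integrals over the scales with respect to dt/t\<close>

lemma nn_integral_powr_near_0:
  fixes p b :: real
  assumes "0 < p" "0 < b"
  shows "(\<integral>\<^sup>+ t. ennreal ((t / p) powr b / t) * indicator {0<..<p} t \<partial>lborel) \<le> ennreal (1 / b)"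
proof -
  have "((\<lambda>t. t powr (b - 1) * p powr - b) has_integral (p powr (b - 1 + 1) / (b - 1 + 1) * p powr - b)) {0..p}"
    using assms by (intro has_integral_mult_left has_integral_powr_from_0) auto
  also have "p powr (b - 1 + 1) / (b - 1 + 1) * p powr - b = 1 / b"
    using assms by (simp add: powr_minus)
  finally have *: "((\<lambda>t. t powr (b - 1) * p powr - b) has_integral 1 / b) {0..p}" .
  have "(\<integral>\<^sup>+ t. ennreal ((t / p) powr b / t) * indicator {0<..<p} t \<partial>lborel) \<le>
    (\<integral>\<^sup>+ t. ennreal (t powr (b - 1) * p powr - b) * indicator {0..p} t \<partial>lborel)"
    using assms by (intro nn_integral_mono)
      (auto simp: indicator_def powr_divide powr_minus powr_diff field_simps intro!: ennreal_leI)
  also have "\<dots> = ennreal (1 / b)"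
    by (rule nn_integral_has_integral_lebesgue'[OF _ *]) simp
  finally show ?thesis .
qed

lemma nn_integral_powr_near_inf:
  fixes p b :: real
  assumes "0 < p" "0 < b"
  shows "(\<integral>\<^sup>+ t. ennreal ((p / t) powr b / t) * indicator {p..} t \<partial>lborel) \<le> ennreal (1 / b)"
proof -
  have "((\<lambda>t. t powr (-b - 1) * p powr b) has_integral (-(p powr (- b - 1 + 1)) / (- b - 1 + 1) * p powr b)) {p..}"
    using assms by (intro has_integral_mult_left has_integral_powr_to_inf) auto
  also have "-(p powr (- b - 1 + 1)) / (- b - 1 + 1) * p powr b = 1 / b"
    using assms by (simp add: powr_minus)
  finally have *: "((\<lambda>t. t powr (-b - 1) * p powr b) has_integral 1 / b) {p..}" .
  have "(\<integral>\<^sup>+ t. ennreal ((p / t) powr b / t) * indicator {p..} t \<partial>lborel) \<le>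
    (\<integral>\<^sup>+ t. ennreal (t powr (-b - 1) * p powr b) * indicator {p..} t \<partial>lborel)"
    using assms by (intro nn_integral_mono)
      (auto simp: indicator_def powr_divide powr_minus powr_diff field_simps intro!: ennreal_leI)
  also have "\<dots> = ennreal (1 / b)"
    by (rule nn_integral_has_integral_lebesgue'[OF _ *]) simp
  finally show ?thesis .
qed

section \<open>Almost orthogonality\<close>

lemma two_mult_le_squares: "2 * (x * y) \<le> x\<^sup>2 + (y::real)\<^sup>2"
  using sum_squares_bound[of x y] by (simp add: mult_ac)

text \<open>Let \<open>T h p = \<integral> \<rho> p h\<close>. The hypothesis \<open>row\<close> is the Schur test for \<open>T T\<^sup>*\<close>, and expanding
  \<open>0 \<le> \<parallel>h - T\<^sup>* T h / B\<parallel>\<^sup>2\<close> turns it into a bound for \<open>T\<close> without operator norms.\<close>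
theorem dual_schur_bound:
  fixes \<rho> :: "'a \<Rightarrow> 'b \<Rightarrow> real"
  assumes fin: "finite_measure M" and sig: "sigma_finite_measure N" and sp: "space M = UNIV"
    and meas [measurable]: "(\<lambda>w. \<rho> (fst w) (snd w)) \<in> borel_measurable (M \<Otimes>\<^sub>M N)"
    and bound: "\<And>p y. \<bar>\<rho> p y\<bar> \<le> c"
    and int: "\<And>p. (\<integral>\<^sup>+ y. ennreal \<bar>\<rho> p y\<bar> \<partial>N) \<le> ennreal c'" and c': "0 \<le> c'"
    and h: "integrable N h" "\<And>y. \<bar>h y\<bar> \<le> b"
    and row: "\<And>p. (\<integral>\<^sup>+ q. ennreal \<bar>LINT y|N. \<rho> p y * \<rho> q y\<bar> \<partial>M) \<le> ennreal B" and B: "0 < B"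
  shows "(\<integral>\<^sup>+ p. ennreal ((LINT y|N. \<rho> p y * h y)\<^sup>2) \<partial>M) \<le> ennreal (B * (LINT y|N. (h y)\<^sup>2))"
proof -
  interpret M: finite_measure M by fact
  interpret N: sigma_finite_measure N by fact
  interpret MN: pair_sigma_finite M N ..
  interpret MM: pair_sigma_finite M M ..
  interpret MM': finite_measure "M \<Otimes>\<^sub>M M" by (intro finite_measure_pair_measure) unfold_locales
  interpret MMN: pair_sigma_finite "M \<Otimes>\<^sub>M M" N ..
  have hm [measurable]: "h \<in> borel_measurable N" using h by auto
  have c0: "0 \<le> c" using bound[of undefined undefined] by linarith
  have b0: "0 \<le> b" using h(2)[of undefined] by linarith
  have \<rho>y [measurable]: "\<rho> p \<in> borel_measurable N" for p
    using measurable_compose[OF measurable_Pair1' meas, of p] sp by simp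
  have \<rho>_comp [measurable (raw)]: "(\<lambda>w. \<rho> (u w) (v w)) \<in> borel_measurable L"
    if "u \<in> L \<rightarrow>\<^sub>M M" "v \<in> L \<rightarrow>\<^sub>M N" for u v and L :: "('b \<times> 'a) measure"
    using measurable_compose[OF measurable_Pair[OF that] meas] by simp
  have \<rho>_comp' [measurable (raw)]: "(\<lambda>w. \<rho> (u w) (v w)) \<in> borel_measurable L"
    if "u \<in> L \<rightarrow>\<^sub>M M" "v \<in> L \<rightarrow>\<^sub>M N" for u v and L :: "(('a \<times> 'a) \<times> 'b) measure"
    using measurable_compose[OF measurable_Pair[OF that] meas] by simp
  have int_\<rho>: "integrable N (\<rho> p)" for p
    using int[of p] by (intro integrableI_bounded) (auto intro: le_less_trans)
  have abs_\<rho>: "(LINT y|N. \<bar>\<rho> p y\<bar>) \<le> c'" for p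
    using int[of p] c' int_\<rho>[of p] by (subst (asm) nn_integral_eq_integral) auto
  define F where "F p = (LINT y|N. \<rho> p y * h y)" for p
  have Fm [measurable]: "F \<in> borel_measurable M" unfolding F_def by measurable
  define f where "f = b * c'"
  have int_\<rho>h: "integrable N (\<lambda>y. \<rho> p y * h y)" for p
    using int_\<rho>[of p] by (rule Bochner_Integration.integrable_bound[OF integrable_mult_right[of b]])
      (auto simp: abs_mult mult.commute[of _ "\<bar>h _\<bar>"] b0 intro!: AE_I2 mult_right_mono h(2))
  have Fb: "\<bar>F p\<bar> \<le> f" for p
  proof -
    have "\<bar>F p\<bar> \<le> (LINT y|N. \<bar>\<rho> p y * h y\<bar>)" unfolding F_def by (rule integral_abs_bound)
    also have "\<dots> \<le> (LINT y|N. b * \<bar>\<rho> p y\<bar>)"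
      using integrable_abs[OF int_\<rho>h[of p]] int_\<rho>[of p]
      by (intro integral_mono) (auto simp: abs_mult mult.commute[of _ "\<bar>h _\<bar>"] b0 intro!: mult_right_mono h(2))
    also have "\<dots> \<le> f" using abs_\<rho>[of p] b0 by (simp add: f_def mult_left_mono)
    finally show ?thesis .
  qed
  have f0: "0 \<le> f" using b0 c' by (simp add: f_def)
  have int_F: "integrable M (\<lambda>p. F p * u p)" if [measurable]: "u \<in> borel_measurable M" and "\<And>p. \<bar>u p\<bar> \<le> k" for u k
    using that f0 by (intro M.integrable_const_bound[where B = "f * k"]) (auto simp: abs_mult intro!: AE_I2 mult_mono Fb)
  have \<rho>p [measurable]: "(\<lambda>p. \<rho> p y) \<in> borel_measurable M" if "y \<in> space N" for y
    using measurable_compose[OF measurable_Pair2' meas, of y] that by simp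
  \<comment> \<open>With \<open>F = T h\<close>, the function \<open>H\<close> is the adjoint of
    \<open>T\<close> applied to \<open>F\<close>, so that \<open>hH\<close> below is the identity
    \<open><h, H> = ||F||^2\<close>.\<close>
  define H where "H y = (LINT p|M. F p * \<rho> p y)" for y
  have Hm [measurable]: "H \<in> borel_measurable N" unfolding H_def by measurable
  define I where "I = (LINT p|M. (F p)\<^sup>2)"
  have int_F2: "integrable M (\<lambda>p. (F p)\<^sup>2)"
    unfolding power2_eq_square by (rule int_F[of _ f]) (auto intro: Fb)
  have I0: "0 \<le> I" unfolding I_def by simp

  have hH: "integrable N (\<lambda>y. h y * H y)" "(LINT y|N. h y * H y) = I"
  proof -
    have i: "integrable (M \<Otimes>\<^sub>M N) (\<lambda>w. F (fst w) * \<rho> (fst w) (snd w) * h (snd w))"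
    proof (rule MN.Fubini_integrable)
      show "AE p in M. integrable N (\<lambda>y. F (fst (p, y)) * \<rho> (fst (p, y)) (snd (p, y)) * h (snd (p, y)))"
        using int_\<rho>h by (auto simp: mult.assoc)
      show "integrable M (\<lambda>p. LINT y|N. norm (F (fst (p, y)) * \<rho> (fst (p, y)) (snd (p, y)) * h (snd (p, y))))"
      proof (rule M.integrable_const_bound[where B = "f * f"])
        show "AE p in M. norm (LINT y|N. norm (F (fst (p, y)) * \<rho> (fst (p, y)) (snd (p, y)) * h (snd (p, y)))) \<le> f * f"
        proof (rule AE_I2)
          fix p
          have "norm (LINT y|N. norm (F (fst (p, y)) * \<rho> (fst (p, y)) (snd (p, y)) * h (snd (p, y)))) =
            (LINT y|N. \<bar>F p\<bar> * \<bar>\<rho> p y * h y\<bar>)" by (simp add: abs_mult mult.assoc)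
          also have "\<dots> = \<bar>F p\<bar> * (LINT y|N. \<bar>\<rho> p y * h y\<bar>)" by simp
          also have "\<dots> \<le> f * f"
          proof (intro mult_mono Fb f0)
            have "(LINT y|N. \<bar>\<rho> p y * h y\<bar>) \<le> (LINT y|N. b * \<bar>\<rho> p y\<bar>)"
              using integrable_abs[OF int_\<rho>h[of p]] int_\<rho>[of p]
              by (intro integral_mono) (auto simp: abs_mult mult.commute[of _ "\<bar>h _\<bar>"] b0 intro!: mult_right_mono h(2))
            also have "\<dots> \<le> f" using abs_\<rho>[of p] b0 by (simp add: f_def mult_left_mono)
            finally show "(LINT y|N. \<bar>\<rho> p y * h y\<bar>) \<le> f" .
          qed auto
          finally show "norm (LINT y|N. norm (F (fst (p, y)) * \<rho> (fst (p, y)) (snd (p, y)) * h (snd (p, y)))) \<le> f * f" .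
        qed
      qed measurable
    qed measurable
    have hHeq: "h y * H y = (LINT p|M. F p * \<rho> p y * h y)" for y
      unfolding H_def by (simp add: mult.commute)
    show "integrable N (\<lambda>y. h y * H y)"
      using MN.integrable_snd[of "\<lambda>p y. F p * \<rho> p y * h y"] i unfolding hHeq by (simp add: case_prod_beta')
    have "(LINT y|N. h y * H y) = (LINT p|M. LINT y|N. F p * \<rho> p y * h y)"
      unfolding hHeq using MN.Fubini_integral[of "\<lambda>p y. F p * \<rho> p y * h y"] i by (simp add: case_prod_beta')
    also have "\<dots> = I" unfolding I_def F_def by (simp add: power2_eq_square mult.assoc)
    finally show "(LINT y|N. h y * H y) = I" .
  qed

  \<comment> \<open>Expanding the square of \<open>H\<close> as a double integral and integrating in
    \<open>y\<close> first leaves \<open>K\<close>, the kernel of \<open>T\<close> times its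
    adjoint, which is what \<open>row\<close> controls.\<close>
  define \<Phi> where "\<Phi> w = F (fst (fst w)) * F (snd (fst w)) * (\<rho> (fst (fst w)) (snd w) * \<rho> (snd (fst w)) (snd w))" for w
  have \<Phi>m [measurable]: "\<Phi> \<in> borel_measurable ((M \<Otimes>\<^sub>M M) \<Otimes>\<^sub>M N)" unfolding \<Phi>_def by measurable
  define K where "K p q = (LINT y|N. \<rho> p y * \<rho> q y)" for p q
  have Km [measurable]: "(\<lambda>w. K (fst w) (snd w)) \<in> borel_measurable (M \<Otimes>\<^sub>M M)" unfolding K_def by measurable
  have int_\<rho>\<rho>: "integrable N (\<lambda>y. \<rho> p y * \<rho> q y)" for p q
    using int_\<rho>[of p] by (rule Bochner_Integration.integrable_bound[OF integrable_mult_right[of c]])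
      (auto simp: abs_mult mult.commute[of _ "\<bar>\<rho> q _\<bar>"] c0 intro!: AE_I2 mult_right_mono bound)
  have abs_\<rho>\<rho>: "(LINT y|N. \<bar>\<rho> p y * \<rho> q y\<bar>) \<le> c * c'" for p q
  proof -
    have "(LINT y|N. \<bar>\<rho> p y * \<rho> q y\<bar>) \<le> (LINT y|N. c * \<bar>\<rho> p y\<bar>)"
      using integrable_abs[OF int_\<rho>\<rho>[of p q]] int_\<rho>[of p]
      by (intro integral_mono) (auto simp: abs_mult mult.commute[of _ "\<bar>\<rho> q _\<bar>"] c0 intro!: mult_right_mono bound)
    also have "\<dots> \<le> c * c'" using abs_\<rho>[of p] c0 by (simp add: mult_left_mono)
    finally show ?thesis .
  qed
  have int_\<Phi>: "integrable ((M \<Otimes>\<^sub>M M) \<Otimes>\<^sub>M N) \<Phi>"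
  proof (rule MMN.Fubini_integrable[OF \<Phi>m])
    show "AE x in M \<Otimes>\<^sub>M M. integrable N (\<lambda>y. \<Phi> (x, y))"
      unfolding \<Phi>_def using int_\<rho>\<rho> by auto
    show "integrable (M \<Otimes>\<^sub>M M) (\<lambda>x. LINT y|N. norm (\<Phi> (x, y)))"
    proof (rule MM'.integrable_const_bound[where B = "f * f * (c * c')"])
      show "AE x in M \<Otimes>\<^sub>M M. norm (LINT y|N. norm (\<Phi> (x, y))) \<le> f * f * (c * c')"
      proof (rule AE_I2)
        fix x :: "'a \<times> 'a"
        have "norm (LINT y|N. norm (\<Phi> (x, y))) = (LINT y|N. \<bar>F (fst x)\<bar> * \<bar>F (snd x)\<bar> * \<bar>\<rho> (fst x) y * \<rho> (snd x) y\<bar>)"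
          unfolding \<Phi>_def by (simp add: abs_mult)
        also have "\<dots> = \<bar>F (fst x)\<bar> * \<bar>F (snd x)\<bar> * (LINT y|N. \<bar>\<rho> (fst x) y * \<rho> (snd x) y\<bar>)" by simp
        also have "\<dots> \<le> f * f * (c * c')" by (intro mult_mono Fb abs_\<rho>\<rho>) (auto simp: f0)
        finally show "norm (LINT y|N. norm (\<Phi> (x, y))) \<le> f * f * (c * c')" .
      qed
    qed measurable
  qed
  have H2eq: "(H y)\<^sup>2 = (LINT x|(M \<Otimes>\<^sub>M M). \<Phi> (x, y))" if y: "y \<in> space N" for y
  proof -
    have [measurable]: "(\<lambda>p. \<rho> p y) \<in> borel_measurable M" using y by (rule \<rho>p)
    have i: "integrable (M \<Otimes>\<^sub>M M) (\<lambda>x. (F (fst x) * \<rho> (fst x) y) * (F (snd x) * \<rho> (snd x) y))"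
      by (rule MM'.integrable_const_bound[where B = "(f * c) * (f * c)"])
         (auto simp: abs_mult c0 f0 intro!: AE_I2 mult_mono Fb bound)
    have "(LINT x|(M \<Otimes>\<^sub>M M). \<Phi> (x, y)) = (LINT x|(M \<Otimes>\<^sub>M M). (F (fst x) * \<rho> (fst x) y) * (F (snd x) * \<rho> (snd x) y))"
      unfolding \<Phi>_def by (simp add: mult_ac)
    also have "\<dots> = (LINT p|M. LINT q|M. (F p * \<rho> p y) * (F q * \<rho> q y))"
      using MM.integral_fst'[OF i] by simp
    also have "\<dots> = H y * H y" unfolding H_def by simp
    finally show ?thesis by (simp add: power2_eq_square)
  qed
  have int_H2: "integrable N (\<lambda>y. (H y)\<^sup>2)"
    using MMN.integrable_snd[of "\<lambda>x y. \<Phi> (x, y)"] int_\<Phi>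
    by (subst Bochner_Integration.integrable_cong[OF refl H2eq]) auto
  have "(LINT y|N. (H y)\<^sup>2) = (LINT y|N. LINT x|(M \<Otimes>\<^sub>M M). \<Phi> (x, y))"
    by (intro Bochner_Integration.integral_cong H2eq) auto
  also have "\<dots> = (LINT x|(M \<Otimes>\<^sub>M M). LINT y|N. \<Phi> (x, y))"
    using MMN.Fubini_integral[of "\<lambda>x y. \<Phi> (x, y)"] int_\<Phi> by simp
  also have "\<dots> = (LINT x|(M \<Otimes>\<^sub>M M). F (fst x) * F (snd x) * K (fst x) (snd x))"
    unfolding \<Phi>_def K_def by simp
  also have "ennreal \<dots> \<le> (\<integral>\<^sup>+ x. ennreal (norm (F (fst x) * F (snd x) * K (fst x) (snd x))) \<partial>(M \<Otimes>\<^sub>M M))"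
  proof -
    have "integrable (M \<Otimes>\<^sub>M M) (\<lambda>x. F (fst x) * F (snd x) * K (fst x) (snd x))"
      using MMN.integrable_fst'[OF int_\<Phi>] unfolding \<Phi>_def K_def by simp
    from integral_norm_bound_ennreal[OF this] show ?thesis
      by (rule order_trans[rotated]) (auto intro: ennreal_leI)
  qed
  \<comment> \<open>The product \<open>F p * F q\<close> is at most half the sum of the squares; by
    the symmetry of \<open>K\<close> both halves can then be integrated by
    \<open>row\<close>.\<close>
  also have "\<dots> \<le> (\<integral>\<^sup>+ x. ennreal ((F (fst x))\<^sup>2 / 2) * ennreal \<bar>K (fst x) (snd x)\<bar>
       + ennreal ((F (snd x))\<^sup>2 / 2) * ennreal \<bar>K (fst x) (snd x)\<bar> \<partial>(M \<Otimes>\<^sub>M M))"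
  proof (rule nn_integral_mono)
    fix x :: "'a \<times> 'a"
    have "norm (F (fst x) * F (snd x) * K (fst x) (snd x)) \<le> ((F (fst x))\<^sup>2 / 2 + (F (snd x))\<^sup>2 / 2) * \<bar>K (fst x) (snd x)\<bar>"
      using two_mult_le_squares[of "\<bar>F (fst x)\<bar>" "\<bar>F (snd x)\<bar>"] by (auto simp: abs_mult intro!: mult_right_mono)
    then show "ennreal (norm (F (fst x) * F (snd x) * K (fst x) (snd x))) \<le> ennreal ((F (fst x))\<^sup>2 / 2) * ennreal \<bar>K (fst x) (snd x)\<bar>
       + ennreal ((F (snd x))\<^sup>2 / 2) * ennreal \<bar>K (fst x) (snd x)\<bar>"
      by (simp add: distrib_right ennreal_leI flip: ennreal_mult ennreal_plus)
  qed
  also have "\<dots> = (\<integral>\<^sup>+ p. ennreal ((F p)\<^sup>2 / 2) * (\<integral>\<^sup>+ q. ennreal \<bar>K p q\<bar> \<partial>M) \<partial>M) +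
      (\<integral>\<^sup>+ q. ennreal ((F q)\<^sup>2 / 2) * (\<integral>\<^sup>+ p. ennreal \<bar>K p q\<bar> \<partial>M) \<partial>M)"
  proof -
    have *: "(\<lambda>q. ennreal \<bar>K p q\<bar>) \<in> borel_measurable M" "(\<lambda>q. ennreal \<bar>K q p\<bar>) \<in> borel_measurable M" for p
      unfolding K_def by (auto)
    have "(\<integral>\<^sup>+ x. ennreal ((F (fst x))\<^sup>2 / 2) * ennreal \<bar>K (fst x) (snd x)\<bar> \<partial>(M \<Otimes>\<^sub>M M)) =
      (\<integral>\<^sup>+ p. ennreal ((F p)\<^sup>2 / 2) * (\<integral>\<^sup>+ q. ennreal \<bar>K p q\<bar> \<partial>M) \<partial>M)"
      by (subst M.nn_integral_fst[symmetric], measurable) (simp add: nn_integral_cmult *)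
    moreover have "(\<integral>\<^sup>+ x. ennreal ((F (snd x))\<^sup>2 / 2) * ennreal \<bar>K (fst x) (snd x)\<bar> \<partial>(M \<Otimes>\<^sub>M M)) =
      (\<integral>\<^sup>+ q. ennreal ((F q)\<^sup>2 / 2) * (\<integral>\<^sup>+ p. ennreal \<bar>K p q\<bar> \<partial>M) \<partial>M)"
      by (subst MM.nn_integral_snd[symmetric], measurable) (simp add: nn_integral_cmult *)
    ultimately show ?thesis
      by (subst nn_integral_add) auto
  qed
  also have "\<dots> \<le> (\<integral>\<^sup>+ p. ennreal ((F p)\<^sup>2 / 2) * ennreal B \<partial>M) + (\<integral>\<^sup>+ q. ennreal ((F q)\<^sup>2 / 2) * ennreal B \<partial>M)"
  proof (intro add_mono nn_integral_mono mult_left_mono)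
    show "(\<integral>\<^sup>+ q. ennreal \<bar>K p q\<bar> \<partial>M) \<le> ennreal B" for p using row[of p] by (simp add: K_def)
    show "(\<integral>\<^sup>+ p. ennreal \<bar>K p q\<bar> \<partial>M) \<le> ennreal B" for q using row[of q] by (simp add: K_def mult.commute)
  qed auto
  also have "\<dots> = ennreal (B * I)"
  proof -
    have "(\<integral>\<^sup>+ p. ennreal ((F p)\<^sup>2 / 2) * ennreal B \<partial>M) = ennreal (I / 2 * B)"
    proof -
      have "(\<integral>\<^sup>+ p. ennreal ((F p)\<^sup>2 / 2) \<partial>M) = ennreal (I / 2)"
        using int_F2 unfolding I_def by (subst nn_integral_eq_integral) auto
      then have "(\<integral>\<^sup>+ p. ennreal ((F p)\<^sup>2 / 2) * ennreal B \<partial>M) = ennreal (I / 2) * ennreal B"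
        by (subst nn_integral_multc) auto
      then show ?thesis using B I0 ennreal_mult[of "I / 2" B] by simp
    qed
    then show ?thesis using I0 B by (simp flip: ennreal_plus)
  qed
  finally have HB: "(LINT y|N. (H y)\<^sup>2) \<le> B * I" using I0 B by simp

  have int_h2: "integrable N (\<lambda>y. (h y)\<^sup>2)"
    using h(1)
  proof (rule Bochner_Integration.integrable_bound[OF integrable_mult_right[of b]])
    have "norm ((h y)\<^sup>2) \<le> norm (b * h y)" for y
      using mult_right_mono[OF h(2)[of y], of "\<bar>h y\<bar>"] b0 by (simp add: power2_eq_square abs_mult)
    then show "AE y in N. norm ((h y)\<^sup>2) \<le> norm (b * h y)" by simp
  qed auto
  \<comment> \<open>The expansion of the squared norm of \<open>h - H / B\<close>: the cross term is
    a multiple of \<open>I\<close> by \<open>hH\<close>, the last term is at most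
    \<open>I / B\<close> by \<open>HB\<close>, so \<open>I / B\<close> is at most the squared norm
    of \<open>h\<close>.\<close>
  have eq: "(h y - H y / B)\<^sup>2 = (h y)\<^sup>2 - (2 / B) * (h y * H y) + (1 / B\<^sup>2) * (H y)\<^sup>2" for y
    by (simp add: power2_diff power_divide)
  have "0 \<le> (LINT y|N. (h y - H y / B)\<^sup>2)" by simp
  also have "\<dots> = (LINT y|N. (h y)\<^sup>2) - (2 / B) * I + (1 / B\<^sup>2) * (LINT y|N. (H y)\<^sup>2)"
    unfolding eq using int_h2 int_H2 hH by (simp add: Bochner_Integration.integral_add Bochner_Integration.integral_diff)
  also have "\<dots> \<le> (LINT y|N. (h y)\<^sup>2) - (2 / B) * I + (1 / B\<^sup>2) * (B * I)"
    using HB B by (intro add_left_mono mult_left_mono) auto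
  also have "\<dots> = (LINT y|N. (h y)\<^sup>2) - I / B" using B by (simp add: power2_eq_square field_simps)
  finally have "I \<le> B * (LINT y|N. (h y)\<^sup>2)" using B by (simp add: field_simps)
  moreover have "(\<integral>\<^sup>+ p. ennreal ((LINT y|N. \<rho> p y * h y)\<^sup>2) \<partial>M) = ennreal I"
    unfolding I_def F_def[symmetric] using int_F2 by (subst nn_integral_eq_integral) auto
  ultimately show ?thesis by (simp add: ennreal_leI)
qed

text \<open>Tonelli, integrating first in a variable that occurs in only one factor. The three
  shapes are those left by \<open>pairing_pointwise\<close> in its two orientations.\<close>

lemma nn_integral_pk_pk:
  fixes x :: "real^'n"
  assumes "0 < t" "0 < s" "0 < \<beta>" "0 < \<gamma>"
  defines "C \<equiv> ennreal (pk_const CARD('n) \<beta> * pk_const CARD('n) \<gamma>)"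
  shows "(\<integral>\<^sup>+ z. \<integral>\<^sup>+ y. ennreal (pk \<beta> t z y * pk \<gamma> s x y) \<partial>lborel \<partial>lborel) \<le> C"
    and "(\<integral>\<^sup>+ z. \<integral>\<^sup>+ y. ennreal (pk \<beta> t z y * pk \<gamma> s x z) \<partial>lborel \<partial>lborel) \<le> C"
    and "(\<integral>\<^sup>+ z. \<integral>\<^sup>+ y. ennreal (pk \<beta> s x y * pk \<gamma> t z x) \<partial>lborel \<partial>lborel) \<le> C"
proof -
  have C: "C = ennreal (pk_const CARD('n) \<beta>) * ennreal (pk_const CARD('n) \<gamma>)"
    using assms pk_const_pos[of \<beta> "CARD('n)"] pk_const_pos[of \<gamma> "CARD('n)"] by (simp add: ennreal_mult)
  have m: "(\<lambda>w. ennreal (pk \<beta> t (snd w) (fst w) * pk \<gamma> s x (fst w))) \<in> 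
    borel_measurable (lborel \<Otimes>\<^sub>M (lborel :: (real^'n) measure))" 
    by measurable
  have "(\<integral>\<^sup>+ z. \<integral>\<^sup>+ y. ennreal (pk \<beta> t z y * pk \<gamma> s x y) \<partial>lborel \<partial>lborel)
     = (\<integral>\<^sup>+ y. \<integral>\<^sup>+ z. ennreal (pk \<beta> t z y * pk \<gamma> s x y) \<partial>lborel \<partial>lborel)"
    using lborel_pair.Fubini'[of "\<lambda>y z. ennreal (pk \<beta> t z y * pk \<gamma> s x y)"] m by (simp add: case_prod_beta')
  also have "\<dots> = (\<integral>\<^sup>+ y. (\<integral>\<^sup>+ z. ennreal (pk \<beta> t z y) \<partial>lborel) * ennreal (pk \<gamma> s x y) \<partial>lborel)"
    by (simp add: ennreal_mult nn_integral_multc)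
  also have "\<dots> \<le> (\<integral>\<^sup>+ y. ennreal (pk_const CARD('n) \<beta>) * ennreal (pk \<gamma> s x y) \<partial>lborel)"
    using assms by (intro nn_integral_mono mult_right_mono nn_integral_pk') auto
  also have "\<dots> \<le> C" unfolding C using assms nn_integral_pk[of s \<gamma> x]
    by (subst nn_integral_cmult) (auto intro!: mult_left_mono)
  finally show "(\<integral>\<^sup>+ z. \<integral>\<^sup>+ y. ennreal (pk \<beta> t z y * pk \<gamma> s x y) \<partial>lborel \<partial>lborel) \<le> C" .
  have "(\<integral>\<^sup>+ z. \<integral>\<^sup>+ y. ennreal (pk \<beta> t z y * pk \<gamma> s x z) \<partial>lborel \<partial>lborel)
     = (\<integral>\<^sup>+ z. (\<integral>\<^sup>+ y. ennreal (pk \<beta> t z y) \<partial>lborel) * ennreal (pk \<gamma> s x z) \<partial>lborel)"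
    by (simp add: ennreal_mult nn_integral_multc)
  also have "\<dots> \<le> (\<integral>\<^sup>+ y. ennreal (pk_const CARD('n) \<beta>) * ennreal (pk \<gamma> s x y) \<partial>lborel)"
    using assms by (intro nn_integral_mono mult_right_mono nn_integral_pk) auto
  also have "\<dots> \<le> C" unfolding C using assms nn_integral_pk[of s \<gamma> x]
    by (subst nn_integral_cmult) (auto intro!: mult_left_mono)
  finally show "(\<integral>\<^sup>+ z. \<integral>\<^sup>+ y. ennreal (pk \<beta> t z y * pk \<gamma> s x z) \<partial>lborel \<partial>lborel) \<le> C" .
  have "(\<integral>\<^sup>+ z. \<integral>\<^sup>+ y. ennreal (pk \<beta> s x y * pk \<gamma> t z x) \<partial>lborel \<partial>lborel)
     = (\<integral>\<^sup>+ z. (\<integral>\<^sup>+ y. ennreal (pk \<beta> s x y) \<partial>lborel) * ennreal (pk \<gamma> t z x) \<partial>lborel)"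
    by (simp add: ennreal_mult nn_integral_multc)
  also have "\<dots> \<le> (\<integral>\<^sup>+ y. ennreal (pk_const CARD('n) \<beta>) * ennreal (pk \<gamma> t y x) \<partial>lborel)"
    using assms by (intro nn_integral_mono mult_right_mono nn_integral_pk) auto
  also have "\<dots> \<le> C" unfolding C using assms nn_integral_pk'[of t \<gamma> x]
    by (subst nn_integral_cmult) (auto intro!: mult_left_mono)
  finally show "(\<integral>\<^sup>+ z. \<integral>\<^sup>+ y. ennreal (pk \<beta> s x y * pk \<gamma> t z x) \<partial>lborel \<partial>lborel) \<le> C" .
qed

text \<open>\<open>8 / \<alpha>\<close> is 2 for the two terms of \<open>pairing_pointwise\<close>
  times \<open>4 / \<alpha>\<close> for the two halves \<open>t < s\<close> and
  \<open>t \<ge> s\<close> of the scale integral with exponent \<open>\<alpha>/2\<close>; the square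
  of the kernel constant is kept outside.\<close>

definition L2_const :: "nat \<Rightarrow> real \<Rightarrow> real" where
  "L2_const d \<alpha> = 8 / \<alpha> * (pk_const d (\<alpha>/2) * pk_const d \<alpha>)"

lemma L2_const_pos: "0 < \<alpha> \<Longrightarrow> 0 < L2_const d \<alpha>"
  by (simp add: L2_const_def pk_const_pos)

text \<open>An axiomatisation of the mean-zero remainder rather than of \<open>k\<close>. Its
  continuity in the second variable has exponent \<open>\<alpha>/2\<close> and holds for all pairs,
  in the form in which \<open>pk_holder\<close> delivers it and \<open>pk_moment\<close> consumes
  it.\<close>

locale cancellative_kernel =
  fixes r :: "real \<Rightarrow> real^'n \<Rightarrow> real^'n \<Rightarrow> real" and \<alpha> A :: real
  assumes \<alpha>: "0 < \<alpha>" "\<alpha> \<le> 1" and A: "0 < A"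
    and meas: "(\<lambda>p. r (fst p) (fst (snd p)) (snd (snd p))) \<in> borel_measurable borel"
    and size: "\<And>t x y. 0 < t \<Longrightarrow> \<bar>r t x y\<bar> \<le> A * pk \<alpha> t x y"
    and holder: "\<And>t x y z. 0 < t \<Longrightarrow>
       \<bar>r t x y - r t x z\<bar> \<le> A * (linf (y - z) / t) powr (\<alpha>/2) * (pk \<alpha> t x y + pk \<alpha> t x z)"
    and canc: "\<And>t x. 0 < t \<Longrightarrow> (LINT y|lborel. r t x y) = 0"
begin

lemma measurable_r [measurable (raw)]:
  assumes "f \<in> borel_measurable M" "g \<in> M \<rightarrow>\<^sub>M borel" "h \<in> M \<rightarrow>\<^sub>M borel"
  shows "(\<lambda>w. r (f w) (g w) (h w)) \<in> borel_measurable M"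
proof -
  have "(\<lambda>w. (f w, g w, h w)) \<in> M \<rightarrow>\<^sub>M borel"
    unfolding borel_prod[symmetric] using assms by measurable
  from measurable_compose[OF this meas] show ?thesis by simp
qed

lemma integrable_r: "0 < t \<Longrightarrow> integrable lborel (r t x)"
  using \<alpha> A by (intro Bochner_Integration.integrable_bound[OF integrable_mult_right[OF integrable_pk[of t \<alpha> x], of A]])
    (auto simp: size)

lemma r_le: "0 < t \<Longrightarrow> \<bar>r t x y\<bar> \<le> A * t powr - real CARD('n)"
  using order_trans[OF size mult_left_mono[OF pk_le]] A \<alpha> by simp

lemma integrable_r_mult:
  assumes "0 < t" "integrable lborel u" "\<And>y. \<bar>u y\<bar> \<le> c"
  shows "integrable lborel (\<lambda>y. r t x y * u y)"
  using integrable_r[OF assms(1), of x]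
proof (rule Bochner_Integration.integrable_bound[OF integrable_mult_right[of c]])
  have "\<bar>u y\<bar> * \<bar>r t x y\<bar> \<le> \<bar>c\<bar> * \<bar>r t x y\<bar>" for y
    using assms(3)[of y] by (intro mult_right_mono) auto
  then show "AE y in lborel. norm (r t x y * u y) \<le> norm (c * r t x y)"
    by (simp add: abs_mult mult.commute)
qed (use assms in auto)

text \<open>The integral of \<open>r t z\<close> vanishes, so \<open>r s x\<close> may be replaced
  by its increment from the point \<open>z\<close> at which the other kernel is centred. Continuity
  at scale \<open>s\<close> and the moment of \<open>pk\<close> at scale \<open>t\<close> then give
  the factor \<open>(t / s) powr (\<alpha>/2)\<close>, useful when \<open>t < s\<close>.\<close>

lemma pairing_pointwise:
  assumes s: "0 < s" and t: "0 < t"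
  shows "ennreal \<bar>LINT y|lborel. r s x y * r t z y\<bar> \<le>
    (\<integral>\<^sup>+ y. ennreal (A\<^sup>2 * (t / s) powr (\<alpha>/2) * (pk (\<alpha>/2) t z y * pk \<alpha> s x y + pk (\<alpha>/2) t z y * pk \<alpha> s x z)) \<partial>lborel)"
proof -
  have i: "integrable lborel (\<lambda>y. r s x y * r t z y)"
    using r_le[OF t] by (intro integrable_r_mult[OF s integrable_r[OF t]]) 
  have "(LINT y|lborel. r s x y * r t z y) = (LINT y|lborel. r s x y * r t z y) - r s x z * (LINT y|lborel. r t z y)"
    using canc[OF t] by simp
  also have "\<dots> = (LINT y|lborel. (r s x y - r s x z) * r t z y)"
    using i integrable_r[OF t, of z] by (simp add: left_diff_distrib)
  finally have eq: "(LINT y|lborel. r s x y * r t z y) = (LINT y|lborel. (r s x y - r s x z) * r t z y)" .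
  have "integrable lborel (\<lambda>y. (r s x y - r s x z) * r t z y)"
    using i integrable_r[OF t, of z] by (simp add: left_diff_distrib)
  from integral_norm_bound_ennreal[OF this]
  have "ennreal \<bar>LINT y|lborel. r s x y * r t z y\<bar> \<le> (\<integral>\<^sup>+ y. ennreal \<bar>(r s x y - r s x z) * r t z y\<bar> \<partial>lborel)"
    by (simp add: eq)
  also have "\<dots> \<le> (\<integral>\<^sup>+ y. ennreal (A\<^sup>2 * (t / s) powr (\<alpha>/2) * (pk (\<alpha>/2) t z y * pk \<alpha> s x y + pk (\<alpha>/2) t z y * pk \<alpha> s x z)) \<partial>lborel)"
  proof (intro nn_integral_mono ennreal_leI)
    fix y
    have "\<bar>(r s x y - r s x z) * r t z y\<bar> \<le> (A * (linf (y - z) / s) powr (\<alpha>/2) * (pk \<alpha> s x y + pk \<alpha> s x z)) * (A * pk \<alpha> t z y)"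
      unfolding abs_mult using A by (intro mult_mono holder size s t) auto
    also have "\<dots> = A\<^sup>2 * s powr - (\<alpha>/2) * (pk \<alpha> s x y + pk \<alpha> s x z) * (linf (z - y) powr (\<alpha>/2) * pk \<alpha> t z y)"
    proof -
      have e: "(linf (y - z) / s) powr (\<alpha>/2) = s powr - (\<alpha>/2) * linf (z - y) powr (\<alpha>/2)"
        using s by (simp add: powr_divide powr_minus_divide linf_minus_commute[of y])
      show ?thesis unfolding e power2_eq_square by (simp only: mult_ac)
    qed
    also have "\<dots> \<le> A\<^sup>2 * s powr - (\<alpha>/2) * (pk \<alpha> s x y + pk \<alpha> s x z) * (t powr (\<alpha>/2) * pk (\<alpha>/2) t z y)"
      using A \<alpha> t by (intro mult_left_mono pk_moment) auto
    also have "\<dots> = A\<^sup>2 * (t / s) powr (\<alpha>/2) * (pk (\<alpha>/2) t z y * pk \<alpha> s x y + pk (\<alpha>/2) t z y * pk \<alpha> s x z)"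
    proof -
      have e: "(t / s) powr (\<alpha>/2) = s powr - (\<alpha>/2) * t powr (\<alpha>/2)"
        using s t by (simp add: powr_divide powr_minus_divide)
      show ?thesis unfolding e by (simp only: distrib_left distrib_right mult_ac)
    qed
    finally show "\<bar>(r s x y - r s x z) * r t z y\<bar> \<le> \<dots>" .
  qed
  finally show ?thesis .
qed

lemma pairing_row:
  assumes s: "0 < s" and t: "0 < t"
  shows "(\<integral>\<^sup>+ z. ennreal \<bar>LINT y|lborel. r s x y * r t z y\<bar> \<partial>lborel)
     \<le> ennreal (2 * A\<^sup>2 * (pk_const CARD('n) (\<alpha>/2) * pk_const CARD('n) \<alpha>)) * ennreal ((t / s) powr (\<alpha>/2))" (is ?A)
  and "(\<integral>\<^sup>+ z. ennreal \<bar>LINT y|lborel. r s x y * r t z y\<bar> \<partial>lborel)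
     \<le> ennreal (2 * A\<^sup>2 * (pk_const CARD('n) (\<alpha>/2) * pk_const CARD('n) \<alpha>)) * ennreal ((s / t) powr (\<alpha>/2))" (is ?B)
proof -
  define P where "P = pk_const CARD('n) (\<alpha>/2) * pk_const CARD('n) \<alpha>"
  have P: "0 \<le> P" unfolding P_def using \<alpha> pk_const_pos[of "\<alpha>/2" "CARD('n)"] pk_const_pos[of \<alpha> "CARD('n)"] by simp
  have split: "(\<integral>\<^sup>+ z. \<integral>\<^sup>+ y. ennreal (c * (u z y + v z y)) \<partial>lborel \<partial>lborel) \<le> ennreal c * (ennreal P + ennreal P)"
    if c: "0 \<le> c" and u: "\<And>z y. 0 \<le> u z y" "\<And>z y. 0 \<le> v z y"
    and [measurable]: "(\<lambda>w. u (fst w) (snd w)) \<in> borel_measurable (borel \<Otimes>\<^sub>M borel)"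
      "(\<lambda>w. v (fst w) (snd w)) \<in> borel_measurable (borel \<Otimes>\<^sub>M borel)"
    and b: "(\<integral>\<^sup>+ z. \<integral>\<^sup>+ y. ennreal (u z y) \<partial>lborel \<partial>lborel) \<le> ennreal P"
       "(\<integral>\<^sup>+ z. \<integral>\<^sup>+ y. ennreal (v z y) \<partial>lborel \<partial>lborel) \<le> ennreal P"
    for c and u v :: "real^'n \<Rightarrow> real^'n \<Rightarrow> real"
  proof -
    have [measurable]: "u z \<in> borel_measurable borel" "v z \<in> borel_measurable borel" for z 
      using measurable_compose[OF measurable_Pair1'[of z borel borel] that(4)] 
        measurable_compose[OF measurable_Pair1'[of z borel borel] that(5)] by auto
    have "(\<integral>\<^sup>+ z. \<integral>\<^sup>+ y. ennreal (c * (u z y + v z y)) \<partial>lborel \<partial>lborel) 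
      = (\<integral>\<^sup>+ z. ennreal c * ((\<integral>\<^sup>+ y. ennreal (u z y) \<partial>lborel) + (\<integral>\<^sup>+ y. ennreal (v z y) \<partial>lborel)) \<partial>lborel)"
      using c u by (simp add: ennreal_mult nn_integral_cmult ennreal_plus nn_integral_add)
    also have "\<dots> = ennreal c * ((\<integral>\<^sup>+ z. \<integral>\<^sup>+ y. ennreal (u z y) \<partial>lborel \<partial>lborel) + (\<integral>\<^sup>+ z. \<integral>\<^sup>+ y. ennreal (v z y) \<partial>lborel \<partial>lborel))"
      by (subst nn_integral_cmult, measurable) (subst nn_integral_add, auto)
    also have "\<dots> \<le> ennreal c * (ennreal P + ennreal P)" by (intro mult_left_mono add_mono b) auto
    finally show ?thesis .
  qed
  have fin: "ennreal (A\<^sup>2 * q) * (ennreal P + ennreal P) = ennreal (2 * A\<^sup>2 * P) * ennreal q" if "0 \<le> q" for q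
    using P that by (simp flip: ennreal_plus ennreal_mult add: mult_ac)
  have "(\<integral>\<^sup>+ z. ennreal \<bar>LINT y|lborel. r s x y * r t z y\<bar> \<partial>lborel) \<le> 
    (\<integral>\<^sup>+ z. \<integral>\<^sup>+ y. ennreal (A\<^sup>2 * (t / s) powr (\<alpha>/2) * (pk (\<alpha>/2) t z y * pk \<alpha> s x y + pk (\<alpha>/2) t z y * pk \<alpha> s x z)) \<partial>lborel \<partial>lborel)"
    by (intro nn_integral_mono pairing_pointwise s t)
  also have "\<dots> \<le> ennreal (A\<^sup>2 * (t / s) powr (\<alpha>/2)) * (ennreal P + ennreal P)"
    using s t \<alpha> nn_integral_pk_pk[of t s "\<alpha>/2" \<alpha> x] by (intro split) (auto simp: P_def)
  finally show ?A by (simp add: fin P_def[symmetric])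
  \<comment> \<open>For \<open>t > s\<close> the roles are exchanged: now the cancellation of
    \<open>r s x\<close> is used, with increments of \<open>r t z\<close> from the point
    \<open>x\<close>.\<close>
  have "(\<integral>\<^sup>+ z. ennreal \<bar>LINT y|lborel. r s x y * r t z y\<bar> \<partial>lborel) =
    (\<integral>\<^sup>+ z. ennreal \<bar>LINT y|lborel. r t z y * r s x y\<bar> \<partial>lborel)" by (simp add: mult.commute)
  also have "\<dots> \<le> (\<integral>\<^sup>+ z. \<integral>\<^sup>+ y. ennreal (A\<^sup>2 * (s / t) powr (\<alpha>/2) * (pk (\<alpha>/2) s x y * pk \<alpha> t z y + pk (\<alpha>/2) s x y * pk \<alpha> t z x)) \<partial>lborel \<partial>lborel)"
    by (intro nn_integral_mono pairing_pointwise s t)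
  also have "\<dots> \<le> ennreal (A\<^sup>2 * (s / t) powr (\<alpha>/2)) * (ennreal P + ennreal P)"
    using s t \<alpha> nn_integral_pk_pk(1)[of t s \<alpha> "\<alpha>/2" x] nn_integral_pk_pk(3)[of t s "\<alpha>/2" \<alpha> x]
    by (intro split) (auto simp: mult.commute P_def)
  finally show ?B by (simp add: fin P_def[symmetric])
qed

text \<open>The scale integral is cut at \<open>t = s\<close>, and on each side the decaying one of
  the two bounds of \<open>pairing_row\<close> is taken. This is the row condition of
  \<open>dual_schur_bound\<close> for the measure \<open>dt dz / t\<close>.\<close>

lemma pairing_row_dt:
  assumes s: "0 < s"
  shows "(\<integral>\<^sup>+ t. ennreal (indicator {0<..} t / t) * (\<integral>\<^sup>+ z. ennreal \<bar>LINT y|lborel. r s x y * r t z y\<bar> \<partial>lborel) \<partial>lborel)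
     \<le> ennreal (L2_const CARD('n) \<alpha> * A\<^sup>2)"
proof -
  define P where "P = pk_const CARD('n) (\<alpha>/2) * pk_const CARD('n) \<alpha>"
  have P: "0 \<le> P" unfolding P_def using \<alpha> pk_const_pos[of "\<alpha>/2" "CARD('n)"] pk_const_pos[of \<alpha> "CARD('n)"] by simp
  let ?f = "\<lambda>t. ennreal ((t / s) powr (\<alpha>/2) / t) * indicator {0<..<s} t"
  let ?g = "\<lambda>t. ennreal ((s / t) powr (\<alpha>/2) / t) * indicator {s..} t"
  have "(\<integral>\<^sup>+ t. ennreal (indicator {0<..} t / t) * (\<integral>\<^sup>+ z. ennreal \<bar>LINT y|lborel. r s x y * r t z y\<bar> \<partial>lborel) \<partial>lborel)
    \<le> (\<integral>\<^sup>+ t. ennreal (2 * A\<^sup>2 * P) * (?f t + ?g t) \<partial>lborel)"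
  proof (rule nn_integral_mono)
    fix t :: real
    let ?I = "\<integral>\<^sup>+ z. ennreal \<bar>LINT y|lborel. r s x y * r t z y\<bar> \<partial>lborel"
    consider "t \<le> 0" | "0 < t" "t < s" | "0 < t" "s \<le> t" by linarith
    then show "ennreal (indicator {0<..} t / t) * ?I \<le> ennreal (2 * A\<^sup>2 * P) * (?f t + ?g t)"
    proof cases
      case 2
      have "ennreal (1 / t) * ?I \<le> ennreal (1 / t) * (ennreal (2 * A\<^sup>2 * P) * ennreal ((t / s) powr (\<alpha>/2)))"
        using pairing_row(1)[OF s 2(1), folded P_def] by (intro mult_left_mono) auto
      also have "\<dots> = ennreal (2 * A\<^sup>2 * P) * ennreal ((t / s) powr (\<alpha>/2) / t)"
        using 2 P by (simp flip: ennreal_mult) 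
      finally show ?thesis using 2 by simp
    next
      case 3
      have "ennreal (1 / t) * ?I \<le> ennreal (1 / t) * (ennreal (2 * A\<^sup>2 * P) * ennreal ((s / t) powr (\<alpha>/2)))"
        using pairing_row(2)[OF s 3(1), folded P_def] by (intro mult_left_mono) auto
      also have "\<dots> = ennreal (2 * A\<^sup>2 * P) * ennreal ((s / t) powr (\<alpha>/2) / t)"
        using 3 P by (simp flip: ennreal_mult) 
      finally show ?thesis using 3 by simp
    qed simp
  qed
  also have "\<dots> = ennreal (2 * A\<^sup>2 * P) * ((\<integral>\<^sup>+ t. ?f t \<partial>lborel) + (\<integral>\<^sup>+ t. ?g t \<partial>lborel))"
    by (subst nn_integral_cmult, measurable) (subst nn_integral_add, auto)
  also have "\<dots> \<le> ennreal (2 * A\<^sup>2 * P) * (ennreal (1 / (\<alpha>/2)) + ennreal (1 / (\<alpha>/2)))"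
    using s \<alpha> by (intro mult_left_mono add_mono nn_integral_powr_near_0 nn_integral_powr_near_inf) auto
  also have "\<dots> = ennreal (2 * A\<^sup>2 * P * (1 / (\<alpha>/2) + 1 / (\<alpha>/2)))"
    using \<alpha> P by (simp flip: ennreal_plus ennreal_mult)
  also have "2 * A\<^sup>2 * P * (1 / (\<alpha>/2) + 1 / (\<alpha>/2)) = L2_const CARD('n) \<alpha> * A\<^sup>2"
    by (simp add: L2_const_def P_def)
  finally show ?thesis .
qed

text \<open>The operator from functions of \<open>y\<close> to functions of \<open>(t, x)\<close> is
  fed to \<open>dual_schur_bound\<close>. The measure \<open>dt dx / t\<close> is infinite, so this
  is done on an exhaustion by regions of finite measure, with a bound that does not depend on the
  region.\<close>

theorem square_function_L2:
  assumes h: "integrable lborel h" and hb: "\<And>y. \<bar>h y\<bar> \<le> b"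
  shows "(\<integral>\<^sup>+ x. (\<integral>\<^sup>+ t\<in>{0<..}. ennreal ((LINT y|lborel. r t x y * h y)\<^sup>2 / t) \<partial>lborel) \<partial>lborel)
     \<le> ennreal (L2_const CARD('n) \<alpha> * A\<^sup>2 * (LINT y|lborel. (h y)\<^sup>2))"
proof -
  let ?L = "L2_const CARD('n) \<alpha> * A\<^sup>2"
  have [measurable]: "h \<in> borel_measurable borel" using h by auto
  have [measurable]: "fst \<in> borel_measurable (borel :: (real \<times> (real^'n)) measure)"
    by (intro borel_measurable_continuous_onI continuous_intros)
  \<comment> \<open>Keeping \<open>t\<close> away from 0 bounds both the density
    \<open>1 / t\<close> and the kernel, which is of size \<open>t powr - d\<close>; the other two
    conditions make the region bounded.\<close>
  define X where "X n = {w::real \<times> (real^'n). 1 / Suc n < fst w \<and> fst w < Suc n \<and> linf (snd w) < Suc n}" for n :: nat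
  have Xm [measurable]: "X n \<in> sets borel" for n
  proof -
    have "X n = {1 / real (Suc n)<..<real (Suc n)} \<times> {z. linf z < real (Suc n)}" by (auto simp: X_def)
    also have "\<dots> \<in> sets (borel \<Otimes>\<^sub>M borel)" by (intro pair_measureI) measurable
    finally show ?thesis by (simp only: borel_prod)
  qed
  have Xpos: "0 < fst w" "1 / Suc n < fst w" if "w \<in> X n" for w n
    using that by (auto simp: X_def intro: less_trans[rotated])
  define M where "M n = density lborel (\<lambda>w. ennreal (indicator (X n) w / fst w))" for n
  have wm [measurable]: "(\<lambda>w::real \<times> (real^'n). ennreal (indicator (X n) w / fst w)) \<in> borel_measurable lborel" for n
    by measurable
  define f where "f w = (LINT y|lborel. r (fst w) (snd w) y * h y)" for w
  have fm [measurable]: "f \<in> borel_measurable borel" unfolding f_def borel_prod[symmetric] by measurable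
  have step: "(\<integral>\<^sup>+ w. ennreal (indicator (X n) w * ((f w)\<^sup>2 / fst w)) \<partial>lborel) \<le> ennreal (?L * (LINT y|lborel. (h y)\<^sup>2))" for n
  proof -
    have "finite_measure (M n)"
    proof (rule finite_measureI)
      have bd: "bounded (X n)"
      proof -
        have "X n \<subseteq> {0..real (Suc n)} \<times> cbox (\<chi> i. - real (Suc n)) (\<chi> i. real (Suc n))"
        proof
          fix w assume w: "w \<in> X n"
          have "\<bar>snd w $ i\<bar> < real (Suc n)" for i using w linf_less_iff unfolding X_def by blast
          then have "- real (Suc n) \<le> snd w $ i \<and> snd w $ i \<le> real (Suc n)" for i
            by (smt (verit))
          then have "snd w \<in> cbox (\<chi> i. - real (Suc n)) (\<chi> i. real (Suc n))"
            unfolding mem_box_cart by simp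
          then show "w \<in> {0..real (Suc n)} \<times> cbox (\<chi> i. - real (Suc n)) (\<chi> i. real (Suc n))"
            using w Xpos(1)[OF w] by (cases w) (auto simp: X_def)
        qed
        then show ?thesis by (rule bounded_subset[rotated]) (intro bounded_Times, auto)
      qed
      have "emeasure (M n) (space (M n)) = (\<integral>\<^sup>+ w. ennreal (indicator (X n) w / fst w) \<partial>lborel)"
        unfolding M_def by (subst emeasure_density) auto
      also have "\<dots> \<le> (\<integral>\<^sup>+ w. ennreal (Suc n) * indicator (X n) w \<partial>lborel)"
      proof (rule nn_integral_mono)
        fix w :: "real \<times> (real^'n)"
        have "1 / fst w \<le> real (Suc n)" if "w \<in> X n"
          using Xpos[OF that] by (simp add: field_simps)
        then show "ennreal (indicator (X n) w / fst w) \<le> ennreal (Suc n) * indicator (X n) w"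
          by (cases "w \<in> X n") (auto intro: ennreal_leI simp del: of_nat_Suc)
      qed
      also have "\<dots> = ennreal (Suc n) * emeasure lborel (X n)" by (rule nn_integral_cmult_indicator) simp
      also have "\<dots> < \<infinity>" using emeasure_bounded_finite[OF bd] by (simp add: ennreal_mult_less_top)
      finally show "emeasure (M n) (space (M n)) \<noteq> \<infinity>" by simp
    qed
    moreover have sp: "space (M n) = UNIV" unfolding M_def by simp
    moreover define \<rho> where "\<rho> w y = indicator (X n) w * r (fst w) (snd w) y" for w y
    have "(\<lambda>w. \<rho> (fst w) (snd w)) \<in> borel_measurable (M n \<Otimes>\<^sub>M lborel)"
    proof -
      have "(\<lambda>w. \<rho> (fst w) (snd w)) \<in> borel_measurable ((borel \<Otimes>\<^sub>M borel) \<Otimes>\<^sub>M borel)"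
      proof -
        have [measurable]: "X n \<in> sets (borel \<Otimes>\<^sub>M borel)" using Xm by (simp only: borel_prod)
        show ?thesis unfolding \<rho>_def by measurable
      qed
      also have "borel_measurable ((borel \<Otimes>\<^sub>M borel) \<Otimes>\<^sub>M borel) = borel_measurable (M n \<Otimes>\<^sub>M lborel)"
        by (intro measurable_cong_sets sets_pair_measure_cong) (simp_all only: M_def borel_prod sets_density sets_lborel)
      finally show ?thesis .
    qed
    moreover have "\<bar>\<rho> w y\<bar> \<le> A * (1 / Suc n) powr - real CARD('n)" for w y
    proof (cases "w \<in> X n")
      case True
      have "\<bar>\<rho> w y\<bar> \<le> A * fst w powr - real CARD('n)" using True r_le[OF Xpos(1)[OF True]] by (simp add: \<rho>_def)
      also have "\<dots> \<le> A * (1 / Suc n) powr - real CARD('n)"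
        using Xpos[OF True] A by (intro mult_left_mono powr_mono2') auto
      finally show ?thesis .
    qed (use A in \<open>simp add: \<rho>_def\<close>)
    moreover have "(\<integral>\<^sup>+ y. ennreal \<bar>\<rho> w y\<bar> \<partial>lborel) \<le> ennreal (A * pk_const CARD('n) \<alpha>)" for w
    proof (cases "w \<in> X n")
      case True
      have "(\<integral>\<^sup>+ y. ennreal \<bar>\<rho> w y\<bar> \<partial>lborel) \<le> (\<integral>\<^sup>+ y. ennreal A * ennreal (pk \<alpha> (fst w) (snd w) y) \<partial>lborel)"
        using True size[OF Xpos(1)[OF True]] A by (intro nn_integral_mono) (auto simp: \<rho>_def ennreal_leI simp flip: ennreal_mult)
      also have "\<dots> \<le> ennreal A * ennreal (pk_const CARD('n) \<alpha>)" 
        using Xpos(1)[OF True] \<alpha> by (subst nn_integral_cmult) (auto intro!: mult_left_mono nn_integral_pk)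
      finally show ?thesis using A pk_const_pos[OF \<alpha>(1), of "CARD('n)"] by (simp add: ennreal_mult less_imp_le)
    qed (simp add: \<rho>_def)
    moreover have "0 \<le> A * pk_const CARD('n) \<alpha>" using A pk_const_pos[OF \<alpha>(1)] by (simp add: less_imp_le)
    moreover note h hb
    moreover have "(\<integral>\<^sup>+ q. ennreal \<bar>LINT y|lborel. \<rho> p y * \<rho> q y\<bar> \<partial>(M n)) \<le> ennreal ?L" for p
    proof (cases "p \<in> X n")
      case True
      note p = Xpos(1)[OF True]
      let ?K = "\<lambda>q. \<bar>LINT y|lborel. r (fst p) (snd p) y * r (fst q) (snd q) y\<bar>"
      have Km [measurable]: "?K \<in> borel_measurable (borel \<Otimes>\<^sub>M borel)" by measurable
      have e: "\<bar>LINT y|lborel. \<rho> p y * \<rho> q y\<bar> = indicator (X n) q * ?K q" for q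
        using True by (auto simp: \<rho>_def indicator_def)
      have "(\<integral>\<^sup>+ q. ennreal \<bar>LINT y|lborel. \<rho> p y * \<rho> q y\<bar> \<partial>(M n)) = 
         (\<integral>\<^sup>+ q. ennreal (indicator (X n) q / fst q) * ennreal (indicator (X n) q * ?K q) \<partial>lborel)"
      proof -
        have [measurable]: "?K \<in> borel_measurable borel" using Km by (simp only: borel_prod)
        have "(\<lambda>q. ennreal (indicator (X n) q * ?K q)) \<in> borel_measurable lborel" by measurable
        from nn_integral_density[OF wm this] show ?thesis unfolding M_def e .
      qed
      also have "\<dots> \<le> (\<integral>\<^sup>+ q. ennreal (indicator {0<..} (fst q) / fst q) * ennreal (?K q) \<partial>(lborel \<Otimes>\<^sub>M lborel))"
        unfolding lborel_prod using Xpos(1) by (intro nn_integral_mono) (auto simp: indicator_def)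
      also have "\<dots> = (\<integral>\<^sup>+ t. ennreal (indicator {0<..} t / t) * (\<integral>\<^sup>+ z. ennreal (?K (t, z)) \<partial>lborel) \<partial>lborel)"
        by (simp add: lborel.nn_integral_fst[symmetric] nn_integral_cmult)
      also have "\<dots> \<le> ennreal ?L"
        using pairing_row_dt[OF p, of "snd p"] by simp
      finally show ?thesis .
    qed (simp add: \<rho>_def)
    moreover have "0 < ?L" using A L2_const_pos[OF \<alpha>(1)] by simp
    ultimately have "(\<integral>\<^sup>+ p. ennreal ((LINT y|lborel. \<rho> p y * h y)\<^sup>2) \<partial>M n) \<le> ennreal (?L * (LINT y|lborel. (h y)\<^sup>2))"
      by (intro dual_schur_bound[OF _ sigma_finite_lborel]) 
    moreover have "(\<integral>\<^sup>+ p. ennreal ((LINT y|lborel. \<rho> p y * h y)\<^sup>2) \<partial>M n) = 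
       (\<integral>\<^sup>+ w. ennreal (indicator (X n) w * ((f w)\<^sup>2 / fst w)) \<partial>lborel)"
    proof -
      have e: "(LINT y|lborel. \<rho> p y * h y) = indicator (X n) p * f p" for p
        unfolding \<rho>_def f_def by (simp add: mult.assoc)
      have m: "(\<lambda>p. ennreal ((indicator (X n) p * f p)\<^sup>2)) \<in> borel_measurable lborel" by measurable
      show ?thesis unfolding e M_def nn_integral_density[OF wm m]
        by (auto intro!: nn_integral_cong simp: indicator_def simp flip: ennreal_mult'')
    qed
    ultimately show ?thesis by simp
  qed
  have "(\<integral>\<^sup>+ x. (\<integral>\<^sup>+ t\<in>{0<..}. ennreal ((LINT y|lborel. r t x y * h y)\<^sup>2 / t) \<partial>lborel) \<partial>lborel)
     = (\<integral>\<^sup>+ x. (\<integral>\<^sup>+ t. ennreal (indicator {0<..} t * ((f (t, x))\<^sup>2 / t)) \<partial>lborel) \<partial>lborel)"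
    by (auto intro!: nn_integral_cong simp: indicator_def f_def)
  also have "\<dots> = (\<integral>\<^sup>+ w. ennreal (indicator {0<..} (fst w) * ((f w)\<^sup>2 / fst w)) \<partial>lborel)"
    using lborel_pair.nn_integral_snd[of "\<lambda>w. ennreal (indicator {0<..} (fst w) * ((f w)\<^sup>2 / fst w))"] fm
    by (simp add: borel_prod lborel_prod)
  also have "\<dots> = (\<integral>\<^sup>+ w. (SUP n. ennreal (indicator (X n) w * ((f w)\<^sup>2 / fst w))) \<partial>lborel)"
  proof (rule nn_integral_cong)
    fix w :: "real \<times> (real^'n)"
    show "ennreal (indicator {0<..} (fst w) * ((f w)\<^sup>2 / fst w)) = (SUP n. ennreal (indicator (X n) w * ((f w)\<^sup>2 / fst w)))"
    proof (cases "0 < fst w")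
      case True
      obtain n :: nat where n: "max (fst w) (max (1 / fst w) (linf (snd w))) < n" using reals_Archimedean2 by blast
      have "w \<in> X n" using n True by (auto simp: X_def field_simps)
      then have "ennreal (indicator {0<..} (fst w) * ((f w)\<^sup>2 / fst w)) \<le> (SUP n. ennreal (indicator (X n) w * ((f w)\<^sup>2 / fst w)))"
        using True by (intro SUP_upper2[of n]) auto
      moreover have "(SUP n. ennreal (indicator (X n) w * ((f w)\<^sup>2 / fst w))) \<le> ennreal (indicator {0<..} (fst w) * ((f w)\<^sup>2 / fst w))"
        using True by (intro SUP_least) (auto simp: indicator_def)
      ultimately show ?thesis by (rule antisym)
    next
      case False
      then have "w \<notin> X n" for n using Xpos(1) by blast
      then show ?thesis using False by simp
    qed
  qed
  also have "\<dots> = (SUP n. \<integral>\<^sup>+ w. ennreal (indicator (X n) w * ((f w)\<^sup>2 / fst w)) \<partial>lborel)"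
  proof (rule nn_integral_monotone_convergence_SUP)
    have "X m \<subseteq> X n" if "m \<le> n" for m n
    proof -
      have "1 / real (Suc n) \<le> 1 / real (Suc m)" using that by (simp add: frac_le)
      then show ?thesis using that unfolding X_def by auto
    qed
    then show "incseq (\<lambda>n w. ennreal (indicator (X n) w * ((f w)\<^sup>2 / fst w)))"
      using Xpos(1) by (auto simp: incseq_def le_fun_def indicator_def less_imp_le intro!: ennreal_leI)
  qed measurable
  also have "\<dots> \<le> ennreal (?L * (LINT y|lborel. (h y)\<^sup>2))"
    by (intro SUP_least step)
  finally show ?thesis .
qed

end

section \<open>Good and bad functions\<close>

text \<open>The summand \<open>C\<close> belongs to \<open>k\<close>; in the other,
  \<open>C * pk_const d \<alpha>\<close> bounds \<open>gam\<close>, \<open>2 powr \<alpha>\<close>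
  the inverse mass of \<open>pk\<close>, and \<open>\<alpha> + d\<close> is the Hoelder constant of
  \<open>pk\<close>.\<close>

definition rk_const :: "nat \<Rightarrow> real \<Rightarrow> real \<Rightarrow> real" where
  "rk_const d \<alpha> C = C + C * pk_const d \<alpha> * 2 powr \<alpha> * (\<alpha> + real d)"

text \<open>In order: the mean-zero part on \<open>L\<^sup>2\<close>, the testing condition on the
  tripled cube, and the tail of \<open>gam\<close> outside that cube. Each square of a sum has cost
  a factor 2.\<close>

definition good_const :: "nat \<Rightarrow> real \<Rightarrow> real \<Rightarrow> real \<Rightarrow> real" where
  "good_const d \<alpha> C CT = 2 * (L2_const d \<alpha> * (rk_const d \<alpha> C)\<^sup>2) * 3 ^ d + 4 * CT * 3 ^ d +
     4 * (C * 2 powr (\<alpha> + real d) * pk_const d \<alpha>)\<^sup>2 / (2 * \<alpha>)"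

text \<open>The summand 1 comes from scales above the size of the support, the power of 2 from
  scales below it, and \<open>1 / \<alpha>\<close> from either scale integral.\<close>

definition bad_const :: "nat \<Rightarrow> real \<Rightarrow> real \<Rightarrow> real" where
  "bad_const d \<alpha> C = C * pk_const d \<alpha> * (1 + 2 powr (\<alpha> + real d)) / \<alpha>"

lemma ennreal_combination3:
  assumes "0 \<le> a" "0 \<le> b" "0 \<le> c" "0 \<le> p" "0 \<le> q"
  shows "ennreal (2 * a + p * b + q * c) = 2 * ennreal a + ennreal p * ennreal b + ennreal q * ennreal c"
  using assms by (simp add: ennreal_mult ennreal_plus)

locale square_kernel =
  fixes k :: "real \<Rightarrow> real^'n \<Rightarrow> real^'n \<Rightarrow> real" and \<alpha> C CT :: real
  assumes \<alpha>: "0 < \<alpha>" "\<alpha> \<le> 1" and C: "0 < C" and CT: "0 < CT"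
    and kernel: "kernel_cond \<alpha> C k" and testing: "testing_cond CT k"
begin

abbreviation energy :: "(real^'n \<Rightarrow> real) \<Rightarrow> real set \<Rightarrow> real^'n \<Rightarrow> ennreal" where
  "energy u I x \<equiv> (\<integral>\<^sup>+ t\<in>I. ennreal ((theta k t u x)\<^sup>2 / t) \<partial>lborel)"

lemma k_measurable: "(\<lambda>p. k (fst p) (fst (snd p)) (snd (snd p))) \<in> borel_measurable borel"
  using kernel by (simp add: kernel_cond_def)

lemma k_size: "0 < t \<Longrightarrow> \<bar>k t x y\<bar> \<le> C * pk \<alpha> t x y"
  using kernel by (auto simp: kernel_cond_def pk_def)

lemma k_smooth:
  assumes "0 < t" "linf (x - x') + linf (y - y') < t"
  shows "\<bar>k t x y - k t x' y'\<bar> \<le> C * ((linf (x - x') / t) powr \<alpha> + (linf (y - y') / t) powr \<alpha>) * pk \<alpha> t x y"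
proof -
  have "\<bar>k t x y - k t x' y'\<bar> \<le> C * (linf (x - x') powr \<alpha> + linf (y - y') powr \<alpha>) / (t + linf (x - y)) powr (\<alpha> + real CARD('n))"
    using kernel assms unfolding kernel_cond_def by blast
  also have "\<dots> = C * ((linf (x - x') / t) powr \<alpha> + (linf (y - y') / t) powr \<alpha>) * pk \<alpha> t x y"
    using assms by (simp add: pk_def powr_divide add_divide_distrib[symmetric])
  finally show ?thesis .
qed

lemma measurable_k [measurable (raw)]:
  assumes "f \<in> borel_measurable M" "g \<in> M \<rightarrow>\<^sub>M borel" "h \<in> M \<rightarrow>\<^sub>M borel"
  shows "(\<lambda>w. k (f w) (g w) (h w)) \<in> borel_measurable M"
proof -
  have "(\<lambda>w. (f w, g w, h w)) \<in> M \<rightarrow>\<^sub>M borel"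
    unfolding borel_prod[symmetric] using assms by measurable
  from measurable_compose[OF this k_measurable] show ?thesis by simp
qed

lemma measurable_theta [measurable (raw)]:
  assumes [measurable]: "f \<in> borel_measurable M" "g \<in> M \<rightarrow>\<^sub>M borel" "u \<in> borel_measurable borel"
  shows "(\<lambda>w. theta k (f w) u (g w)) \<in> borel_measurable M"
  unfolding theta_def by measurable

lemma integrable_k: "0 < t \<Longrightarrow> integrable lborel (k t x)"
  using \<alpha> C by (intro Bochner_Integration.integrable_bound[OF integrable_mult_right[OF integrable_pk[of t \<alpha> x], of C]])
    (auto simp: k_size)

lemma integrable_k_mult:
  assumes "0 < t" "u \<in> borel_measurable lborel" "\<And>y. \<bar>u y\<bar> \<le> c"
  shows "integrable lborel (\<lambda>y. k t x y * u y)"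
  using integrable_k[OF assms(1), of x]
proof (rule Bochner_Integration.integrable_bound[OF integrable_mult_right[of c]])
  have "\<bar>u y\<bar> * \<bar>k t x y\<bar> \<le> \<bar>c\<bar> * \<bar>k t x y\<bar>" for y
    using assms(3)[of y] by (intro mult_right_mono) auto
  then show "AE y in lborel. norm (k t x y * u y) \<le> norm (c * k t x y)"
    by (simp add: abs_mult mult.commute)
qed (use assms in auto)

lemma integrable_k_mult':
  assumes "0 < t" "integrable lborel u"
  shows "integrable lborel (\<lambda>y. k t x y * u y)"
  using assms(2)
proof (rule Bochner_Integration.integrable_bound[OF integrable_mult_right[of "C * t powr - real CARD('n)"]])
  have "\<bar>k t x y\<bar> \<le> C * t powr - real CARD('n)" for y
    using order_trans[OF k_size mult_left_mono[OF pk_le]] C \<alpha> assms by simp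
  then have "\<bar>k t x y\<bar> * \<bar>u y\<bar> \<le> (C * t powr - real CARD('n)) * \<bar>u y\<bar>" for y
    by (intro mult_right_mono) auto
  then show "AE y in lborel. norm (k t x y * u y) \<le> norm (C * t powr - real CARD('n) * u y)"
    using C by (simp add: abs_mult)
qed (use assms in auto)

lemma theta_add:
  assumes "0 < t" "integrable lborel u" "integrable lborel v"
  shows "theta k t (\<lambda>y. u y + v y) x = theta k t u x + theta k t v x"
  using integrable_k_mult'[OF assms(1,2)] integrable_k_mult'[OF assms(1,3)]
  unfolding theta_def by (simp add: distrib_left)

lemma theta_sum:
  assumes "0 < t" "\<And>i. i \<in> I \<Longrightarrow> integrable lborel (u i)"
  shows "theta k t (\<lambda>y. \<Sum>i\<in>I. u i y) x = (\<Sum>i\<in>I. theta k t (u i) x)"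
  using integrable_k_mult'[OF assms(1)] assms(2)
  unfolding theta_def by (simp add: sum_distrib_left Bochner_Integration.integral_sum)

lemma theta_le_nn_integral:
  assumes "0 < t"
  shows "ennreal \<bar>theta k t u x\<bar> \<le> (\<integral>\<^sup>+ y. ennreal (C * (pk \<alpha> t x y * \<bar>u y\<bar>)) \<partial>lborel)"
proof (cases "integrable lborel (\<lambda>y. k t x y * u y)")
  case True
  have "ennreal \<bar>theta k t u x\<bar> \<le> (\<integral>\<^sup>+ y. ennreal \<bar>k t x y * u y\<bar> \<partial>lborel)"
    using integral_norm_bound_ennreal[OF True] by (simp add: theta_def)
  also have "\<dots> \<le> (\<integral>\<^sup>+ y. ennreal (C * (pk \<alpha> t x y * \<bar>u y\<bar>)) \<partial>lborel)"
    using k_size[OF assms] by (intro nn_integral_mono ennreal_leI) (auto simp: abs_mult mult.assoc[symmetric] mult_right_mono)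
  finally show ?thesis .
qed (simp add: theta_def not_integrable_integral_eq)

lemma theta_bounded:
  assumes "0 < t" "u \<in> borel_measurable lborel" "\<And>y. \<bar>u y\<bar> \<le> b"
  shows "\<bar>theta k t u x\<bar> \<le> C * pk_const CARD('n) \<alpha> * b"
proof -
  have b: "0 \<le> b" using assms(3)[of undefined] by linarith
  have "ennreal \<bar>theta k t u x\<bar> \<le> (\<integral>\<^sup>+ y. ennreal (C * b) * ennreal (pk \<alpha> t x y) \<partial>lborel)"
    by (rule order_trans[OF theta_le_nn_integral[OF assms(1)]])
      (use assms C b in \<open>auto intro!: nn_integral_mono ennreal_leI mult_left_mono mult_right_mono simp: mult_ac simp flip: ennreal_mult\<close>)
  also have "\<dots> \<le> ennreal (C * b) * ennreal (pk_const CARD('n) \<alpha>)"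
    using assms \<alpha> by (subst nn_integral_cmult) (auto intro!: mult_left_mono nn_integral_pk)
  also have "\<dots> = ennreal (C * pk_const CARD('n) \<alpha> * b)"
    using C b pk_const_pos[OF \<alpha>(1), of "CARD('n)"] by (simp add: mult_ac less_imp_le flip: ennreal_mult)
  finally show ?thesis using C b pk_const_pos[OF \<alpha>(1), of "CARD('n)"] by (simp add: less_imp_le)
qed

section \<open>Splitting off the part of the kernel without cancellation\<close>

definition gam :: "real \<Rightarrow> real^'n \<Rightarrow> real" where
  "gam t x = (LINT y|lborel. k t x y)"

definition ek :: "real \<Rightarrow> real^'n \<Rightarrow> real^'n \<Rightarrow> real" where
  "ek t x y = pk \<alpha> t x y / (LINT y|lborel. pk \<alpha> t x y)"

definition rk :: "real \<Rightarrow> real^'n \<Rightarrow> real^'n \<Rightarrow> real" where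
  "rk t x y = k t x y - gam t x * ek t x y"

lemma rk_const_pos: "0 < rk_const CARD('n) \<alpha> C"
  using C \<alpha> pk_const_pos[OF \<alpha>(1), of "CARD('n)"] by (simp add: rk_const_def add_pos_nonneg)

lemma one_le_dim: "1 \<le> \<alpha> + real CARD('n)"
proof -
  have "1 \<le> real CARD('n)" by (simp add: Suc_le_eq)
  then show ?thesis using \<alpha> by linarith
qed

lemma gam_le: "0 < t \<Longrightarrow> \<bar>gam t x\<bar> \<le> C * pk_const CARD('n) \<alpha>"
  using theta_bounded[of t "\<lambda>_. 1" 1 x] by (simp add: theta_def gam_def)

lemma pk_mass: "0 < t \<Longrightarrow> 2 powr - \<alpha> \<le> (LINT y|lborel. pk \<alpha> t x y)" for x :: "real^'n"
  using integral_pk_ge \<alpha> by blast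

lemma pk_mass_inv: "0 < t \<Longrightarrow> u / (LINT y|lborel. pk \<alpha> t x y) \<le> 2 powr \<alpha> * u" if "0 \<le> u" for x :: "real^'n"
proof -
  assume t: "0 < t"
  have "u / (LINT y|lborel. pk \<alpha> t x y) \<le> u / 2 powr - \<alpha>"
    using pk_mass[OF t, of x] that
    by (intro divide_left_mono mult_pos_pos) (auto intro: less_le_trans[rotated])
  then show ?thesis by (simp add: powr_minus field_simps)
qed

lemma integral_ek: "0 < t \<Longrightarrow> (LINT y|lborel. ek t x y) = 1"
proof -
  assume t: "0 < t"
  have "0 < 2 powr - \<alpha>" by simp
  then have "0 < (LINT y|lborel. pk \<alpha> t x y)" using pk_mass[OF t, of x] by linarith
  then show ?thesis by (simp add: ek_def)
qed

lemma ek_nonneg [simp]: "0 \<le> ek t x y"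
  unfolding ek_def by (intro divide_nonneg_nonneg integral_nonneg) auto

lemma integrable_ek: "0 < t \<Longrightarrow> integrable lborel (ek t x)"
  unfolding ek_def using integrable_pk[of t \<alpha> x] \<alpha> by simp

lemma cancellative_rk: "cancellative_kernel rk \<alpha> (rk_const CARD('n) \<alpha> C)"
proof
  let ?P = "pk_const CARD('n) \<alpha>"
  have P: "0 < ?P" using pk_const_pos \<alpha> by blast
  show "0 < \<alpha>" "\<alpha> \<le> 1" "0 < rk_const CARD('n) \<alpha> C" using \<alpha> rk_const_pos by auto
  show "(\<lambda>p. rk (fst p) (fst (snd p)) (snd (snd p))) \<in> borel_measurable borel"
    unfolding rk_def gam_def ek_def borel_prod[symmetric] by measurable
  fix t :: real and x y z :: "real^'n" assume t: "0 < t"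
  have "\<bar>rk t x y\<bar> \<le> \<bar>k t x y\<bar> + \<bar>gam t x\<bar> * ek t x y"
    unfolding rk_def using abs_triangle_ineq4[of "k t x y" "gam t x * ek t x y"] by (simp add: abs_mult)
  also have "\<dots> \<le> C * pk \<alpha> t x y + (C * ?P) * (2 powr \<alpha> * pk \<alpha> t x y)"
    unfolding ek_def[abs_def] using P C t
    by (intro add_mono k_size mult_mono gam_le pk_mass_inv divide_nonneg_nonneg integral_nonneg) auto
  \<comment> \<open>The factor \<open>\<alpha> + d\<close>, at least 1, is inserted so that one
    constant serves for the size and for the continuity.\<close>
  also have "\<dots> \<le> C * pk \<alpha> t x y + (C * ?P) * (2 powr \<alpha> * pk \<alpha> t x y) * (\<alpha> + real CARD('n))"
    using one_le_dim P C by (intro add_left_mono mult_left_le[where a=1, simplified]) 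
      (metis mult.right_neutral mult_left_mono mult_nonneg_nonneg less_imp_le pk_nonneg powr_ge_zero)
  also have "\<dots> = rk_const CARD('n) \<alpha> C * pk \<alpha> t x y" by (simp add: rk_const_def algebra_simps)
  finally show "\<bar>rk t x y\<bar> \<le> rk_const CARD('n) \<alpha> C * pk \<alpha> t x y" .
  let ?w = "(linf (y - z) / t) powr (\<alpha>/2)"
  let ?S = "pk \<alpha> t x y + pk \<alpha> t x z"
  \<comment> \<open>Nearby points use the regularity of \<open>k\<close>, whose exponent
    \<open>\<alpha>\<close> may be lowered since the quotient is below 1; for distant points
    \<open>?w\<close> is at least 1 and the size bound is enough.\<close>
  have k1: "\<bar>k t x y - k t x z\<bar> \<le> C * ?w * ?S"
  proof (cases "linf (y - z) < t")
    case True
    have "\<bar>k t x y - k t x z\<bar> \<le> C * (linf (y - z) / t) powr \<alpha> * pk \<alpha> t x y"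
      using k_smooth[OF t, of x x y z] True by simp
    also have "\<dots> \<le> C * ?w * ?S"
      using True t \<alpha> C by (intro mult_mono powr_mono') auto
    finally show ?thesis .
  next
    case False
    have "\<bar>k t x y - k t x z\<bar> \<le> C * 1 * ?S"
      using k_size[OF t, of x y] k_size[OF t, of x z] by (simp add: distrib_left)
    also have "\<dots> \<le> C * ?w * ?S"
      using False t \<alpha> C by (intro mult_right_mono mult_left_mono ge_one_powr_ge_zero) auto
    finally show ?thesis .
  qed
  have k2: "\<bar>gam t x * ek t x y - gam t x * ek t x z\<bar> \<le> (C * ?P) * (2 powr \<alpha> * ((\<alpha> + real CARD('n)) * ?w * ?S))"
  proof -
    have "\<bar>gam t x * ek t x y - gam t x * ek t x z\<bar> = \<bar>gam t x\<bar> * (\<bar>pk \<alpha> t x y - pk \<alpha> t x z\<bar> / (LINT y|lborel. pk \<alpha> t x y))"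
      unfolding ek_def by (simp add: abs_mult diff_divide_distrib[symmetric] right_diff_distrib[symmetric] abs_divide)
    also have "\<dots> \<le> (C * ?P) * (2 powr \<alpha> * \<bar>pk \<alpha> t x y - pk \<alpha> t x z\<bar>)"
      using P C t by (intro mult_mono gam_le pk_mass_inv divide_nonneg_nonneg integral_nonneg) auto
    also have "\<dots> \<le> (C * ?P) * (2 powr \<alpha> * ((\<alpha> + real CARD('n)) * ?w * ?S))"
      using P C t \<alpha> by (intro mult_left_mono pk_holder) auto
    finally show ?thesis .
  qed
  have "\<bar>rk t x y - rk t x z\<bar> \<le> \<bar>k t x y - k t x z\<bar> + \<bar>gam t x * ek t x y - gam t x * ek t x z\<bar>"
    unfolding rk_def by linarith
  also have "\<dots> \<le> C * ?w * ?S + (C * ?P) * (2 powr \<alpha> * ((\<alpha> + real CARD('n)) * ?w * ?S))"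
    using k1 k2 by linarith
  also have "\<dots> = rk_const CARD('n) \<alpha> C * ?w * ?S" by (simp add: rk_const_def algebra_simps)
  finally show "\<bar>rk t x y - rk t x z\<bar> \<le> rk_const CARD('n) \<alpha> C * ?w * ?S" .
  show "(LINT y|lborel. rk t x y) = 0"
    unfolding rk_def using integrable_k[OF t, of x] integrable_ek[OF t, of x] integral_ek[OF t, of x]
    by (simp add: gam_def)
qed

sublocale rk: cancellative_kernel rk \<alpha> "rk_const CARD('n) \<alpha> C"
  by (rule cancellative_rk)

text \<open>\<open>theta k t h\<close> is the mean-zero operator plus \<open>gam t x\<close> times
  an average of \<open>h\<close> against the probability density \<open>ek t x\<close>, and that
  average is at most \<open>b\<close>. The sup bound thus replaces a Carleson embedding.\<close>

lemma theta_decompose: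
  assumes t: "0 < t" and h: "integrable lborel h" "\<And>y. \<bar>h y\<bar> \<le> b"
  shows "(theta k t h x)\<^sup>2 \<le> 2 * (LINT y|lborel. rk t x y * h y)\<^sup>2 + 2 * b\<^sup>2 * (gam t x)\<^sup>2"
proof -
  have hm: "h \<in> borel_measurable lborel" using h by auto
  have i: "integrable lborel (\<lambda>y. ek t x y * h y)"
    using integrable_ek[OF t, of x]
  proof (rule Bochner_Integration.integrable_bound[OF integrable_mult_right[of b]])
    have "\<bar>h y\<bar> * ek t x y \<le> \<bar>b\<bar> * ek t x y" for y
      using h(2)[of y] by (intro mult_right_mono) auto
    then show "AE y in lborel. norm (ek t x y * h y) \<le> norm (b * ek t x y)"
      by (simp add: abs_mult mult.commute)
  qed (use hm integrable_ek[OF t, of x] in auto)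
  let ?R = "LINT y|lborel. rk t x y * h y"
  let ?E = "LINT y|lborel. ek t x y * h y"
  have "?R = theta k t h x - gam t x * ?E"
    unfolding rk_def theta_def using integrable_k_mult[OF t hm h(2), of x] i
    by (simp add: left_diff_distrib mult.assoc)
  then have eq: "theta k t h x = ?R + gam t x * ?E" by simp
  have "\<bar>?E\<bar> \<le> (LINT y|lborel. \<bar>ek t x y * h y\<bar>)" by (rule integral_abs_bound)
  also have "\<dots> \<le> (LINT y|lborel. b * ek t x y)"
    using integrable_abs[OF i] integrable_ek[OF t, of x] h(2)
    by (intro integral_mono) (auto simp: abs_mult mult.commute[of b] intro!: mult_left_mono)
  also have "\<dots> = b" using integral_ek[OF t, of x] by simp
  finally have E: "?E\<^sup>2 \<le> b\<^sup>2" by (metis abs_ge_zero power2_abs power_mono)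
  have "(theta k t h x)\<^sup>2 \<le> 2 * ?R\<^sup>2 + 2 * (gam t x * ?E)\<^sup>2"
    unfolding eq power2_sum using two_mult_le_squares[of ?R "gam t x * ?E"] by linarith
  also have "(gam t x * ?E)\<^sup>2 \<le> (gam t x)\<^sup>2 * b\<^sup>2"
    unfolding power_mult_distrib using E by (intro mult_left_mono) auto
  finally show ?thesis by (simp add: mult_ac)
qed

text \<open>The constant 1 is split into the indicator of \<open>T\<close>, to which the testing
  condition will apply, and that of the complement, which lies at distance at least \<open>l\<close>
  from \<open>x\<close> and which \<open>pk_far\<close> bounds by a multiple of
  \<open>(t / l) powr \<alpha>\<close>.\<close>

lemma gam_split:
  assumes t: "0 < t" and l: "0 < l" and T: "T \<in> sets borel" and far: "\<And>y. y \<notin> T \<Longrightarrow> l \<le> linf (x - y)"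
  shows "(gam t x)\<^sup>2 \<le> 2 * (theta k t (indicator T) x)\<^sup>2 + 2 * ((C * 2 powr (\<alpha> + real CARD('n)) * pk_const CARD('n) \<alpha>)\<^sup>2 * (t / l) powr (2 * \<alpha>))"
proof -
  let ?D = "C * 2 powr (\<alpha> + real CARD('n)) * pk_const CARD('n) \<alpha>"
  have D: "0 \<le> ?D" using C pk_const_pos[OF \<alpha>(1), of "CARD('n)"] by simp
  have Tm [measurable]: "T \<in> sets borel" by (rule T)
  have eq: "gam t x = theta k t (indicator T) x + theta k t (indicator (- T)) x"
  proof -
    have "integrable lborel (\<lambda>y. k t x y * indicator T y)" "integrable lborel (\<lambda>y. k t x y * indicator (- T) y)"
      using T by (auto intro!: integrable_k_mult[OF t, where c = 1] simp del: indicator_compl)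
    from Bochner_Integration.integral_add[OF this]
    have "theta k t (indicator T) x + theta k t (indicator (- T)) x = 
      (LINT y|lborel. k t x y * indicator T y + k t x y * indicator (- T) y)"
      by (simp only: theta_def)
    also have "\<dots> = gam t x" unfolding gam_def
      by (intro Bochner_Integration.integral_cong) (auto simp: indicator_def)
    finally show ?thesis by simp
  qed
  have "ennreal \<bar>theta k t (indicator (- T)) x\<bar> \<le> (\<integral>\<^sup>+ y. ennreal (C * ((t / l) powr \<alpha> * 2 powr (\<alpha> + real CARD('n)))) * ennreal (pk \<alpha> l x y) \<partial>lborel)"
  proof (rule order_trans[OF theta_le_nn_integral[OF t] nn_integral_mono])
    fix y
    have "C * (pk \<alpha> t x y * \<bar>indicator (- T) y\<bar>) \<le> C * ((t / l) powr \<alpha> * 2 powr (\<alpha> + real CARD('n))) * pk \<alpha> l x y"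
    proof (cases "y \<in> T")
      case False
      then show ?thesis using pk_far[OF t l far[OF False] \<alpha>(1)] C by (simp add: mult.assoc)
    qed (use C in simp)
    then show "ennreal (C * (pk \<alpha> t x y * \<bar>indicator (- T) y\<bar>)) \<le> ennreal (C * ((t / l) powr \<alpha> * 2 powr (\<alpha> + real CARD('n)))) * ennreal (pk \<alpha> l x y)"
      using C by (simp add: ennreal_leI flip: ennreal_mult)
  qed
  also have "\<dots> \<le> ennreal (C * ((t / l) powr \<alpha> * 2 powr (\<alpha> + real CARD('n)))) * ennreal (pk_const CARD('n) \<alpha>)"
    using l \<alpha> by (subst nn_integral_cmult) (auto intro!: mult_left_mono nn_integral_pk)
  also have "\<dots> = ennreal (?D * (t / l) powr \<alpha>)"
    using C pk_const_pos[OF \<alpha>(1), of "CARD('n)"] by (simp add: mult_ac less_imp_le flip: ennreal_mult)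
  finally have "\<bar>theta k t (indicator (- T)) x\<bar> \<le> ?D * (t / l) powr \<alpha>"
    using D by simp
  then have "(theta k t (indicator (- T)) x)\<^sup>2 \<le> (?D * (t / l) powr \<alpha>)\<^sup>2"
    by (metis abs_ge_zero power2_abs power_mono)
  also have "\<dots> = ?D\<^sup>2 * (t / l) powr (2 * \<alpha>)"
    using t l by (simp add: power_mult_distrib power2_eq_square flip: powr_add)
  finally show ?thesis
    unfolding eq power2_sum 
    using two_mult_le_squares[of "theta k t (indicator T) x" "theta k t (indicator (- T)) x"] by linarith
qed

lemma good_const_pos: "0 < good_const CARD('n) \<alpha> C CT"
proof -
  have "0 < 2 * (L2_const CARD('n) \<alpha> * (rk_const CARD('n) \<alpha> C)\<^sup>2) * 3 ^ CARD('n)" using L2_const_pos[OF \<alpha>(1), of "CARD('n)"] rk_const_pos by simp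
  then show ?thesis unfolding good_const_def using CT \<alpha> by (simp add: add_pos_nonneg)
qed

text \<open>What remains after \<open>theta_decompose\<close> is the square of \<open>gam\<close>
  integrated over the cube and the scales below \<open>l\<close>. Testing on the tripled cube, up to
  its own side, gives the main part, and every point of \<open>cube a l\<close> is at distance at
  least \<open>l\<close> from the complement of that cube.\<close>

lemma good_part_bound:
  assumes l: "0 < l" and hm: "h \<in> borel_measurable borel" and hb: "\<And>y. \<bar>h y\<bar> \<le> b"
    and supp: "\<And>y. y \<notin> cube (\<chi> i. a $ i - l) (3 * l) \<Longrightarrow> h y = 0"
  shows "(\<integral>\<^sup>+ x\<in>cube a l. energy h {0<..<l} x \<partial>lborel)
    \<le> ennreal (good_const CARD('n) \<alpha> C CT * b\<^sup>2 * l ^ CARD('n))"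
proof -
  let ?T = "cube (\<chi> i. a $ i - l) (3 * l)"
  let ?Q = "cube a l"
  let ?D = "C * 2 powr (\<alpha> + real CARD('n)) * pk_const CARD('n) \<alpha>"
  note [measurable] = hm
  have b: "0 \<le> b" using hb[of undefined] by linarith
  have T: "measure lborel ?T = (3 * l) ^ CARD('n)" "emeasure lborel ?T < \<infinity>" 
    using l by (simp_all add: measure_cube emeasure_cube)
  have hle: "\<bar>h y\<bar> \<le> b * indicator ?T y" for y using hb[of y] supp[of y] by (auto simp: indicator_def)
  have iT: "integrable lborel (indicator ?T :: _ \<Rightarrow> real)" using T by simp
  have hi: "integrable lborel h"
    by (rule Bochner_Integration.integrable_bound[OF integrable_mult_right[OF iT, of b]])
      (use hle b in auto)
  have h2: "(LINT y|lborel. (h y)\<^sup>2) \<le> b\<^sup>2 * (3 * l) ^ CARD('n)"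
  proof -
    have le: "(h y)\<^sup>2 \<le> b\<^sup>2 * indicator ?T y" for y
    proof -
      have "\<bar>h y\<bar>\<^sup>2 \<le> (b * indicator ?T y)\<^sup>2" by (intro power_mono hle) auto
      also have "\<dots> = b\<^sup>2 * indicator ?T y" by (simp add: indicator_def)
      finally show ?thesis by simp
    qed
    have "(LINT y|lborel. (h y)\<^sup>2) \<le> (LINT y|lborel. b\<^sup>2 * indicator ?T y)"
      using iT by (intro integral_mono le Bochner_Integration.integrable_bound[OF integrable_mult_right[OF iT, of "b\<^sup>2"]])
         (auto intro: order_trans[OF le])
    then show ?thesis using T by simp
  qed
  let ?R = "\<lambda>t x. LINT y|lborel. rk t x y * h y"
  let ?\<theta>T = "\<lambda>t x. theta k t (indicator ?T) x"
  have Rm [measurable]: "(\<lambda>w. ?R (fst w) (snd w)) \<in> borel_measurable (borel \<Otimes>\<^sub>M borel)" by measurable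
  have "(\<integral>\<^sup>+ x\<in>?Q. energy h {0<..<l} x \<partial>lborel) \<le>
    (\<integral>\<^sup>+ x. (\<integral>\<^sup>+ t. 2 * (ennreal ((?R t x)\<^sup>2 / t) * indicator {0<..} t)
        + ennreal (4 * b\<^sup>2) * (ennreal ((?\<theta>T t x)\<^sup>2 / t) * indicator {0<..<3 * l} t * indicator ?T x)
        + ennreal (4 * b\<^sup>2 * ?D\<^sup>2) * (ennreal ((t / l) powr (2 * \<alpha>) / t) * indicator {0<..<l} t * indicator ?Q x) \<partial>lborel) \<partial>lborel)"
  proof -
    have pt: "ennreal ((theta k t h x)\<^sup>2 / t) \<le> 2 * ennreal ((?R t x)\<^sup>2 / t)
        + ennreal (4 * b\<^sup>2) * ennreal ((?\<theta>T t x)\<^sup>2 / t)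
        + ennreal (4 * b\<^sup>2 * ?D\<^sup>2) * ennreal ((t / l) powr (2 * \<alpha>) / t)" if t: "0 < t" and x: "x \<in> ?Q" for t x
    proof -
      have far: "l \<le> linf (x - y)" if y: "y \<notin> ?T" for y
      proof -
        obtain i where i: "\<not> (a $ i - l \<le> y $ i \<and> y $ i < a $ i - l + 3 * l)" using y by (auto simp: cube_def)
        have "a $ i \<le> x $ i" "x $ i < a $ i + l" using x by (auto simp: cube_def)
        with i have "l \<le> \<bar>(x - y) $ i\<bar>" by auto
        then show ?thesis using component_le_linf order_trans by blast
      qed
      have g: "(gam t x)\<^sup>2 \<le> 2 * (?\<theta>T t x)\<^sup>2 + 2 * (?D\<^sup>2 * (t / l) powr (2 * \<alpha>))"
        by (rule gam_split[OF t l _ far]) auto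
      have "(theta k t h x)\<^sup>2 \<le> 2 * (?R t x)\<^sup>2 + 2 * b\<^sup>2 * (gam t x)\<^sup>2"
        by (rule theta_decompose[OF t hi hb])
      also have "\<dots> \<le> 2 * (?R t x)\<^sup>2 + 2 * b\<^sup>2 * (2 * (?\<theta>T t x)\<^sup>2 + 2 * (?D\<^sup>2 * (t / l) powr (2 * \<alpha>)))"
        using g by (intro add_left_mono mult_left_mono) auto
      finally have "(theta k t h x)\<^sup>2 / t \<le> (2 * (?R t x)\<^sup>2 + 2 * b\<^sup>2 * (2 * (?\<theta>T t x)\<^sup>2 + 2 * (?D\<^sup>2 * (t / l) powr (2 * \<alpha>)))) / t"
        using t by (intro divide_right_mono) auto
      also have "\<dots> = 2 * ((?R t x)\<^sup>2 / t) + 4 * b\<^sup>2 * ((?\<theta>T t x)\<^sup>2 / t) + 4 * b\<^sup>2 * ?D\<^sup>2 * ((t / l) powr (2 * \<alpha>) / t)"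
        by (simp add: add_divide_distrib distrib_left mult.assoc)
      finally have "ennreal ((theta k t h x)\<^sup>2 / t) \<le> ennreal (2 * ((?R t x)\<^sup>2 / t) + 4 * b\<^sup>2 * ((?\<theta>T t x)\<^sup>2 / t) + 4 * b\<^sup>2 * ?D\<^sup>2 * ((t / l) powr (2 * \<alpha>) / t))"
        by (rule ennreal_leI)
      then show ?thesis using t by (subst (asm) ennreal_combination3) auto
    qed
    have QT: "x \<in> ?T" if "x \<in> ?Q" for x using that l by (auto simp: cube_def) (smt (verit))+
    have "(\<integral>\<^sup>+ x\<in>?Q. energy h {0<..<l} x \<partial>lborel) =
      (\<integral>\<^sup>+ x. (\<integral>\<^sup>+ t. ennreal ((theta k t h x)\<^sup>2 / t) * indicator {0<..<l} t * indicator ?Q x \<partial>lborel) \<partial>lborel)"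
      by (subst nn_integral_multc[symmetric]) auto
    also have "\<dots> \<le> (\<integral>\<^sup>+ x. (\<integral>\<^sup>+ t. 2 * (ennreal ((?R t x)\<^sup>2 / t) * indicator {0<..} t)
        + ennreal (4 * b\<^sup>2) * (ennreal ((?\<theta>T t x)\<^sup>2 / t) * indicator {0<..<3 * l} t * indicator ?T x)
        + ennreal (4 * b\<^sup>2 * ?D\<^sup>2) * (ennreal ((t / l) powr (2 * \<alpha>) / t) * indicator {0<..<l} t * indicator ?Q x) \<partial>lborel) \<partial>lborel)"
    proof (intro nn_integral_mono)
      fix x t
      show "ennreal ((theta k t h x)\<^sup>2 / t) * indicator {0<..<l} t * indicator ?Q x \<le>
        2 * (ennreal ((?R t x)\<^sup>2 / t) * indicator {0<..} t)
        + ennreal (4 * b\<^sup>2) * (ennreal ((?\<theta>T t x)\<^sup>2 / t) * indicator {0<..<3 * l} t * indicator ?T x)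
        + ennreal (4 * b\<^sup>2 * ?D\<^sup>2) * (ennreal ((t / l) powr (2 * \<alpha>) / t) * indicator {0<..<l} t * indicator ?Q x)"
      proof (cases "0 < t \<and> t < l \<and> x \<in> ?Q")
        case True
        then show ?thesis using pt[of t x] QT[of x] by simp
      qed (auto simp: indicator_def)
    qed
    finally show ?thesis .
  qed
  also have "\<dots> = 2 * (\<integral>\<^sup>+ x. (\<integral>\<^sup>+ t\<in>{0<..}. ennreal ((?R t x)\<^sup>2 / t) \<partial>lborel) \<partial>lborel)
      + ennreal (4 * b\<^sup>2) * (\<integral>\<^sup>+ x\<in>?T. (\<integral>\<^sup>+ t\<in>{0<..<3 * l}. ennreal ((?\<theta>T t x)\<^sup>2 / t) \<partial>lborel) \<partial>lborel)
      + ennreal (4 * b\<^sup>2 * ?D\<^sup>2) * (\<integral>\<^sup>+ x\<in>?Q. (\<integral>\<^sup>+ t\<in>{0<..<l}. ennreal ((t / l) powr (2 * \<alpha>) / t) \<partial>lborel) \<partial>lborel)"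
    by (simp add: nn_integral_add nn_integral_cmult nn_integral_multc)
  also have "\<dots> \<le> 2 * ennreal (L2_const CARD('n) \<alpha> * (rk_const CARD('n) \<alpha> C)\<^sup>2 * (LINT y|lborel. (h y)\<^sup>2))
      + ennreal (4 * b\<^sup>2) * ennreal (CT * (3 * l) ^ CARD('n))
      + ennreal (4 * b\<^sup>2 * ?D\<^sup>2) * (ennreal (1 / (2 * \<alpha>)) * ennreal (l ^ CARD('n)))"
  proof (intro add_mono mult_left_mono)
    show "(\<integral>\<^sup>+ x. (\<integral>\<^sup>+ t\<in>{0<..}. ennreal ((?R t x)\<^sup>2 / t) \<partial>lborel) \<partial>lborel) \<le> ennreal (L2_const CARD('n) \<alpha> * (rk_const CARD('n) \<alpha> C)\<^sup>2 * (LINT y|lborel. (h y)\<^sup>2))"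
      by (rule rk.square_function_L2[OF hi hb])
    show "(\<integral>\<^sup>+ x\<in>?T. (\<integral>\<^sup>+ t\<in>{0<..<3 * l}. ennreal ((?\<theta>T t x)\<^sup>2 / t) \<partial>lborel) \<partial>lborel) \<le> ennreal (CT * (3 * l) ^ CARD('n))"
      using testing[unfolded testing_cond_def, rule_format, of "3 * l" "\<chi> i. a $ i - l"] l by simp
    have "(\<integral>\<^sup>+ x\<in>?Q. (\<integral>\<^sup>+ t\<in>{0<..<l}. ennreal ((t / l) powr (2 * \<alpha>) / t) \<partial>lborel) \<partial>lborel) \<le> (\<integral>\<^sup>+ x\<in>?Q. ennreal (1 / (2 * \<alpha>)) \<partial>lborel)"
      using l \<alpha> by (intro nn_integral_mono mult_right_mono nn_integral_powr_near_0) auto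
    also have "\<dots> = ennreal (1 / (2 * \<alpha>)) * ennreal (l ^ CARD('n))"
      using l by (subst nn_integral_cmult_indicator) (auto simp: emeasure_cube)
    finally show "(\<integral>\<^sup>+ x\<in>?Q. (\<integral>\<^sup>+ t\<in>{0<..<l}. ennreal ((t / l) powr (2 * \<alpha>) / t) \<partial>lborel) \<partial>lborel) \<le> ennreal (1 / (2 * \<alpha>)) * ennreal (l ^ CARD('n))" .
  qed auto
  also have "\<dots> \<le> ennreal (2 * (L2_const CARD('n) \<alpha> * (rk_const CARD('n) \<alpha> C)\<^sup>2 * (b\<^sup>2 * (3 * l) ^ CARD('n))) + 4 * b\<^sup>2 * (CT * (3 * l) ^ CARD('n)) + 4 * b\<^sup>2 * ?D\<^sup>2 * (1 / (2 * \<alpha>) * l ^ CARD('n)))"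
  proof -
    have L: "0 \<le> L2_const CARD('n) \<alpha> * (rk_const CARD('n) \<alpha> C)\<^sup>2" using L2_const_pos[OF \<alpha>(1), of "CARD('n)"] by simp
    have "2 * ennreal (L2_const CARD('n) \<alpha> * (rk_const CARD('n) \<alpha> C)\<^sup>2 * (LINT y|lborel. (h y)\<^sup>2)) \<le> 2 * ennreal (L2_const CARD('n) \<alpha> * (rk_const CARD('n) \<alpha> C)\<^sup>2 * (b\<^sup>2 * (3 * l) ^ CARD('n)))"
      using h2 L by (intro mult_left_mono ennreal_leI) auto
    then show ?thesis using L CT l \<alpha> 
      by (subst ennreal_combination3) (auto simp: ennreal_mult[symmetric] intro!: add_right_mono)
  qed
  also have "2 * (L2_const CARD('n) \<alpha> * (rk_const CARD('n) \<alpha> C)\<^sup>2 * (b\<^sup>2 * (3 * l) ^ CARD('n))) + 4 * b\<^sup>2 * (CT * (3 * l) ^ CARD('n)) + 4 * b\<^sup>2 * ?D\<^sup>2 * (1 / (2 * \<alpha>) * l ^ CARD('n))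
     = good_const CARD('n) \<alpha> C CT * b\<^sup>2 * l ^ CARD('n)"
    by (simp add: good_const_def power_mult_distrib[of 3 l] algebra_simps)
  finally show ?thesis .
qed

section \<open>Mean-zero pieces and their first-power energy\<close>

lemma nn_integral_le_pk_average:
  fixes b :: "real^'n \<Rightarrow> real"
  assumes b: "integrable lborel b" and s: "0 < s" and c: "0 \<le> c"
    and u: "\<And>x. u x \<le> (\<integral>\<^sup>+ y. ennreal c * ennreal (pk \<alpha> s x y * \<bar>b y\<bar>) \<partial>lborel)"
  shows "(\<integral>\<^sup>+ x. u x \<partial>lborel) \<le> ennreal (c * pk_const CARD('n) \<alpha> * (LINT y|lborel. \<bar>b y\<bar>))"
proof -
  have bm [measurable]: "b \<in> borel_measurable borel" using b by auto
  have "(\<integral>\<^sup>+ x. u x \<partial>lborel) \<le> (\<integral>\<^sup>+ x. (\<integral>\<^sup>+ y. ennreal c * ennreal (pk \<alpha> s x y * \<bar>b y\<bar>) \<partial>lborel) \<partial>lborel)"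
    by (intro nn_integral_mono u)
  also have "\<dots> = (\<integral>\<^sup>+ y. (\<integral>\<^sup>+ x. ennreal c * ennreal (pk \<alpha> s x y * \<bar>b y\<bar>) \<partial>lborel) \<partial>lborel)"
    by (rule lborel_pair.Fubini'[symmetric]) measurable
  also have "\<dots> = (\<integral>\<^sup>+ y. ennreal c * ((\<integral>\<^sup>+ x. ennreal (pk \<alpha> s x y) \<partial>lborel) * ennreal \<bar>b y\<bar>) \<partial>lborel)"
    by (simp add: ennreal_mult nn_integral_cmult nn_integral_multc)
  also have "\<dots> \<le> (\<integral>\<^sup>+ y. ennreal c * (ennreal (pk_const CARD('n) \<alpha>) * ennreal \<bar>b y\<bar>) \<partial>lborel)"
    using s \<alpha> by (intro nn_integral_mono mult_left_mono mult_right_mono nn_integral_pk') auto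
  also have "\<dots> = ennreal (c * pk_const CARD('n) \<alpha> * (LINT y|lborel. \<bar>b y\<bar>))"
    using b c pk_const_pos[OF \<alpha>(1), of "CARD('n)"]
    by (simp add: nn_integral_cmult nn_integral_eq_integral mult.assoc less_imp_le flip: ennreal_mult)
  finally show ?thesis .
qed

text \<open>The vanishing integral of \<open>b\<close> allows \<open>k t x y0\<close> to be
  subtracted. For \<open>t \<ge> p\<close> the support lies within distance \<open>t\<close> of
  \<open>y0\<close>, so the regularity of \<open>k\<close> applies and yields
  \<open>(p / t) powr \<alpha>\<close>.\<close>

lemma cancellative_part_large_t:
  fixes b :: "real^'n \<Rightarrow> real"
  assumes b: "integrable lborel b" and b0: "(LINT y|lborel. b y) = 0" 
    and p: "0 < p" "p \<le> t" and supp: "\<And>y. b y \<noteq> 0 \<Longrightarrow> linf (y - y0) < p"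
  shows "(\<integral>\<^sup>+ x. ennreal \<bar>theta k t b x\<bar> \<partial>lborel) \<le> ennreal (C * pk_const CARD('n) \<alpha> * (LINT y|lborel. \<bar>b y\<bar>)) * ennreal ((p / t) powr \<alpha>)"
proof -
  have t: "0 < t" using p by simp
  let ?c = "C * (p / t) powr \<alpha>"
  note [measurable] = borel_measurable_integrable[OF b]
  have bm: "b \<in> borel_measurable borel" using b by auto
  have "ennreal \<bar>theta k t b x\<bar> \<le> (\<integral>\<^sup>+ y. ennreal ?c * ennreal (pk \<alpha> t x y * \<bar>b y\<bar>) \<partial>lborel)" for x
  proof -
    have eq: "theta k t b x = (LINT y|lborel. (k t x y - k t x y0) * b y)"
      unfolding theta_def left_diff_distrib using integrable_k_mult'[OF t b, of x] b b0 by simp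
    have i: "integrable lborel (\<lambda>y. (k t x y - k t x y0) * b y)"
      unfolding left_diff_distrib using integrable_k_mult'[OF t b, of x] b by simp
    have "ennreal \<bar>theta k t b x\<bar> \<le> (\<integral>\<^sup>+ y. ennreal \<bar>(k t x y - k t x y0) * b y\<bar> \<partial>lborel)"
      using integral_norm_bound_ennreal[OF i] by (simp add: eq)
    also have "\<dots> \<le> (\<integral>\<^sup>+ y. ennreal ?c * ennreal (pk \<alpha> t x y * \<bar>b y\<bar>) \<partial>lborel)"
    proof (rule nn_integral_mono)
      fix y
      have "\<bar>(k t x y - k t x y0) * b y\<bar> \<le> ?c * (pk \<alpha> t x y * \<bar>b y\<bar>)"
      proof (cases "b y = 0")
        case False
        then have y: "linf (y - y0) < p" by (rule supp)
        have "\<bar>k t x y - k t x y0\<bar> \<le> C * (linf (y - y0) / t) powr \<alpha> * pk \<alpha> t x y"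
          using k_smooth[OF t, of x x y y0] y p by simp
        also have "\<dots> \<le> ?c * pk \<alpha> t x y"
          using y p t C \<alpha> by (intro mult_right_mono mult_left_mono powr_mono2 divide_right_mono) auto
        finally show ?thesis by (simp add: abs_mult mult.assoc[symmetric] mult_right_mono)
      qed simp
      then show "ennreal \<bar>(k t x y - k t x y0) * b y\<bar> \<le> ennreal ?c * ennreal (pk \<alpha> t x y * \<bar>b y\<bar>)"
        using C by (simp add: ennreal_leI flip: ennreal_mult)
    qed
    finally show ?thesis .
  qed
  from nn_integral_le_pk_average[OF b t _ this]
  have "(\<integral>\<^sup>+ x. ennreal \<bar>theta k t b x\<bar> \<partial>lborel) \<le> ennreal (?c * pk_const CARD('n) \<alpha> * (LINT y|lborel. \<bar>b y\<bar>))"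
    using C by simp
  then show ?thesis
    using C pk_const_pos[OF \<alpha>(1), of "CARD('n)"] by (simp add: mult_ac less_imp_le flip: ennreal_mult)
qed

text \<open>The size of the kernel is enough here: seen from \<open>Z\<close>, the support of
  \<open>b\<close> is at distance at least \<open>p\<close>, and \<open>pk_far\<close> gains
  \<open>(t / p) powr \<alpha>\<close>.\<close>

lemma far_part_small_t:
  fixes b :: "real^'n \<Rightarrow> real"
  assumes b: "integrable lborel b" and t: "0 < t" and p: "0 < p"
    and supp: "\<And>x y. x \<in> Z \<Longrightarrow> b y \<noteq> 0 \<Longrightarrow> p \<le> linf (x - y)"
  shows "(\<integral>\<^sup>+ x\<in>Z. ennreal \<bar>theta k t b x\<bar> \<partial>lborel) 
    \<le> ennreal (C * pk_const CARD('n) \<alpha> * 2 powr (\<alpha> + real CARD('n)) * (LINT y|lborel. \<bar>b y\<bar>)) * ennreal ((t / p) powr \<alpha>)"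
proof -
  let ?c = "C * ((t / p) powr \<alpha> * 2 powr (\<alpha> + real CARD('n)))"
  note [measurable] = borel_measurable_integrable[OF b]
  have bm: "b \<in> borel_measurable borel" using b by auto
  have "ennreal \<bar>theta k t b x\<bar> * indicator Z x \<le> (\<integral>\<^sup>+ y. ennreal ?c * ennreal (pk \<alpha> p x y * \<bar>b y\<bar>) \<partial>lborel)" for x
  proof (cases "x \<in> Z")
    case True
    have "ennreal \<bar>theta k t b x\<bar> \<le> (\<integral>\<^sup>+ y. ennreal ?c * ennreal (pk \<alpha> p x y * \<bar>b y\<bar>) \<partial>lborel)"
    proof (rule order_trans[OF theta_le_nn_integral[OF t] nn_integral_mono])
      fix y
      have "C * (pk \<alpha> t x y * \<bar>b y\<bar>) \<le> C * (((t / p) powr \<alpha> * 2 powr (\<alpha> + real CARD('n)) * pk \<alpha> p x y) * \<bar>b y\<bar>)"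
      proof (cases "b y = 0")
        case False
        show ?thesis using C \<alpha> t p supp[OF True False] by (intro mult_left_mono mult_right_mono pk_far) auto
      qed simp
      then show "ennreal (C * (pk \<alpha> t x y * \<bar>b y\<bar>)) \<le> ennreal ?c * ennreal (pk \<alpha> p x y * \<bar>b y\<bar>)"
        using C by (simp add: ennreal_leI mult.assoc flip: ennreal_mult)
    qed
    then show ?thesis using True by simp
  qed simp
  from nn_integral_le_pk_average[OF b p _ this]
  have "(\<integral>\<^sup>+ x\<in>Z. ennreal \<bar>theta k t b x\<bar> \<partial>lborel) \<le> ennreal (?c * pk_const CARD('n) \<alpha> * (LINT y|lborel. \<bar>b y\<bar>))"
    using C by simp
  then show ?thesis
    using C pk_const_pos[OF \<alpha>(1), of "CARD('n)"] by (simp add: mult_ac less_imp_le flip: ennreal_mult)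
qed

text \<open>The scales are split at \<open>t = p\<close>: cancellation above, separation below. When
  \<open>p \<le> e\<close>, no scale below \<open>p\<close> survives the truncation; this
  alternative serves the pieces on the smallest cubes, around which nothing is removed.\<close>

lemma bad_part_bound:
  fixes b :: "real^'n \<Rightarrow> real"
  assumes b: "integrable lborel b" and b0: "(LINT y|lborel. b y) = 0" and p: "0 < p" and e: "0 \<le> e"
    and Z: "Z \<in> sets borel" and near: "\<And>y. b y \<noteq> 0 \<Longrightarrow> linf (y - y0) < p"
    and far: "p \<le> e \<or> (\<forall>x\<in>Z. \<forall>y. b y \<noteq> 0 \<longrightarrow> p \<le> linf (x - y))"
  shows "(\<integral>\<^sup>+ x\<in>Z. (\<integral>\<^sup>+ t\<in>{e<..}. ennreal (\<bar>theta k t b x\<bar> / t) \<partial>lborel) \<partial>lborel)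
    \<le> ennreal (bad_const CARD('n) \<alpha> C * (LINT y|lborel. \<bar>b y\<bar>))"
proof -
  note [measurable] = borel_measurable_integrable[OF b] Z
  have bm: "b \<in> borel_measurable borel" using b by auto
  let ?n = "LINT y|lborel. \<bar>b y\<bar>" and ?P = "pk_const CARD('n) \<alpha>" and ?g = "2 powr (\<alpha> + real CARD('n))"
  have n: "0 \<le> ?n" by simp
  have P: "0 \<le> ?P" using pk_const_pos[OF \<alpha>(1), of "CARD('n)"] by simp
  have [measurable]: "(\<lambda>w. theta k (fst w) b (snd w)) \<in> borel_measurable (borel \<Otimes>\<^sub>M borel)" using bm by measurable
  have [measurable]: "(\<lambda>w. theta k (snd w) b (fst w)) \<in> borel_measurable (borel \<Otimes>\<^sub>M borel)" using bm by measurable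
  have [measurable]: "(\<lambda>x. theta k t b x) \<in> borel_measurable borel" "(\<lambda>t. theta k t b x) \<in> borel_measurable borel" for t x
    using bm by measurable
  have "(\<integral>\<^sup>+ x\<in>Z. (\<integral>\<^sup>+ t\<in>{e<..}. ennreal (\<bar>theta k t b x\<bar> / t) \<partial>lborel) \<partial>lborel) =
    (\<integral>\<^sup>+ x. (\<integral>\<^sup>+ t. ennreal (\<bar>theta k t b x\<bar> / t) * indicator {e<..} t * indicator Z x \<partial>lborel) \<partial>lborel)"
    by (subst nn_integral_multc[symmetric]) auto
  also have "\<dots> = (\<integral>\<^sup>+ t. (\<integral>\<^sup>+ x. ennreal (\<bar>theta k t b x\<bar> / t) * indicator {e<..} t * indicator Z x \<partial>lborel) \<partial>lborel)"
    by (rule lborel_pair.Fubini') measurable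
  also have "\<dots> \<le> (\<integral>\<^sup>+ t. ennreal (C * ?P * ?g * ?n) * (ennreal ((t / p) powr \<alpha> / t) * indicator {0<..<p} t) +
      ennreal (C * ?P * ?n) * (ennreal ((p / t) powr \<alpha> / t) * indicator {p..} t) \<partial>lborel)"
  proof (rule nn_integral_mono)
    fix t :: real
    consider "t \<le> e" | "e < t" "t < p" | "e < t" "p \<le> t" by linarith
    then show "(\<integral>\<^sup>+ x. ennreal (\<bar>theta k t b x\<bar> / t) * indicator {e<..} t * indicator Z x \<partial>lborel) \<le>
      ennreal (C * ?P * ?g * ?n) * (ennreal ((t / p) powr \<alpha> / t) * indicator {0<..<p} t) +
      ennreal (C * ?P * ?n) * (ennreal ((p / t) powr \<alpha> / t) * indicator {p..} t)"
    proof cases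
      case 2
      then have t: "0 < t" using e by simp
      have "(\<integral>\<^sup>+ x. ennreal (\<bar>theta k t b x\<bar> / t) * indicator {e<..} t * indicator Z x \<partial>lborel) =
        (\<integral>\<^sup>+ x. ennreal (1 / t) * (ennreal \<bar>theta k t b x\<bar> * indicator Z x) \<partial>lborel)"
        using 2 t by (intro nn_integral_cong) (simp add: mult.assoc[symmetric] flip: ennreal_mult)
      also have "\<dots> = ennreal (1 / t) * (\<integral>\<^sup>+ x\<in>Z. ennreal \<bar>theta k t b x\<bar> \<partial>lborel)"
        by (rule nn_integral_cmult) measurable
      also have "\<dots> \<le> ennreal (1 / t) * (ennreal (C * ?P * ?g * ?n) * ennreal ((t / p) powr \<alpha>))"
        using far 2 by (intro mult_left_mono far_part_small_t[OF b t p]) auto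
      also have "\<dots> = ennreal (C * ?P * ?g * ?n) * (ennreal ((t / p) powr \<alpha> / t))"
        using t C P n by (simp add: mult_ac flip: ennreal_mult)
      finally show ?thesis using 2 t by simp
    next
      case 3
      then have t: "0 < t" using e by simp
      have "(\<integral>\<^sup>+ x. ennreal (\<bar>theta k t b x\<bar> / t) * indicator {e<..} t * indicator Z x \<partial>lborel) \<le>
        (\<integral>\<^sup>+ x. ennreal (1 / t) * (ennreal \<bar>theta k t b x\<bar>) \<partial>lborel)"
        using 3 t by (intro nn_integral_mono) (simp add: indicator_def flip: ennreal_mult)
      also have "\<dots> = ennreal (1 / t) * (\<integral>\<^sup>+ x. ennreal \<bar>theta k t b x\<bar> \<partial>lborel)"
        by (rule nn_integral_cmult) measurable
      also have "\<dots> \<le> ennreal (1 / t) * (ennreal (C * ?P * ?n) * ennreal ((p / t) powr \<alpha>))"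
        using near 3 by (intro mult_left_mono cancellative_part_large_t[OF b b0 p]) auto
      also have "\<dots> = ennreal (C * ?P * ?n) * (ennreal ((p / t) powr \<alpha> / t))"
        using t C P n by (simp add: mult_ac flip: ennreal_mult)
      finally show ?thesis using 3 t by simp
    qed simp
  qed
  also have "\<dots> = ennreal (C * ?P * ?g * ?n) * (\<integral>\<^sup>+ t. ennreal ((t / p) powr \<alpha> / t) * indicator {0<..<p} t \<partial>lborel) +
      ennreal (C * ?P * ?n) * (\<integral>\<^sup>+ t. ennreal ((p / t) powr \<alpha> / t) * indicator {p..} t \<partial>lborel)"
    by (simp add: nn_integral_add nn_integral_cmult)
  also have "\<dots> \<le> ennreal (C * ?P * ?g * ?n) * ennreal (1 / \<alpha>) + ennreal (C * ?P * ?n) * ennreal (1 / \<alpha>)"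
    using p \<alpha> by (intro add_mono mult_left_mono nn_integral_powr_near_0 nn_integral_powr_near_inf) auto
  also have "\<dots> = ennreal (C * ?P * ?g * ?n * (1 / \<alpha>) + C * ?P * ?n * (1 / \<alpha>))"
    using C P n \<alpha> by (simp add: ennreal_mult[symmetric] ennreal_plus[symmetric] del: ennreal_plus)
  also have "C * ?P * ?g * ?n * (1 / \<alpha>) + C * ?P * ?n * (1 / \<alpha>) = bad_const CARD('n) \<alpha> C * ?n"
    by (simp add: bad_const_def algebra_simps add_divide_distrib)
  finally show ?thesis .
qed

lemma bad_const_pos: "0 < bad_const CARD('n) \<alpha> C"
  using C \<alpha> pk_const_pos[OF \<alpha>(1), of "CARD('n)"] by (simp add: bad_const_def add_pos_nonneg)

end

section \<open>Dyadic grids\<close>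

lemma finite_vec_bounded: "finite {n :: int^'n. \<forall>i. lo \<le> n $ i \<and> n $ i \<le> hi}"
proof -
  have "{n :: int^'n. \<forall>i. lo \<le> n $ i \<and> n $ i \<le> hi} \<subseteq> vec_lambda ` (PiE UNIV (\<lambda>_. {lo..hi}))"
  proof
    fix n :: "int^'n" assume "n \<in> {n. \<forall>i. lo \<le> n $ i \<and> n $ i \<le> hi}"
    then have "vec_nth n \<in> PiE UNIV (\<lambda>_. {lo..hi})" by auto
    then have "vec_lambda (vec_nth n) \<in> vec_lambda ` (PiE UNIV (\<lambda>_. {lo..hi}))" by (rule imageI)
    then show "n \<in> vec_lambda ` (PiE UNIV (\<lambda>_. {lo..hi}))" by simp
  qed
  then show ?thesis by (rule finite_subset) (intro finite_imageI finite_PiE, auto)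
qed

text \<open>Encoded as a measure with density rather than as a set integral, so that monotonicity
  and additivity come from \<open>finite_measure\<close>; \<open>mass_eq_integral\<close> translates
  back.\<close>

definition mass :: "(real^'n \<Rightarrow> real) \<Rightarrow> (real^'n) set \<Rightarrow> real" where
  "mass f X = measure (density lborel (\<lambda>y. ennreal \<bar>f y\<bar>)) X"

lemma finite_measure_mass: "integrable lborel f \<Longrightarrow> finite_measure (density lborel (\<lambda>y. ennreal \<bar>f y\<bar>))"
  by (intro finite_measureI) (auto simp: emeasure_density nn_integral_eq_integral integrable_abs)

lemma mass_nonneg [simp]: "0 \<le> mass f X"
  by (simp add: mass_def)

lemma emeasure_mass:
  assumes "integrable lborel f" "X \<in> sets borel"
  shows "ennreal (mass f X) = (\<integral>\<^sup>+ y\<in>X. ennreal \<bar>f y\<bar> \<partial>lborel)"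
proof -
  interpret finite_measure "density lborel (\<lambda>y. ennreal \<bar>f y\<bar>)" by (rule finite_measure_mass) fact
  have "ennreal (mass f X) = emeasure (density lborel (\<lambda>y. ennreal \<bar>f y\<bar>)) X"
    unfolding mass_def by (rule emeasure_eq_measure[symmetric])
  then show ?thesis using assms by (simp add: emeasure_density)
qed

lemma mass_eq_integral:
  assumes "integrable lborel f" "X \<in> sets borel"
  shows "mass f X = (LINT y:X|lborel. \<bar>f y\<bar>)"
proof -
  have i: "set_integrable lborel X (\<lambda>y. \<bar>f y\<bar>)"
    unfolding set_integrable_def using assms by (intro integrable_mult_indicator) auto
  then have "integrable lborel (\<lambda>y. indicator X y * \<bar>f y\<bar>)" by (simp add: set_integrable_def)
  then have "(\<integral>\<^sup>+ y. ennreal (indicator X y * \<bar>f y\<bar>) \<partial>lborel) = ennreal (LINT y|lborel. indicator X y * \<bar>f y\<bar>)"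
    by (rule nn_integral_eq_integral) simp
  moreover have "(\<integral>\<^sup>+ y. ennreal (indicator X y * \<bar>f y\<bar>) \<partial>lborel) = (\<integral>\<^sup>+ y\<in>X. ennreal \<bar>f y\<bar> \<partial>lborel)"
    by (intro nn_integral_cong) (auto simp: indicator_def)
  moreover have "0 \<le> (LINT y|lborel. indicator X y * \<bar>f y\<bar>)" by (intro Bochner_Integration.integral_nonneg) auto
  ultimately show ?thesis using emeasure_mass[OF assms]
    by (simp add: set_lebesgue_integral_def)
qed

lemma mass_mono:
  assumes "integrable lborel f" "X \<subseteq> Y" "Y \<in> sets borel"
  shows "mass f X \<le> mass f Y"
proof -
  interpret finite_measure "density lborel (\<lambda>y. ennreal \<bar>f y\<bar>)" by (rule finite_measure_mass) fact
  show ?thesis unfolding mass_def using assms by (intro finite_measure_mono) auto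
qed

lemma mass_UN_le:
  assumes "integrable lborel f" "finite I" "\<And>i. i \<in> I \<Longrightarrow> X i \<in> sets borel"
  shows "mass f (\<Union>i\<in>I. X i) \<le> (\<Sum>i\<in>I. mass f (X i))"
proof -
  interpret finite_measure "density lborel (\<lambda>y. ennreal \<bar>f y\<bar>)" by (rule finite_measure_mass) fact
  show ?thesis unfolding mass_def using assms by (intro finite_measure_subadditive_finite) auto
qed

lemma mass_UN_disjoint:
  assumes "integrable lborel f" "finite I" "\<And>i. i \<in> I \<Longrightarrow> X i \<in> sets borel" "disjoint_family_on X I"
  shows "mass f (\<Union>i\<in>I. X i) = (\<Sum>i\<in>I. mass f (X i))"
proof -
  interpret finite_measure "density lborel (\<lambda>y. ennreal \<bar>f y\<bar>)" by (rule finite_measure_mass) fact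
  show ?thesis unfolding mass_def using assms by (intro finite_measure_finite_Union) auto
qed

lemma mass_cong:
  assumes "integrable lborel f" "integrable lborel g" "X \<in> sets borel" "\<And>y. y \<in> X \<Longrightarrow> \<bar>f y\<bar> = \<bar>g y\<bar>"
  shows "mass f X = mass g X"
proof -
  have "ennreal (mass f X) = ennreal (mass g X)"
    unfolding emeasure_mass[OF assms(1,3)] emeasure_mass[OF assms(2,3)]
    by (intro nn_integral_cong) (auto simp: indicator_def assms(4))
  then show ?thesis by simp
qed

locale grid =
  fixes a :: "real^'n" and L :: real
  assumes L: "0 < L"
begin

definition side :: "nat \<Rightarrow> real" where "side m = L / 2 ^ m"

text \<open>Cells will be the fibres of \<open>idx m\<close> and dilates will be read off from index
  differences, so that partition, nesting and adjacency become integer arithmetic with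
  \<open>div 2\<close>.\<close>

definition idx :: "nat \<Rightarrow> real^'n \<Rightarrow> int^'n" where
  "idx m x = (\<chi> i. \<lfloor>(x $ i - a $ i) / side m\<rfloor>)"

definition cell :: "nat \<Rightarrow> int^'n \<Rightarrow> (real^'n) set" where
  "cell m n = {x. idx m x = n}"

definition tri :: "nat \<Rightarrow> int^'n \<Rightarrow> (real^'n) set" where
  "tri m n = {x. \<forall>i. \<bar>idx m x $ i - n $ i\<bar> \<le> 1}"

abbreviation "cell_of p \<equiv> cell (fst p) (snd p)"
abbreviation "tri_of p \<equiv> tri (fst p) (snd p)"

lemma side_pos [simp]: "0 < side m"
  using L by (simp add: side_def)

lemma weight_nonneg: "mass F X \<le> w * side m ^ j \<Longrightarrow> 0 \<le> w"
  by (smt (verit) mass_nonneg mult_neg_pos zero_less_power side_pos)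

lemma side_Suc: "side m = 2 * side (Suc m)"
  by (simp add: side_def)

lemma side_antimono: "m \<le> m' \<Longrightarrow> side m' \<le> side m"
  using L by (simp add: side_def frac_le)

lemma mem_cell_idx [simp]: "x \<in> cell m (idx m x)"
  by (simp add: cell_def)

lemma mem_tri_idx [simp]: "x \<in> tri m (idx m x)"
  by (simp add: tri_def)

lemma cell_subset_tri: "cell m n \<subseteq> tri m n"
  by (auto simp: cell_def tri_def)

lemma floor_divide_iff: "\<lfloor>(u - c) / side m\<rfloor> = z \<longleftrightarrow> c + side m * of_int z \<le> u \<and> u < c + side m * of_int z + side m"
  using side_pos[of m] by (simp add: floor_eq_iff pos_le_divide_eq pos_divide_less_eq algebra_simps)

lemma cell_eq_cube: "cell m n = cube (\<chi> i. a $ i + side m * of_int (n $ i)) (side m)"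
  unfolding cell_def cube_def idx_def vec_eq_iff by (simp add: floor_divide_iff)

lemma tri_eq_cube: "tri m n = cube (\<chi> i. (\<chi> i. a $ i + side m * of_int (n $ i)) $ i - side m) (3 * side m)"
proof -
  have "\<bar>\<lfloor>(u - c) / side m\<rfloor> - z\<bar> \<le> 1 \<longleftrightarrow> c + side m * of_int z - side m \<le> u \<and> u < c + side m * of_int z - side m + 3 * side m" for u c and z :: int
  proof -
    have "\<bar>\<lfloor>(u - c) / side m\<rfloor> - z\<bar> \<le> 1 \<longleftrightarrow> z - 1 \<le> \<lfloor>(u - c) / side m\<rfloor> \<and> \<lfloor>(u - c) / side m\<rfloor> < z + 2" by linarith
    also have "\<dots> \<longleftrightarrow> of_int (z - 1) \<le> (u - c) / side m \<and> (u - c) / side m < of_int (z + 2)"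
      by (simp only: le_floor_iff floor_less_iff)
    also have "\<dots> \<longleftrightarrow> c + side m * of_int z - side m \<le> u \<and> u < c + side m * of_int z - side m + 3 * side m"
      using side_pos[of m] by (simp only: pos_le_divide_eq pos_divide_less_eq) (auto simp: algebra_simps)
    finally show ?thesis .
  qed
  then show ?thesis unfolding tri_def cube_def idx_def by simp
qed

lemma cell_borel [measurable, simp]: "cell m n \<in> sets borel"
  by (simp add: cell_eq_cube)

lemma tri_borel [measurable, simp]: "tri m n \<in> sets borel"
  by (simp add: tri_eq_cube)

lemma emeasure_cell: "emeasure lborel (cell m n) = ennreal (side m ^ CARD('n))"
  unfolding cell_eq_cube by (rule emeasure_cube) (simp add: less_imp_le)

lemma emeasure_tri: "emeasure lborel (tri m n) = ennreal ((3 * side m) ^ CARD('n))"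
  unfolding tri_eq_cube by (rule emeasure_cube) (simp add: less_imp_le)

lemma measure_cell: "measure lborel (cell m n) = side m ^ CARD('n)"
  unfolding cell_eq_cube by (rule measure_cube) (simp add: less_imp_le)

lemma cell_nonempty: "cell m n \<noteq> {}"
  using emeasure_cell[of m n] side_pos[of m] by (metis emeasure_empty ennreal_eq_0_iff not_le zero_less_power)

lemma idx_Suc: "idx m x $ i = idx (Suc m) x $ i div 2"
proof -
  have "(x $ i - a $ i) / side m = ((x $ i - a $ i) / side (Suc m)) / real_of_int 2"
    unfolding side_Suc[of m] by simp
  also have "\<lfloor>\<dots>\<rfloor> = \<lfloor>(x $ i - a $ i) / side (Suc m)\<rfloor> div 2"
    by (rule floor_divide_real_eq_div) simp
  finally show ?thesis by (simp add: idx_def)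
qed

lemma idx_coarser: "m \<le> m' \<Longrightarrow> idx m' x = idx m' y \<Longrightarrow> idx m x = idx m y"
proof (induction m' rule: dec_induct)
  case (step j)
  then have "idx j x = idx j y" unfolding vec_eq_iff idx_Suc[of j] by simp
  with step show ?case by simp
qed simp

text \<open>Integers at most 1 apart stay at most 1 apart after \<open>div 2\<close>; hence the
  dilates around a point decrease with the generation.\<close>

lemma tri_coarser: "m \<le> m' \<Longrightarrow> y \<in> tri m' (idx m' x) \<Longrightarrow> y \<in> tri m (idx m x)"
proof (induction m' rule: dec_induct)
  case (step j)
  have "\<bar>u div 2 - v div 2\<bar> \<le> 1" if "\<bar>u - v\<bar> \<le> 1" for u v :: int using that by linarith
  then have "y \<in> tri j (idx j x)" using step.prems unfolding tri_def idx_Suc[of j] by auto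
  with step show ?case by simp
qed simp

lemma cell_coarser: "m \<le> m' \<Longrightarrow> cell m' (idx m' x) \<subseteq> cell m (idx m x)"
  unfolding cell_def using idx_coarser[of m m' _ x] by blast

lemma tri_sym: "y \<in> tri m (idx m x) \<longleftrightarrow> x \<in> tri m (idx m y)"
  by (simp add: tri_def abs_minus_commute)

lemma cell_dist: "x \<in> cell m n \<Longrightarrow> y \<in> cell m n \<Longrightarrow> linf (x - y) < side m"
  unfolding linf_less_iff
proof
  fix i assume "x \<in> cell m n" "y \<in> cell m n"
  then have "a $ i + side m * of_int (n $ i) \<le> x $ i" "x $ i < a $ i + side m * of_int (n $ i) + side m"
    "a $ i + side m * of_int (n $ i) \<le> y $ i" "y $ i < a $ i + side m * of_int (n $ i) + side m"
    by (auto simp: cell_eq_cube cube_def)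
  then show "\<bar>(x - y) $ i\<bar> < side m" unfolding vector_minus_component by linarith
qed

lemma tri_dist:
  assumes "y \<notin> tri m (idx m x)"
  shows "side m \<le> linf (x - y)"
proof -
  obtain i where i: "\<not> \<bar>idx m y $ i - idx m x $ i\<bar> \<le> 1" using assms by (auto simp: tri_def)
  have "side m \<le> \<bar>x $ i - y $ i\<bar>"
  proof (rule ccontr)
    assume "\<not> side m \<le> \<bar>x $ i - y $ i\<bar>"
    then have "\<bar>(x $ i - a $ i) / side m - (y $ i - a $ i) / side m\<bar> < 1"
      by (simp add: diff_divide_distrib[symmetric] abs_divide)
    then have "\<bar>\<lfloor>(x $ i - a $ i) / side m\<rfloor> - \<lfloor>(y $ i - a $ i) / side m\<rfloor>\<bar> \<le> 1" by linarith
    then show False using i by (simp add: idx_def)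
  qed
  then show ?thesis using component_le_linf[of "x - y" i] by simp
qed

lemma tri_eq_UN_cells: "tri m n = (\<Union>n'\<in>{n'. \<forall>i. \<bar>n' $ i - n $ i\<bar> \<le> 1}. cell m n')"
  by (auto simp: tri_def cell_def)

lemma finite_neighbours: "finite {n' :: int^'n. \<forall>i. \<bar>n' $ i - n $ i\<bar> \<le> 1}"
proof (rule finite_subset[OF _ finite_vec_bounded])
  let ?M = "Max (range (\<lambda>i. \<bar>n $ i\<bar>)) + 1"
  show "{n' :: int^'n. \<forall>i. \<bar>n' $ i - n $ i\<bar> \<le> 1} \<subseteq> {n'. \<forall>i. - ?M \<le> n' $ i \<and> n' $ i \<le> ?M}"
  proof safe
    fix n' :: "int^'n" and i assume "\<forall>i. \<bar>n' $ i - n $ i\<bar> \<le> 1"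
    then have "\<bar>n' $ i - n $ i\<bar> \<le> 1" by blast
    moreover have "\<bar>n $ i\<bar> \<le> Max (range (\<lambda>i. \<bar>n $ i\<bar>))" by (intro Max_ge) auto
    ultimately show "- ?M \<le> n' $ i" "n' $ i \<le> ?M" by linarith+
  qed
qed

lemma disjoint_cells: "disjoint_family_on (cell m) X"
  by (auto simp: disjoint_family_on_def cell_def)

text \<open>Counted by volume: \<open>tri 0 n\<close> is the disjoint union of the neighbouring
  cells and has \<open>3 ^ d\<close> times their common measure.\<close>

lemma card_neighbours: "real (card {n' :: int^'n. \<forall>i. \<bar>n' $ i - n $ i\<bar> \<le> 1}) = 3 ^ CARD('n)"
proof -
  let ?N = "{n' :: int^'n. \<forall>i. \<bar>n' $ i - n $ i\<bar> \<le> 1}"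
  have "emeasure lborel (tri 0 n) = (\<Sum>n'\<in>?N. emeasure lborel (cell 0 n'))"
    unfolding tri_eq_UN_cells
    by (rule sum_emeasure[symmetric]) (auto simp: disjoint_cells finite_neighbours)
  then have "ennreal ((3 * side 0) ^ CARD('n)) = ennreal (real (card ?N) * side 0 ^ CARD('n))"
    by (simp add: emeasure_tri emeasure_cell less_imp_le ennreal_mult ennreal_of_nat_eq_real_of_nat)
  then have "(3 * side 0) ^ CARD('n) = real (card ?N) * side 0 ^ CARD('n)"
    by (subst (asm) ennreal_inj) (auto simp: less_imp_le)
  then show ?thesis using side_pos[of 0] by (simp add: power_mult_distrib)
qed

lemma finite_idx_tri: "finite (idx m ` tri m0 n0)"
proof (rule finite_subset[OF _ finite_vec_bounded])
  let ?b = "\<lambda>i. a $ i + side m0 * of_int (n0 $ i) - side m0"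
  define R where "R = Max (range (\<lambda>i. \<bar>?b i - a $ i\<bar>)) + 3 * side m0"
  show "idx m ` tri m0 n0 \<subseteq> {n'. \<forall>i. \<lfloor>- R / side m\<rfloor> \<le> n' $ i \<and> n' $ i \<le> \<lfloor>R / side m\<rfloor>}"
  proof safe
    fix x i assume "x \<in> tri m0 n0"
    then have "?b i \<le> x $ i" "x $ i < ?b i + 3 * side m0" by (auto simp: tri_eq_cube cube_def)
    moreover have "\<bar>?b i - a $ i\<bar> \<le> Max (range (\<lambda>i. \<bar>?b i - a $ i\<bar>))" by (intro Max_ge) auto
    ultimately have "- R \<le> x $ i - a $ i" "x $ i - a $ i \<le> R" unfolding R_def by linarith+
    then have "- R / side m \<le> (x $ i - a $ i) / side m \<and> (x $ i - a $ i) / side m \<le> R / side m"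
      using less_imp_le[OF side_pos] by (meson divide_right_mono)
    then show "\<lfloor>- R / side m\<rfloor> \<le> idx m x $ i" "idx m x $ i \<le> \<lfloor>R / side m\<rfloor>"
      unfolding idx_def vec_lambda_beta by (auto intro: floor_mono)
  qed
qed

text \<open>Cubes of generation \<open>N\<close> always stop, so the stopping cubes of a bounded set form a finite partition.\<close>
definition first_stop :: "(nat \<Rightarrow> int^'n \<Rightarrow> bool) \<Rightarrow> nat \<Rightarrow> nat \<Rightarrow> real^'n \<Rightarrow> nat" where
  "first_stop B m0 N x = (LEAST m. m0 \<le> m \<and> (B m (idx m x) \<or> N \<le> m))"

definition stop_cells :: "(nat \<Rightarrow> int^'n \<Rightarrow> bool) \<Rightarrow> nat \<Rightarrow> nat \<Rightarrow> (real^'n) set \<Rightarrow> (nat \<times> (int^'n)) set" where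
  "stop_cells B m0 N X = (\<lambda>x. (first_stop B m0 N x, idx (first_stop B m0 N x) x)) ` X"

lemma first_props:
  assumes "m0 \<le> N"
  shows "m0 \<le> first_stop B m0 N x" "first_stop B m0 N x \<le> N"
    "B (first_stop B m0 N x) (idx (first_stop B m0 N x) x) \<or> first_stop B m0 N x = N"
    "\<And>m. m0 \<le> m \<Longrightarrow> m < first_stop B m0 N x \<Longrightarrow> \<not> B m (idx m x)"
    "\<And>m. m0 \<le> m \<Longrightarrow> B m (idx m x) \<Longrightarrow> first_stop B m0 N x \<le> m"
proof -
  let ?P = "\<lambda>m. m0 \<le> m \<and> (B m (idx m x) \<or> N \<le> m)"
  have PN: "?P N" using assms by simp
  have "?P (first_stop B m0 N x)" unfolding first_stop_def by (rule LeastI[of ?P, OF PN])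
  moreover show le: "first_stop B m0 N x \<le> N" unfolding first_stop_def by (rule Least_le[of ?P, OF PN])
  ultimately show "m0 \<le> first_stop B m0 N x" "B (first_stop B m0 N x) (idx (first_stop B m0 N x) x) \<or> first_stop B m0 N x = N" by auto
  show "\<not> B m (idx m x)" if "m0 \<le> m" "m < first_stop B m0 N x" for m
    using not_less_Least[of m ?P] that unfolding first_stop_def by blast
  show "first_stop B m0 N x \<le> m" if "m0 \<le> m" "B m (idx m x)" for m
    unfolding first_stop_def using that by (intro Least_le) auto
qed

text \<open>Whether a point has stopped by generation \<open>m\<close> depends only on its cells up
  to that generation, which it shares with every other point of its stopping cell. Hence a stopping
  cell can be recovered from any of its points.\<close>

lemma first_cong:
  assumes "m0 \<le> N" "idx (first_stop B m0 N x) y = idx (first_stop B m0 N x) x"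
  shows "first_stop B m0 N y = first_stop B m0 N x"
proof -
  let ?f = "first_stop B m0 N"
  have same: "idx m y = idx m x" if "m \<le> ?f x" for m using idx_coarser[OF that assms(2)] .
  have "?f y \<le> ?f x"
    using first_props(3)[OF assms(1), of B x] first_props(5)[OF assms(1), of "?f x" B y] 
      first_props(1,2)[OF assms(1), of B x] first_props(2)[OF assms(1), of B y] assms(2) by auto
  moreover have "?f x \<le> ?f y"
    using first_props(3)[OF assms(1), of B y] first_props(5)[OF assms(1), of "?f y" B x]
      first_props(1)[OF assms(1), of B y] first_props(2)[OF assms(1), of B x] same[of "?f y"] calculation by auto
  ultimately show ?thesis by simp
qed

lemma stops_unique:
  assumes "m0 \<le> N" "p \<in> stop_cells B m0 N X" "z \<in> cell_of p"
  shows "p = (first_stop B m0 N z, idx (first_stop B m0 N z) z)"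
proof -
  obtain x where x: "p = (first_stop B m0 N x, idx (first_stop B m0 N x) x)" using assms(2) by (auto simp: stop_cells_def)
  then have "idx (first_stop B m0 N x) z = idx (first_stop B m0 N x) x" using assms(3) by (simp add: cell_def)
  with first_cong[OF assms(1) this] x show ?thesis by simp
qed

lemma disjoint_stops: "m0 \<le> N \<Longrightarrow> disjoint_family_on (\<lambda>p. cell_of p) (stop_cells B m0 N X)"
  unfolding disjoint_family_on_def using stops_unique by blast

lemma stops_level: "m0 \<le> N \<Longrightarrow> p \<in> stop_cells B m0 N X \<Longrightarrow> m0 \<le> fst p \<and> fst p \<le> N"
  by (auto simp: stop_cells_def first_props)

lemma stops_cover: "x \<in> X \<Longrightarrow> \<exists>p\<in>stop_cells B m0 N X. x \<in> cell_of p"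
  unfolding stop_cells_def by (intro bexI[of _ "(first_stop B m0 N x, idx (first_stop B m0 N x) x)"]) auto

lemma finite_stops:
  assumes "m0 \<le> N" "X \<subseteq> tri m0 n0"
  shows "finite (stop_cells B m0 N X)"
proof (rule finite_subset)
  show "stop_cells B m0 N X \<subseteq> (\<Union>m\<in>{m0..N}. {m} \<times> idx m ` tri m0 n0)"
  proof
    fix p assume "p \<in> stop_cells B m0 N X"
    then obtain x where x: "x \<in> X" "p = (first_stop B m0 N x, idx (first_stop B m0 N x) x)" by (auto simp: stop_cells_def)
    then have "p \<in> {first_stop B m0 N x} \<times> idx (first_stop B m0 N x) ` tri m0 n0" using assms(2) by auto
    moreover have "first_stop B m0 N x \<in> {m0..N}" using first_props(1,2)[OF assms(1)] by simp
    ultimately show "p \<in> (\<Union>m\<in>{m0..N}. {m} \<times> idx m ` tri m0 n0)" by (rule UN_I[rotated])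
  qed
  show "finite (\<Union>m\<in>{m0..N}. {m} \<times> idx m ` tri m0 n0)" using finite_idx_tri by blast
qed

lemma stops_not_before:
  assumes "m0 \<le> N" "p \<in> stop_cells B m0 N X" "z \<in> cell_of p" "m0 \<le> m" "m < fst p"
  shows "\<not> B m (idx m z)"
  using first_props(4)[OF assms(1,4)] assms(5) stops_unique[OF assms(1-3)] by auto

lemma stops_cases:
  assumes "m0 \<le> N" "p \<in> stop_cells B m0 N X"
  shows "B (fst p) (snd p) \<or> fst p = N"
proof -
  obtain x where x: "p = (first_stop B m0 N x, idx (first_stop B m0 N x) x)" using assms(2) by (auto simp: stop_cells_def)
  show ?thesis unfolding x using first_props(3)[OF assms(1), of B x] by simp
qed

lemma stops_subset_tri:
  assumes "m0 \<le> N" "p \<in> stop_cells B m0 N X" "X \<subseteq> tri m0 n0"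
  shows "cell_of p \<subseteq> tri m0 n0"
proof
  fix z assume z: "z \<in> cell_of p"
  obtain x where x: "x \<in> X" "p = (first_stop B m0 N x, idx (first_stop B m0 N x) x)" using assms(2) by (auto simp: stop_cells_def)
  have "idx m0 z = idx m0 x"
    using idx_coarser[OF first_props(1)[OF assms(1)], of B x z x] z x by (simp add: cell_def)
  then show "z \<in> tri m0 n0" using x assms(3) by (auto simp: tri_def)
qed

lemma stops_subset_cell:
  assumes "m0 \<le> N" "p \<in> stop_cells B m0 N (cell m0 n0)"
  shows "cell_of p \<subseteq> cell m0 n0"
proof
  fix z assume z: "z \<in> cell_of p"
  obtain x where x: "x \<in> cell m0 n0" "p = (first_stop B m0 N x, idx (first_stop B m0 N x) x)" using assms(2) by (auto simp: stop_cells_def)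
  have "idx m0 z = idx m0 x"
    using idx_coarser[OF first_props(1)[OF assms(1)], of B x z x] z x by (simp add: cell_def)
  then show "z \<in> cell m0 n0" using x by (auto simp: cell_def)
qed

end

text \<open>\<open>2 ^ d\<close> passes from the measure of a child to that of its parent; the
  denominator sums the series of \<open>geometric_sides\<close>.\<close>

definition tail_const :: "nat \<Rightarrow> real \<Rightarrow> real" where
  "tail_const d \<alpha> = 2 ^ d / (1 - 2 powr - \<alpha>)"

definition avg_const :: "nat \<Rightarrow> real \<Rightarrow> real" where
  "avg_const d \<alpha> = 1 + tail_const d \<alpha> * 2 powr \<alpha>"

lemma tail_const_pos: "0 < \<alpha> \<Longrightarrow> 0 < tail_const d \<alpha>"
  using two_powr_minus_less_1[of \<alpha>] by (simp add: tail_const_def)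

lemma avg_const_pos: "0 < \<alpha> \<Longrightarrow> 0 < avg_const d \<alpha>"
  using tail_const_pos[of \<alpha> d] by (simp add: avg_const_def add_pos_nonneg)

text \<open>Chosen so that \<open>3 ^ d / cz_const d \<delta>\<close> is at most
  \<open>\<delta> / 2\<close>: the dilates of the bad cells then use up half of the exceptional
  measure. The summand 1 makes the constant at least 1.\<close>

definition cz_const :: "nat \<Rightarrow> real \<Rightarrow> real" where
  "cz_const d \<delta> = 2 * 3 ^ d / \<delta> + 1"

definition ctrl_const :: "nat \<Rightarrow> real \<Rightarrow> real" where
  "ctrl_const d \<delta> = 3 ^ d * cz_const d \<delta>"

text \<open>A sup bound, in units of \<open>\<nu>\<close>, for the difference of
  \<open>theta\<close> on \<open>F\<close> and on its good part: the first summand bounds the former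
  through Poisson averages, the second the latter through its sup norm.\<close>

definition dev_const :: "nat \<Rightarrow> real \<Rightarrow> real \<Rightarrow> real \<Rightarrow> real" where
  "dev_const d \<alpha> C \<delta> = C * avg_const d \<alpha> * ctrl_const d \<delta> + C * pk_const d \<alpha> * (2 ^ d * cz_const d \<delta>)"

text \<open>The factor 4 is 2 from the square of a sum times 2 from the \<open>L\<^sup>1\<close>
  norm of a piece in \<open>cz_bad_props\<close>.\<close>

definition exc_energy_const :: "nat \<Rightarrow> real \<Rightarrow> real \<Rightarrow> real \<Rightarrow> real \<Rightarrow> real" where
  "exc_energy_const d \<alpha> C CT \<delta> = 2 * good_const d \<alpha> C CT * (2 ^ d * cz_const d \<delta>)\<^sup>2 + 4 * dev_const d \<alpha> C \<delta> * bad_const d \<alpha> C"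

text \<open>Set by Markov's inequality: since \<open>exc_energy_const\<close> bounds the total
  energy, the set where the energy exceeds this multiple of \<open>\<nu>\<^sup>2\<close> has at most
  the share \<open>\<delta> / 2\<close>.\<close>

definition exc_const :: "nat \<Rightarrow> real \<Rightarrow> real \<Rightarrow> real \<Rightarrow> real \<Rightarrow> real" where
  "exc_const d \<alpha> C CT \<delta> = 2 * exc_energy_const d \<alpha> C CT \<delta> / \<delta>"

section \<open>Poisson averages controlled by masses over dilates\<close>

context grid
begin

lemma geometric_sides:
  assumes "0 < \<alpha>" "0 < t" "m0 \<le> M"
  shows "(\<Sum>m\<in>{m0..<M}. (t / side (Suc m)) powr \<alpha>) \<le> (t / side M) powr \<alpha> / (1 - 2 powr - \<alpha>)"
  using assms(3)
proof (induction M rule: dec_induct)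
  case base
  show ?case using two_powr_minus_less_1[OF assms(1)] by simp
next
  case (step M)
  let ?q = "2 powr - \<alpha>"
  have q: "?q < 1" by (rule two_powr_minus_less_1[OF assms(1)])
  have "t / side M = (t / side (Suc M)) * (1 / 2)" by (simp add: side_Suc[of M])
  then have e: "(t / side M) powr \<alpha> = (t / side (Suc M)) powr \<alpha> * ?q"
    using assms by (simp only: powr_mult powr_divide powr_one_eq_one powr_minus_divide)
  have "(\<Sum>m\<in>{m0..<Suc M}. (t / side (Suc m)) powr \<alpha>) \<le> (t / side M) powr \<alpha> / (1 - ?q) + (t / side (Suc M)) powr \<alpha>"
    using step by simp
  also have "\<dots> = (t / side (Suc M)) powr \<alpha> / (1 - ?q)"
  proof -
    have "X * q / (1 - q) + X = X / (1 - q)" if "q < 1" for X q :: real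
      using that by (simp add: field_simps)
    from this[OF q] show ?thesis unfolding e .
  qed
  finally show ?case .
qed

text \<open>A point \<open>y\<close> of the support outside the dilate of generation
  \<open>M\<close> leaves the chain of dilates around \<open>x\<close> at some first generation
  \<open>Suc m\<close>. There \<open>linf (x - y)\<close> is at least \<open>side (Suc m)\<close>,
  while the mass of dilate \<open>m\<close> is still under control. The sum over \<open>m\<close> is
  geometric and dominated by its finest term.\<close>

lemma tail_estimate:
  assumes \<alpha>: "0 < \<alpha>" and F: "integrable lborel F" and supp: "\<And>y. y \<notin> tri m0 (idx m0 x) \<Longrightarrow> F y = 0"
    and M: "m0 \<le> M" and ctrl: "\<And>m. m0 \<le> m \<Longrightarrow> m \<le> M \<Longrightarrow> mass F (tri m (idx m x)) \<le> w * side m ^ CARD('n)"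
    and t: "0 < t"
  shows "(\<integral>\<^sup>+ y\<in>- tri M (idx M x). ennreal (pk \<alpha> t x y * \<bar>F y\<bar>) \<partial>lborel) \<le> ennreal (tail_const CARD('n) \<alpha> * w * (t / side M) powr \<alpha>)"
proof -
  note [measurable] = borel_measurable_integrable[OF F]
  define c where "c m = t powr \<alpha> * side (Suc m) powr (- (\<alpha> + real CARD('n)))" for m
  have c0: "0 \<le> c m" for m by (simp add: c_def)
  have w0: "0 \<le> w"
    using ctrl[OF order_refl M] by (rule weight_nonneg)
  have pt: "ennreal (pk \<alpha> t x y * \<bar>F y\<bar>) * indicator (- tri M (idx M x)) y \<le>
     (\<Sum>m\<in>{m0..<M}. ennreal (c m) * (ennreal \<bar>F y\<bar> * indicator (tri m (idx m x)) y))" for y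
  proof (cases "y \<notin> tri M (idx M x) \<and> F y \<noteq> 0")
    case True
    define m' where "m' = (LEAST m. y \<notin> tri m (idx m x))"
    have m': "y \<notin> tri m' (idx m' x)" unfolding m'_def using True by (intro LeastI[where P = "\<lambda>m. y \<notin> tri m (idx m x)" and k = M]) simp
    have "m' \<le> M" unfolding m'_def using True by (intro Least_le[where P = "\<lambda>m. y \<notin> tri m (idx m x)"]) simp
    have "m0 < m'" proof (rule ccontr)
      assume "\<not> m0 < m'"
      then show False using tri_coarser[of m' m0 y x] m' supp[of y] True by auto
    qed
    then obtain m where m: "m' = Suc m" "m0 \<le> m" by (cases m') auto
    have y: "y \<in> tri m (idx m x)" using not_less_Least[of m "\<lambda>m. y \<notin> tri m (idx m x)"] m m'_def by simp
    have "pk \<alpha> t x y \<le> c m" unfolding c_def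
      using tri_dist[OF m'] m t \<alpha> by (intro pk_far_le) auto
    then have "ennreal (pk \<alpha> t x y * \<bar>F y\<bar>) \<le> ennreal (c m) * (ennreal \<bar>F y\<bar> * indicator (tri m (idx m x)) y)"
      using y c0 by (simp add: ennreal_leI mult_right_mono flip: ennreal_mult)
    also have "\<dots> \<le> (\<Sum>m\<in>{m0..<M}. ennreal (c m) * (ennreal \<bar>F y\<bar> * indicator (tri m (idx m x)) y))"
      using m \<open>m' \<le> M\<close> by (intro member_le_sum) auto
    finally show ?thesis using True by simp
  qed auto
  have "(\<integral>\<^sup>+ y\<in>- tri M (idx M x). ennreal (pk \<alpha> t x y * \<bar>F y\<bar>) \<partial>lborel) \<le>
    (\<integral>\<^sup>+ y. (\<Sum>m\<in>{m0..<M}. ennreal (c m) * (ennreal \<bar>F y\<bar> * indicator (tri m (idx m x)) y)) \<partial>lborel)"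
    by (intro nn_integral_mono pt)
  also have "\<dots> = (\<Sum>m\<in>{m0..<M}. ennreal (c m) * ennreal (mass F (tri m (idx m x))))"
    by (simp add: nn_integral_sum nn_integral_cmult emeasure_mass[OF F])
  also have "\<dots> \<le> (\<Sum>m\<in>{m0..<M}. ennreal (w * 2 ^ CARD('n) * (t / side (Suc m)) powr \<alpha>))"
  proof (rule sum_mono)
    fix m assume m: "m \<in> {m0..<M}"
    have "ennreal (c m) * ennreal (mass F (tri m (idx m x))) \<le> ennreal (c m) * ennreal (w * side m ^ CARD('n))"
      using m by (intro mult_left_mono ennreal_leI ctrl) auto
    also have "\<dots> = ennreal (c m * (w * side m ^ CARD('n)))" using c0 w0 by (simp add: ennreal_mult less_imp_le)
    also have "c m * (w * side m ^ CARD('n)) = w * 2 ^ CARD('n) * (t / side (Suc m)) powr \<alpha>"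
    proof -
      have "side (Suc m) powr (- (\<alpha> + real CARD('n))) * side (Suc m) ^ CARD('n) = side (Suc m) powr - \<alpha>"
        by (simp add: powr_realpow[symmetric] powr_add[symmetric])
      then have "c m * side m ^ CARD('n) = 2 ^ CARD('n) * (t powr \<alpha> * side (Suc m) powr - \<alpha>)"
        unfolding c_def side_Suc[of m] power_mult_distrib by simp
      also have "t powr \<alpha> * side (Suc m) powr - \<alpha> = (t / side (Suc m)) powr \<alpha>"
        using t by (simp add: powr_divide powr_minus_divide less_imp_le)
      finally show ?thesis by (simp add: mult_ac)
    qed
    finally show "ennreal (c m) * ennreal (mass F (tri m (idx m x))) \<le> ennreal (w * 2 ^ CARD('n) * (t / side (Suc m)) powr \<alpha>)" .
  qed
  also have "\<dots> = ennreal (w * 2 ^ CARD('n) * (\<Sum>m\<in>{m0..<M}. (t / side (Suc m)) powr \<alpha>))"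
    using w0 by (subst sum_ennreal) (auto simp: sum_distrib_left)
  also have "\<dots> \<le> ennreal (w * 2 ^ CARD('n) * ((t / side M) powr \<alpha> / (1 - 2 powr - \<alpha>)))"
    using w0 by (intro ennreal_leI mult_left_mono geometric_sides \<alpha> t M) auto
  also have "w * 2 ^ CARD('n) * ((t / side M) powr \<alpha> / (1 - 2 powr - \<alpha>)) = tail_const CARD('n) \<alpha> * w * (t / side M) powr \<alpha>"
    by (simp add: tail_const_def)
  finally show ?thesis .
qed

text \<open>The scale \<open>t\<close> is matched with a generation \<open>m\<close> such that
  \<open>side m \<le> t \<le> 2 * side m\<close>. Inside the dilate of that generation the sup of
  the kernel suffices; outside, \<open>tail_estimate\<close> applies with \<open>m\<close> in place
  of \<open>M\<close>.\<close>

lemma average_estimate: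
  assumes \<alpha>: "0 < \<alpha>" and F: "integrable lborel F" and supp: "\<And>y. y \<notin> tri m0 (idx m0 x) \<Longrightarrow> F y = 0"
    and M: "m0 \<le> M" and ctrl: "\<And>m. m0 \<le> m \<Longrightarrow> m \<le> M \<Longrightarrow> mass F (tri m (idx m x)) \<le> w * side m ^ CARD('n)"
    and t: "side M \<le> t" "t \<le> side m0"
  shows "(\<integral>\<^sup>+ y. ennreal (pk \<alpha> t x y * \<bar>F y\<bar>) \<partial>lborel) \<le> ennreal (avg_const CARD('n) \<alpha> * w)"
proof -
  note [measurable] = borel_measurable_integrable[OF F]
  have t0: "0 < t" using t side_pos[of M] by linarith
  have w0: "0 \<le> w"
    using ctrl[OF order_refl M] by (rule weight_nonneg)
  define m where "m = (LEAST m. m0 \<le> m \<and> side m \<le> t)"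
  have P: "m0 \<le> m \<and> side m \<le> t" unfolding m_def by (rule LeastI[of _ M]) (use M t in simp)
  have mM: "m \<le> M" unfolding m_def by (rule Least_le) (use M t in simp)
  have t2: "t \<le> 2 * side m"
  proof (cases "m = m0")
    case True
    then show ?thesis using t(2) side_pos[of m0] unfolding True by linarith
  next
    case False
    then obtain j where j: "m = Suc j" "m0 \<le> j" using P by (cases m) auto
    then have "\<not> side j \<le> t" using not_less_Least[of j "\<lambda>m. m0 \<le> m \<and> side m \<le> t"] m_def by auto
    then show ?thesis using side_Suc[of j] j by simp
  qed
  let ?T = "tri m (idx m x)"
  have "(\<integral>\<^sup>+ y. ennreal (pk \<alpha> t x y * \<bar>F y\<bar>) \<partial>lborel) \<le>
     (\<integral>\<^sup>+ y. ennreal (t powr - real CARD('n)) * (ennreal \<bar>F y\<bar> * indicator ?T y) + ennreal (pk \<alpha> t x y * \<bar>F y\<bar>) * indicator (- ?T) y \<partial>lborel)"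
  proof (rule nn_integral_mono)
    fix y
    show "ennreal (pk \<alpha> t x y * \<bar>F y\<bar>) \<le> ennreal (t powr - real CARD('n)) * (ennreal \<bar>F y\<bar> * indicator ?T y) + ennreal (pk \<alpha> t x y * \<bar>F y\<bar>) * indicator (- ?T) y"
      using pk_le[OF t0 \<alpha>, of x y] by (cases "y \<in> ?T") (auto simp: ennreal_leI mult_right_mono simp flip: ennreal_mult)
  qed
  also have "\<dots> = ennreal (t powr - real CARD('n)) * ennreal (mass F ?T) + (\<integral>\<^sup>+ y\<in>- ?T. ennreal (pk \<alpha> t x y * \<bar>F y\<bar>) \<partial>lborel)"
    by (simp add: nn_integral_add nn_integral_cmult emeasure_mass[OF F])
  also have "\<dots> \<le> ennreal (t powr - real CARD('n)) * ennreal (w * t ^ CARD('n)) + ennreal (tail_const CARD('n) \<alpha> * w * 2 powr \<alpha>)"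
  proof (intro add_mono mult_left_mono)
    have "mass F ?T \<le> w * side m ^ CARD('n)" using P mM by (intro ctrl) auto
    also have "\<dots> \<le> w * t ^ CARD('n)" using P w0 by (intro mult_left_mono power_mono) (auto simp: less_imp_le)
    finally show "ennreal (mass F ?T) \<le> ennreal (w * t ^ CARD('n))" by (rule ennreal_leI)
    have "(\<integral>\<^sup>+ y\<in>- ?T. ennreal (pk \<alpha> t x y * \<bar>F y\<bar>) \<partial>lborel) \<le> ennreal (tail_const CARD('n) \<alpha> * w * (t / side m) powr \<alpha>)"
      using P mM by (intro tail_estimate[where M = m and ?m0.0 = m0] \<alpha> F supp ctrl t0) auto
    also have "\<dots> \<le> ennreal (tail_const CARD('n) \<alpha> * w * 2 powr \<alpha>)"
      using w0 tail_const_pos[OF \<alpha>, of "CARD('n)"] t2 \<alpha> t0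
      by (intro ennreal_leI mult_left_mono powr_mono2) (auto simp: pos_divide_le_eq less_imp_le)
    finally show "(\<integral>\<^sup>+ y\<in>- ?T. ennreal (pk \<alpha> t x y * \<bar>F y\<bar>) \<partial>lborel) \<le> ennreal (tail_const CARD('n) \<alpha> * w * 2 powr \<alpha>)" .
  qed auto
  also have "ennreal (t powr - real CARD('n)) * ennreal (w * t ^ CARD('n)) = ennreal w"
    using t0 w0 by (simp add: powr_minus powr_realpow flip: ennreal_mult)
  also have "ennreal w + ennreal (tail_const CARD('n) \<alpha> * w * 2 powr \<alpha>) = ennreal (avg_const CARD('n) \<alpha> * w)"
    using w0 tail_const_pos[OF \<alpha>, of "CARD('n)"] by (subst ennreal_plus[symmetric]) (auto simp: avg_const_def algebra_simps less_imp_le)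
  finally show ?thesis .
qed

end

locale square_kernel_grid = square_kernel k \<alpha> C CT + grid a L
  for k :: "real \<Rightarrow> real^'n \<Rightarrow> real^'n \<Rightarrow> real" and \<alpha> C CT :: real and a :: "real^'n" and L :: real
begin

lemma theta_average:
  assumes F: "integrable lborel F" and supp: "\<And>y. y \<notin> tri m0 (idx m0 x) \<Longrightarrow> F y = 0"
    and M: "m0 \<le> M" and ctrl: "\<And>m. m0 \<le> m \<Longrightarrow> m \<le> M \<Longrightarrow> mass F (tri m (idx m x)) \<le> w * side m ^ CARD('n)"
    and t: "side M \<le> t" "t \<le> side m0"
  shows "\<bar>theta k t F x\<bar> \<le> C * avg_const CARD('n) \<alpha> * w"
proof -
  note [measurable] = borel_measurable_integrable[OF F]
  have t0: "0 < t" using t side_pos[of M] by linarith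
  have w0: "0 \<le> w"
    using ctrl[OF order_refl M] by (rule weight_nonneg)
  have "ennreal \<bar>theta k t F x\<bar> \<le> (\<integral>\<^sup>+ y. ennreal C * ennreal (pk \<alpha> t x y * \<bar>F y\<bar>) \<partial>lborel)"
    using theta_le_nn_integral[OF t0, of F x] C by (simp add: ennreal_mult)
  also have "\<dots> \<le> ennreal C * ennreal (avg_const CARD('n) \<alpha> * w)"
    by (subst nn_integral_cmult) (auto intro!: mult_left_mono average_estimate[OF \<alpha>(1) F supp M ctrl t])
  also have "\<dots> = ennreal (C * avg_const CARD('n) \<alpha> * w)"
    using C w0 avg_const_pos[OF \<alpha>(1), of "CARD('n)"] by (simp add: mult.assoc flip: ennreal_mult)
  finally show ?thesis using C w0 avg_const_pos[OF \<alpha>(1), of "CARD('n)"] by simp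
qed

lemma theta_tail:
  assumes F: "integrable lborel F" and supp: "\<And>y. y \<notin> tri m0 (idx m0 x) \<Longrightarrow> F y = 0"
    and M: "m0 \<le> M" and ctrl: "\<And>m. m0 \<le> m \<Longrightarrow> m \<le> M \<Longrightarrow> mass F (tri m (idx m x)) \<le> w * side m ^ CARD('n)"
    and t: "0 < t"
  shows "\<bar>theta k t (\<lambda>y. F y * indicator (- tri M (idx M x)) y) x\<bar> \<le> C * tail_const CARD('n) \<alpha> * w * (t / side M) powr \<alpha>"
proof -
  note [measurable] = borel_measurable_integrable[OF F]
  have w0: "0 \<le> w"
    using ctrl[OF order_refl M] by (rule weight_nonneg)
  have "ennreal \<bar>theta k t (\<lambda>y. F y * indicator (- tri M (idx M x)) y) x\<bar> \<le> 
     (\<integral>\<^sup>+ y. ennreal (C * (pk \<alpha> t x y * \<bar>F y * indicator (- tri M (idx M x)) y\<bar>)) \<partial>lborel)"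
    by (rule theta_le_nn_integral[OF t])
  also have "\<dots> = (\<integral>\<^sup>+ y. ennreal C * (ennreal (pk \<alpha> t x y * \<bar>F y\<bar>) * indicator (- tri M (idx M x)) y) \<partial>lborel)"
    using C by (intro nn_integral_cong) (auto simp: indicator_def simp flip: ennreal_mult)
  also have "\<dots> \<le> ennreal C * ennreal (tail_const CARD('n) \<alpha> * w * (t / side M) powr \<alpha>)"
    by (subst nn_integral_cmult) (auto intro!: mult_left_mono tail_estimate[OF \<alpha>(1) F supp M ctrl t])
  also have "\<dots> = ennreal (C * tail_const CARD('n) \<alpha> * w * (t / side M) powr \<alpha>)"
    using C w0 tail_const_pos[OF \<alpha>(1), of "CARD('n)"] by (simp add: mult.assoc flip: ennreal_mult)
  finally show ?thesis using C w0 tail_const_pos[OF \<alpha>(1), of "CARD('n)"] by simp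
qed

text \<open>Points of one cell of generation \<open>M\<close> are closer than
  \<open>side M \<le> t\<close>, so the regularity of \<open>k\<close> in its first variable costs
  \<open>(side M / t) powr \<alpha>\<close> against the same Poisson average. A bound at one good
  point thus serves the whole cell at all scales above its side.\<close>

lemma theta_oscillation:
  assumes F: "integrable lborel F" and supp: "\<And>y. y \<notin> tri m0 (idx m0 x) \<Longrightarrow> F y = 0"
    and M: "m0 \<le> M" and ctrl: "\<And>m. m0 \<le> m \<Longrightarrow> m \<le> M \<Longrightarrow> mass F (tri m (idx m x)) \<le> w * side m ^ CARD('n)"
    and t: "side M \<le> t" "t \<le> side m0" and x': "idx M x' = idx M x"
  shows "\<bar>theta k t F x - theta k t F x'\<bar> \<le> C * avg_const CARD('n) \<alpha> * w * (side M / t) powr \<alpha>"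
proof -
  note [measurable] = borel_measurable_integrable[OF F]
  have t0: "0 < t" using t side_pos[of M] by linarith
  have w0: "0 \<le> w"
    using ctrl[OF order_refl M] by (rule weight_nonneg)
  have xx': "linf (x - x') < side M" using cell_dist[of x M "idx M x" x'] x' by (simp add: cell_def)
  let ?c = "C * (side M / t) powr \<alpha>"
  have kk: "\<bar>k t x y - k t x' y\<bar> \<le> ?c * pk \<alpha> t x y" for y
  proof -
    have "\<bar>k t x y - k t x' y\<bar> \<le> C * (linf (x - x') / t) powr \<alpha> * pk \<alpha> t x y"
      using k_smooth[OF t0, of x x' y y] xx' t by simp
    also have "\<dots> \<le> ?c * pk \<alpha> t x y"
      using xx' t0 \<alpha> C by (intro mult_right_mono mult_left_mono powr_mono2 divide_right_mono) auto
    finally show ?thesis .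
  qed
  have i: "integrable lborel (\<lambda>y. (k t x y - k t x' y) * F y)"
    unfolding left_diff_distrib using integrable_k_mult'[OF t0 F] by simp
  have "theta k t F x - theta k t F x' = (LINT y|lborel. (k t x y - k t x' y) * F y)"
    unfolding theta_def left_diff_distrib using integrable_k_mult'[OF t0 F] by simp
  then have "ennreal \<bar>theta k t F x - theta k t F x'\<bar> \<le> (\<integral>\<^sup>+ y. ennreal \<bar>(k t x y - k t x' y) * F y\<bar> \<partial>lborel)"
    using integral_norm_bound_ennreal[OF i] by simp
  also have "\<dots> \<le> (\<integral>\<^sup>+ y. ennreal ?c * ennreal (pk \<alpha> t x y * \<bar>F y\<bar>) \<partial>lborel)"
  proof (rule nn_integral_mono)
    fix y
    have "\<bar>(k t x y - k t x' y) * F y\<bar> \<le> ?c * (pk \<alpha> t x y * \<bar>F y\<bar>)"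
      using mult_right_mono[OF kk[of y], of "\<bar>F y\<bar>"] by (simp add: abs_mult mult.assoc)
    then show "ennreal \<bar>(k t x y - k t x' y) * F y\<bar> \<le> ennreal ?c * ennreal (pk \<alpha> t x y * \<bar>F y\<bar>)"
      using C by (simp add: ennreal_leI flip: ennreal_mult)
  qed
  also have "\<dots> \<le> ennreal ?c * ennreal (avg_const CARD('n) \<alpha> * w)"
    by (subst nn_integral_cmult) (auto intro!: mult_left_mono average_estimate[OF \<alpha>(1) F supp M ctrl t])
  also have "\<dots> = ennreal (C * avg_const CARD('n) \<alpha> * w * (side M / t) powr \<alpha>)"
    using C w0 avg_const_pos[OF \<alpha>(1), of "CARD('n)"] by (simp add: mult_ac flip: ennreal_mult)
  finally show ?thesis using C w0 avg_const_pos[OF \<alpha>(1), of "CARD('n)"] by simp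
qed

end

section \<open>The exceptional set\<close>

lemma mass_eq_0:
  assumes "integrable lborel F" "X \<in> sets borel" "\<And>y. y \<in> X \<Longrightarrow> F y = 0"
  shows "mass F X = 0"
proof -
  have "(\<lambda>y. ennreal \<bar>F y\<bar> * indicator X y) = (\<lambda>_. 0)"
    by (auto simp: fun_eq_iff indicator_def assms(3))
  then show ?thesis using emeasure_mass[OF assms(1,2)] by simp
qed

lemma (in grid) side_neq_0 [simp]: "side m \<noteq> 0"
  using side_pos[of m] by linarith

lemma (in grid) side_nonneg [simp]: "0 \<le> side m"
  using side_pos[of m] by linarith

context square_kernel_grid
begin

lemma cz_const_ge_1: "0 < \<delta> \<Longrightarrow> 1 \<le> cz_const CARD('n) \<delta>"
  by (simp add: cz_const_def)

lemma ctrl_const_pos: "0 < \<delta> \<Longrightarrow> 0 < ctrl_const CARD('n) \<delta>"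
  using cz_const_ge_1[of \<delta>] by (simp add: ctrl_const_def)

lemma dev_const_pos: "0 < \<delta> \<Longrightarrow> 0 < dev_const CARD('n) \<alpha> C \<delta>"
  using C ctrl_const_pos[of \<delta>] cz_const_ge_1[of \<delta>] avg_const_pos[OF \<alpha>(1), of "CARD('n)"] pk_const_pos[OF \<alpha>(1), of "CARD('n)"]
  unfolding dev_const_def by (intro add_pos_pos mult_pos_pos) auto

lemma exc_energy_const_pos: "0 < \<delta> \<Longrightarrow> 0 < exc_energy_const CARD('n) \<alpha> C CT \<delta>"
  using good_const_pos bad_const_pos dev_const_pos[of \<delta>] cz_const_ge_1[of \<delta>]
  unfolding exc_energy_const_def by (intro add_pos_pos mult_pos_pos zero_less_power) auto

lemma exc_const_pos: "0 < \<delta> \<Longrightarrow> 0 < exc_const CARD('n) \<alpha> C CT \<delta>"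
  using exc_energy_const_pos[of \<delta>] by (simp add: exc_const_def)

section \<open>Calderon-Zygmund pieces and the exceptional set\<close>

definition cz_mean :: "(real^'n \<Rightarrow> real) \<Rightarrow> nat \<times> (int^'n) \<Rightarrow> real" where
  "cz_mean F p = (LINT z:cell_of p|lborel. F z) / side (fst p) ^ CARD('n)"

lemma abs_cz_mean_le:
  assumes "integrable lborel F"
  shows "\<bar>cz_mean F p\<bar> \<le> mass F (cell_of p) / side (fst p) ^ CARD('n)"
proof -
  have "\<bar>LINT z:cell_of p|lborel. F z\<bar> \<le> (LINT z:cell_of p|lborel. \<bar>F z\<bar>)"
    unfolding set_lebesgue_integral_def 
    by (rule order_trans[OF integral_abs_bound]) (simp add: abs_mult)
  then show ?thesis
    unfolding cz_mean_def mass_eq_integral[OF assms cell_borel] by (simp add: abs_divide divide_right_mono less_imp_le)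
qed

definition cz_bad :: "(real^'n \<Rightarrow> real) \<Rightarrow> nat \<times> (int^'n) \<Rightarrow> real^'n \<Rightarrow> real" where
  "cz_bad F p y = (F y - cz_mean F p) * indicator (cell_of p) y"

lemma cz_bad_props:
  assumes F: "integrable lborel F"
  shows "integrable lborel (cz_bad F p)" "(LINT y|lborel. cz_bad F p y) = 0"
    "(LINT y|lborel. \<bar>cz_bad F p y\<bar>) \<le> 2 * mass F (cell_of p)"
proof -
  let ?c = "cell_of p"
  have i1: "integrable lborel (indicator ?c :: _ \<Rightarrow> real)" by (simp add: emeasure_cell)
  have i2: "integrable lborel (\<lambda>y. indicator ?c y * F y)"
    using integrable_mult_indicator[of ?c lborel F] F by simp
  have i2': "integrable lborel (\<lambda>y. indicator ?c y * \<bar>F y\<bar>)"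
    using integrable_abs[OF i2] by (simp add: abs_mult)
  have eq: "cz_bad F p = (\<lambda>y. indicator ?c y * F y - cz_mean F p * indicator ?c y)"
    by (auto simp: cz_bad_def indicator_def)
  show i: "integrable lborel (cz_bad F p)" unfolding eq using i1 i2 by simp
  show "(LINT y|lborel. cz_bad F p y) = 0"
    unfolding eq using i1 i2 side_pos[of "fst p"]
    by (simp add: measure_cell cz_mean_def set_lebesgue_integral_def)
  have "(LINT y|lborel. \<bar>cz_bad F p y\<bar>) \<le> (LINT y|lborel. indicator ?c y * \<bar>F y\<bar> + \<bar>cz_mean F p\<bar> * indicator ?c y)"
  proof (rule integral_mono)
    show "integrable lborel (\<lambda>y. \<bar>cz_bad F p y\<bar>)" by (rule integrable_abs[OF i])
    show "integrable lborel (\<lambda>y. indicator ?c y * \<bar>F y\<bar> + \<bar>cz_mean F p\<bar> * indicator ?c y)"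
      using i1 i2' by simp
    show "\<bar>cz_bad F p y\<bar> \<le> indicator ?c y * \<bar>F y\<bar> + \<bar>cz_mean F p\<bar> * indicator ?c y" for y
      by (auto simp: cz_bad_def indicator_def)
  qed
  also have "\<dots> = mass F ?c + \<bar>cz_mean F p\<bar> * side (fst p) ^ CARD('n)"
    using i1 i2' by (simp add: measure_cell mass_eq_integral[OF F] set_lebesgue_integral_def)
  also have "\<dots> \<le> mass F ?c + mass F ?c"
    using abs_cz_mean_le[OF F, of p] side_pos[of "fst p"] by (simp add: pos_le_divide_eq)
  finally show "(LINT y|lborel. \<bar>cz_bad F p y\<bar>) \<le> 2 * mass F ?c" by simp
qed

text \<open>Off the exceptional set, \<open>\<bar>\<theta>\<^sub>t b\<bar>\<close> is at most a multiple of \<open>\<nu>\<close> for the bad part \<open>b\<close>, so its square is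
  at most \<open>C \<nu> \<bar>\<theta>\<^sub>t b\<bar>\<close> and \<open>L\<^sup>1\<close> bounds for the single bad pieces suffice.\<close>
lemma exceptional_set:
  fixes F :: "real^'n \<Rightarrow> real"
  assumes F: "integrable lborel F" and Fb: "\<And>y. \<bar>F y\<bar> \<le> bF" and supp: "\<And>y. y \<notin> tri m0 n0 \<Longrightarrow> F y = 0"
    and N: "m0 \<le> N" and \<delta>: "0 < \<delta>"
  defines "\<nu> \<equiv> mass F (tri m0 n0) / side m0 ^ CARD('n)"
  obtains E where "E \<in> sets borel" "E \<subseteq> cell m0 n0" "emeasure lborel E \<le> ennreal (\<delta> * side m0 ^ CARD('n))"
    "\<And>x m. x \<in> cell m0 n0 - E \<Longrightarrow> m0 \<le> m \<Longrightarrow> m \<le> N \<Longrightarrow> mass F (tri m (idx m x)) \<le> ctrl_const CARD('n) \<delta> * \<nu> * side m ^ CARD('n)"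
    "\<And>x. x \<in> cell m0 n0 - E \<Longrightarrow> 
      energy F {side N<..<side m0} x \<le> ennreal (exc_const CARD('n) \<alpha> C CT \<delta> * \<nu>\<^sup>2)"
proof -
  define D where "D = CARD('n)"
  have Fm [measurable]: "F \<in> borel_measurable borel" using F by auto
  have sp: "0 < side m ^ D" for m by simp
  have \<nu>0: "0 \<le> \<nu>" by (simp add: \<nu>_def less_imp_le)
  have mT: "mass F (tri m0 n0) = \<nu> * side m0 ^ D" using side_pos[of m0] by (simp add: \<nu>_def D_def)
  let ?Q = "cell m0 n0" and ?T = "tri m0 n0"
  show thesis
  \<comment> \<open>The measure bounds below divide by \<open>\<nu>\<close>. If it vanishes,
    \<open>F\<close> is zero almost everywhere and the empty set is exceptional.\<close>
  proof (cases "\<nu> = 0")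
    case True
    then have "(\<integral>\<^sup>+ y. ennreal \<bar>F y\<bar> * indicator ?T y \<partial>lborel) = 0"
      using emeasure_mass[OF F tri_borel, of m0 n0] mT by simp
    then have "AE y in lborel. ennreal \<bar>F y\<bar> * indicator ?T y = 0"
      by (subst (asm) nn_integral_0_iff_AE) auto
    then have AE0: "AE y in lborel. F y = 0"
      by eventually_elim (use supp in \<open>auto simp: indicator_def split: if_splits\<close>)
    have "theta k t F x = 0" for t x
      unfolding theta_def using AE0 by (intro integral_eq_zero_AE) (auto elim: eventually_mono)
    moreover have "mass F X = 0" if "X \<in> sets borel" for X
    proof -
      have "(\<integral>\<^sup>+ y. ennreal \<bar>F y\<bar> * indicator X y \<partial>lborel) = 0"
        using that AE0 by (subst nn_integral_0_iff_AE) (auto elim: eventually_mono)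
      then show ?thesis using emeasure_mass[OF F that] by simp
    qed
    ultimately show ?thesis using \<delta> \<nu>0 ctrl_const_pos[OF \<delta>] by (intro that[of "{}"]) (auto simp: less_imp_le)
  next
    case False
    then have \<nu>: "0 < \<nu>" using \<nu>0 by simp
    define A where "A = cz_const D \<delta>"
    have A: "1 \<le> A" unfolding A_def D_def by (rule cz_const_ge_1[OF \<delta>])
    \<comment> \<open>The height is \<open>A * \<nu>\<close>. Stopping runs over the whole dilate
      \<open>?T\<close>, where \<open>F\<close> lives; cells that reach generation \<open>N\<close>
      without being bad are kept as well, so that \<open>St\<close> covers
      \<open>?T\<close>.\<close>
    define B where "B m n \<longleftrightarrow> A * \<nu> * side m ^ D < mass F (cell m n)" for m n
    define St where "St = stop_cells B m0 N ?T"
    have finSt: "finite St" unfolding St_def by (rule finite_stops[OF N order_refl])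
    have disj: "disjoint_family_on (\<lambda>p. cell_of p) St" unfolding St_def by (rule disjoint_stops[OF N])
    have St_sub: "cell_of p \<subseteq> ?T" if "p \<in> St" for p
      using stops_subset_tri[OF N that[unfolded St_def] order_refl] .
    define Bad where "Bad = {p \<in> St. B (fst p) (snd p)}"
    have Bad: "Bad \<subseteq> St" "finite Bad" using finSt by (auto simp: Bad_def)
    \<comment> \<open>Points outside these dilates are at least one side length away from every bad
      cell.\<close>
    define \<Omega> where "\<Omega> = (\<Union>p\<in>Bad. tri_of p)"
    have \<Omega>m [measurable]: "\<Omega> \<in> sets borel" unfolding \<Omega>_def using Bad by (intro sets.finite_UN) auto
    have sum_mass: "(\<Sum>p\<in>I. mass F (cell_of p)) \<le> \<nu> * side m0 ^ D" if "I \<subseteq> St" for I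
    proof -
      have "(\<Sum>p\<in>I. mass F (cell_of p)) = mass F (\<Union>p\<in>I. cell_of p)"
        using that finSt disj
        by (intro mass_UN_disjoint[symmetric] F) (auto intro: finite_subset disjoint_family_on_mono)
      also have "\<dots> \<le> mass F ?T" using St_sub that by (intro mass_mono F) auto
      finally show ?thesis using mT by simp
    qed
    have emeasure_\<Omega>: "emeasure lborel \<Omega> \<le> ennreal (\<delta> / 2 * side m0 ^ D)"
    proof -
      have "emeasure lborel \<Omega> \<le> (\<Sum>p\<in>Bad. emeasure lborel (tri_of p))"
        unfolding \<Omega>_def using Bad by (intro emeasure_subadditive_finite) auto
      also have "\<dots> \<le> (\<Sum>p\<in>Bad. ennreal (3 ^ D / (A * \<nu>) * mass F (cell_of p)))"
      proof (rule sum_mono)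
        fix p assume "p \<in> Bad"
        then have "A * \<nu> * side (fst p) ^ D \<le> mass F (cell_of p)" by (simp add: Bad_def B_def)
        then have "(3 * side (fst p)) ^ D \<le> 3 ^ D / (A * \<nu>) * mass F (cell_of p)"
          using A \<nu> by (simp add: power_mult_distrib field_simps)
        then show "emeasure lborel (tri_of p) \<le> ennreal (3 ^ D / (A * \<nu>) * mass F (cell_of p))"
          by (simp add: emeasure_tri D_def[symmetric] ennreal_leI)
      qed
      also have "\<dots> = ennreal (3 ^ D / (A * \<nu>) * (\<Sum>p\<in>Bad. mass F (cell_of p)))"
        using A \<nu> by (subst sum_ennreal) (auto simp: sum_distrib_left)
      also have "\<dots> \<le> ennreal (3 ^ D / (A * \<nu>) * (\<nu> * side m0 ^ D))"
        using A \<nu> Bad by (intro ennreal_leI mult_left_mono sum_mass) auto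
      also have "3 ^ D / (A * \<nu>) * (\<nu> * side m0 ^ D) = 3 ^ D / A * side m0 ^ D" using \<nu> by simp
      also have "3 ^ D / A * side m0 ^ D \<le> \<delta> / 2 * side m0 ^ D"
      proof (intro mult_right_mono)
        have "3 ^ D / (2 * 3 ^ D / \<delta>) = \<delta> / 2" by simp
        moreover have "3 ^ D / A \<le> 3 ^ D / (2 * 3 ^ D / \<delta>)" 
          unfolding A_def cz_const_def using \<delta> by (intro divide_left_mono mult_pos_pos) (auto intro: add_pos_pos)
        ultimately show "3 ^ D / A \<le> \<delta> / 2" by simp
      qed (simp add: less_imp_le)
      finally show ?thesis by (simp add: ennreal_leI)
    qed
    \<comment> \<open>If a neighbour of the cell of \<open>x\<close> were too heavy, the first
      stopping cell above it would be bad, and its dilate would contain \<open>x\<close> because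
      adjacency survives passing to ancestors; but \<open>x\<close> avoids
      \<open>\<Omega>\<close>.\<close>
    have ctrl: "mass F (tri m (idx m x)) \<le> ctrl_const D \<delta> * \<nu> * side m ^ D" if x: "x \<in> ?Q - \<Omega>" and m: "m0 \<le> m" "m \<le> N" for x m
    proof -
      let ?N = "{n' :: int^'n. \<forall>i. \<bar>n' $ i - idx m x $ i\<bar> \<le> 1}"
      have "mass F (cell m n') \<le> A * \<nu> * side m ^ D" if n': "n' \<in> ?N" for n'
      proof (rule ccontr)
        assume "\<not> ?thesis"
        then have Bn: "B m n'" by (simp add: B_def)
        \<comment> \<open>A heavy neighbour must meet \<open>?T\<close>, outside of which
          \<open>F\<close> vanishes; this gives a point to which the stopping rule applies.\<close>
        obtain y where y: "y \<in> cell m n'" "y \<in> ?T"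
        proof (cases "cell m n' \<inter> ?T = {}")
          case True
          then have "mass F (cell m n') = 0" using supp by (intro mass_eq_0[OF F]) auto
          moreover have "0 \<le> A * \<nu> * side m ^ D" using A \<nu> sp[of m] by (intro mult_nonneg_nonneg) auto
          ultimately show ?thesis using Bn unfolding B_def by linarith
        qed (use that in auto)
        let ?f = "first_stop B m0 N y"
        have iy: "idx m y = n'" using y by (simp add: cell_def)
        have fm: "?f \<le> m" using first_props(5)[OF N m(1), of B y] Bn iy by simp
        have "B ?f (idx ?f y)" using first_props(3)[OF N, of B y] fm m Bn iy by auto
        then have "(?f, idx ?f y) \<in> Bad" using y by (auto simp: Bad_def St_def stop_cells_def)
        moreover have "y \<in> tri m (idx m x)" using n' iy by (simp add: tri_def)
        then have "x \<in> tri ?f (idx ?f y)" using tri_coarser[OF fm] tri_sym by blast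
        ultimately have "x \<in> \<Omega>" unfolding \<Omega>_def by force
        then show False using x by simp
      qed
      then have "(\<Sum>n'\<in>?N. mass F (cell m n')) \<le> of_nat (card ?N) * (A * \<nu> * side m ^ D)"
        by (intro sum_bounded_above) auto
      moreover have "mass F (tri m (idx m x)) \<le> (\<Sum>n'\<in>?N. mass F (cell m n'))"
        unfolding tri_eq_UN_cells by (intro mass_UN_le F finite_neighbours) auto
      ultimately show ?thesis unfolding card_neighbours by (simp add: ctrl_const_def A_def D_def mult_ac)
    qed
    \<comment> \<open>The parent of a stopping cell was not bad, which costs \<open>2 ^ D\<close>. A
      stopping cell of generation \<open>m0\<close> has no parent in range, but its mass is at most
      that of \<open>?T\<close>, and \<open>A\<close> is at least 1.\<close>
    have mean_le: "\<bar>cz_mean F p\<bar> \<le> 2 ^ D * A * \<nu>" if p: "p \<in> St" for p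
    proof -
      obtain z where z: "z \<in> cell_of p" using cell_nonempty by blast
      have lev: "m0 \<le> fst p" "fst p \<le> N" using stops_level[OF N p[unfolded St_def]] by auto
      have "mass F (cell_of p) \<le> 2 ^ D * A * \<nu> * side (fst p) ^ D"
      proof (cases "fst p = m0")
        case True
        have "mass F (cell_of p) \<le> mass F ?T" using St_sub[OF p] by (intro mass_mono F) auto
        also have "\<dots> = 1 * (1 * \<nu> * side (fst p) ^ D)" using mT True by simp
        also have "\<dots> \<le> 2 ^ D * (A * \<nu> * side (fst p) ^ D)"
          using A \<nu> by (intro mult_mono) (auto simp: less_imp_le)
        finally show ?thesis by (simp add: mult_ac)
      next
        case False
        then obtain j where j: "fst p = Suc j" "m0 \<le> j" using lev by (cases "fst p") auto
        have "\<not> B j (idx j z)" using stops_not_before[OF N p[unfolded St_def] z] j by simp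
        then have "mass F (cell j (idx j z)) \<le> A * \<nu> * side j ^ D" by (simp add: B_def)
        moreover have "mass F (cell_of p) \<le> mass F (cell j (idx j z))"
        proof (intro mass_mono F cell_borel)
          have "idx (fst p) z = snd p" using z by (simp add: cell_def)
          then show "cell_of p \<subseteq> cell j (idx j z)" using cell_coarser[of j "fst p" z] j by simp
        qed
        ultimately show ?thesis using j side_Suc[of j] by (simp add: power_mult_distrib mult_ac)
      qed
      then have "mass F (cell_of p) / side (fst p) ^ D \<le> 2 ^ D * A * \<nu>"
        using sp[of "fst p"] by (subst pos_divide_le_eq) auto
      then show ?thesis using abs_cz_mean_le[OF F, of p] by (simp add: D_def)
    qed
    \<comment> \<open>The good part averages over all cells of \<open>St\<close>, including those of
      generation \<open>N\<close> that are not bad. The decomposition of \<open>F\<close> is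
      therefore exact and finite, and no limit of averages occurs.\<close>
    define h where "h y = (\<Sum>p\<in>St. cz_mean F p * indicator (cell_of p) y)" for y
    have h_eq: "h y = cz_mean F p" if "p \<in> St" "y \<in> cell_of p" for p y
    proof -
      have "h y = (\<Sum>q\<in>St. if q = p then cz_mean F p else 0)"
        unfolding h_def
      proof (rule sum.cong)
        fix q assume "q \<in> St"
        then show "cz_mean F q * indicator (cell_of q) y = (if q = p then cz_mean F p else 0)"
          using disj that by (auto simp: disjoint_family_on_def indicator_def)
      qed simp
      then show ?thesis using that finSt by simp
    qed
    have h_0: "h y = 0" if "y \<notin> ?T" for y
      unfolding h_def using St_sub that by (intro sum.neutral) (auto simp: indicator_def)
    have cover: "\<exists>p\<in>St. y \<in> cell_of p" if "y \<in> ?T" for y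
      unfolding St_def using that by (rule stops_cover)
    have h_le: "\<bar>h y\<bar> \<le> 2 ^ D * A * \<nu>" for y
    proof (cases "y \<in> ?T")
      case True
      then obtain p where "p \<in> St" "y \<in> cell_of p" using cover by blast
      then show ?thesis using h_eq mean_le by simp
    qed (use h_0 A \<nu> in \<open>simp add: less_imp_le\<close>)
    have hm [measurable]: "h \<in> borel_measurable borel" unfolding h_def by measurable
    have hi: "integrable lborel h"
      unfolding h_def by (intro Bochner_Integration.integrable_sum integrable_mult_right) (simp add: emeasure_cell)
    have F_eq: "F y = h y + (\<Sum>p\<in>St. cz_bad F p y)" for y
    proof (cases "y \<in> ?T")
      case True
      then obtain p where p: "p \<in> St" "y \<in> cell_of p" using cover by blast
      have "(\<Sum>q\<in>St. cz_bad F q y) = (\<Sum>q\<in>St. if q = p then F y - cz_mean F p else 0)"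
      proof (rule sum.cong)
        fix q assume "q \<in> St"
        then show "cz_bad F q y = (if q = p then F y - cz_mean F p else 0)"
          using disj p by (auto simp: disjoint_family_on_def indicator_def cz_bad_def)
      qed simp
      also have "\<dots> = F y - cz_mean F p" using p finSt by simp
      finally show ?thesis using h_eq[OF p] by simp
    next
      case False
      then have "(\<Sum>q\<in>St. cz_bad F q y) = 0"
        using St_sub by (intro sum.neutral) (auto simp: indicator_def cz_bad_def)
      then show ?thesis using h_0[OF False] supp[OF False] by simp
    qed
    have theta_F: "theta k t F x = theta k t h x + (\<Sum>p\<in>St. theta k t (cz_bad F p) x)" if "0 < t" for t x
    proof -
      have "F = (\<lambda>y. h y + (\<Sum>p\<in>St. cz_bad F p y))" using F_eq by auto
      then have "theta k t F x = theta k t (\<lambda>y. h y + (\<Sum>p\<in>St. cz_bad F p y)) x" by simp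
      also have "\<dots> = theta k t h x + theta k t (\<lambda>y. \<Sum>p\<in>St. cz_bad F p y) x"
        using cz_bad_props(1)[OF F] by (intro theta_add that hi Bochner_Integration.integrable_sum) auto
      also have "theta k t (\<lambda>y. \<Sum>p\<in>St. cz_bad F p y) x = (\<Sum>p\<in>St. theta k t (cz_bad F p) x)"
        using cz_bad_props(1)[OF F] by (intro theta_sum that) auto
      finally show ?thesis .
    qed
    let ?C3 = "dev_const D \<alpha> C \<delta>"
    have C30: "0 < ?C3" unfolding D_def by (rule dev_const_pos[OF \<delta>])
    have bad_le: "\<bar>theta k t F x - theta k t h x\<bar> \<le> ?C3 * \<nu>" 
      if x: "x \<in> ?Q - \<Omega>" and t: "side N < t" "t < side m0" for x t
    proof -
      have t0: "0 < t" using t side_pos[of N] by linarith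
      have ix: "idx m0 x = n0" using x by (simp add: cell_def)
      have "\<bar>theta k t F x\<bar> \<le> C * avg_const CARD('n) \<alpha> * (ctrl_const D \<delta> * \<nu>)"
        using t by (intro theta_average[OF F _ N, where w = "ctrl_const D \<delta> * \<nu>"]) 
          (auto simp: ix supp ctrl[OF x] D_def[symmetric])
      moreover have "\<bar>theta k t h x\<bar> \<le> C * pk_const CARD('n) \<alpha> * (2 ^ D * A * \<nu>)"
        using h_le by (intro theta_bounded t0) auto
      moreover have "?C3 * \<nu> = C * avg_const CARD('n) \<alpha> * (ctrl_const D \<delta> * \<nu>) + C * pk_const CARD('n) \<alpha> * (2 ^ D * A * \<nu>)"
        by (simp add: dev_const_def A_def D_def algebra_simps)
      ultimately show ?thesis by linarith
    qed
    let ?Z = "?Q - \<Omega>"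
    have bm [measurable]: "cz_bad F p \<in> borel_measurable borel" for p unfolding cz_bad_def by measurable
    \<comment> \<open>The good part is enlarged back to all of \<open>?Q\<close> and all scales
      below \<open>side m0\<close>, the form in which \<open>good_part_bound\<close> takes it; the
      bad pieces keep the truncation and the excision of \<open>\<Omega>\<close>.\<close>
    have sq_le: "ennreal ((theta k t F x)\<^sup>2 / t) * indicator {side N<..<side m0} t * indicator ?Z x \<le>
       2 * (ennreal ((theta k t h x)\<^sup>2 / t) * indicator {0<..<side m0} t * indicator ?Q x) +
       ennreal (2 * ?C3 * \<nu>) * (\<Sum>p\<in>St. ennreal (\<bar>theta k t (cz_bad F p) x\<bar> / t) * indicator {side N<..} t * indicator ?Z x)" for t x
    proof (cases "x \<in> ?Z \<and> side N < t \<and> t < side m0")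
      case True
      then have t0: "0 < t" using side_pos[of N] by linarith
      let ?b = "theta k t F x - theta k t h x"
      have "(theta k t F x)\<^sup>2 \<le> 2 * (theta k t h x)\<^sup>2 + 2 * ?b\<^sup>2"
        using two_mult_le_squares[of "theta k t h x" ?b] power2_sum[of "theta k t h x" ?b] by simp
      also have "?b\<^sup>2 = \<bar>?b\<bar> * \<bar>?b\<bar>" by (simp add: power2_eq_square)
      also have "\<bar>?b\<bar> * \<bar>?b\<bar> \<le> (?C3 * \<nu>) * (\<Sum>p\<in>St. \<bar>theta k t (cz_bad F p) x\<bar>)"
      proof (intro mult_mono)
        show "\<bar>?b\<bar> \<le> ?C3 * \<nu>" using True by (intro bad_le) auto
        have "\<bar>?b\<bar> = \<bar>\<Sum>p\<in>St. theta k t (cz_bad F p) x\<bar>" using theta_F[OF t0, of x] by simp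
        then show "\<bar>?b\<bar> \<le> (\<Sum>p\<in>St. \<bar>theta k t (cz_bad F p) x\<bar>)" by simp
      qed (use C30 \<nu> in auto)
      finally have "(theta k t F x)\<^sup>2 / t \<le> (2 * (theta k t h x)\<^sup>2 + 2 * ((?C3 * \<nu>) * (\<Sum>p\<in>St. \<bar>theta k t (cz_bad F p) x\<bar>))) / t"
        using t0 by (intro divide_right_mono) auto
      also have "\<dots> = 2 * ((theta k t h x)\<^sup>2 / t) + (2 * ?C3 * \<nu>) * (\<Sum>p\<in>St. \<bar>theta k t (cz_bad F p) x\<bar> / t)"
        by (simp add: add_divide_distrib sum_divide_distrib[symmetric] mult.assoc)
      finally have "ennreal ((theta k t F x)\<^sup>2 / t) \<le> ennreal (2 * ((theta k t h x)\<^sup>2 / t) + (2 * ?C3 * \<nu>) * (\<Sum>p\<in>St. \<bar>theta k t (cz_bad F p) x\<bar> / t))"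
        by (rule ennreal_leI)
      also have "\<dots> = ennreal (2 * ((theta k t h x)\<^sup>2 / t)) + ennreal (2 * ?C3 * \<nu>) * ennreal (\<Sum>p\<in>St. \<bar>theta k t (cz_bad F p) x\<bar> / t)"
        using t0 C30 \<nu> by (subst ennreal_plus) (auto intro!: mult_nonneg_nonneg sum_nonneg simp: ennreal_mult'' sum_nonneg)
      also have "ennreal (2 * ((theta k t h x)\<^sup>2 / t)) = 2 * ennreal ((theta k t h x)\<^sup>2 / t)"
        using t0 by (subst ennreal_mult) auto
      also have "ennreal (\<Sum>p\<in>St. \<bar>theta k t (cz_bad F p) x\<bar> / t) = (\<Sum>p\<in>St. ennreal (\<bar>theta k t (cz_bad F p) x\<bar> / t))"
        using t0 by (intro sum_ennreal[symmetric]) auto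
      finally show ?thesis using True t0 by simp
    qed (auto simp: indicator_def)
    let ?I = "\<lambda>x. energy F {side N<..<side m0} x"
    have Im [measurable]: "?I \<in> borel_measurable borel" by measurable
    have total: "(\<integral>\<^sup>+ x\<in>?Z. ?I x \<partial>lborel) \<le> ennreal (exc_energy_const D \<alpha> C CT \<delta> * \<nu>\<^sup>2 * side m0 ^ D)"
    proof -
      have "(\<integral>\<^sup>+ x\<in>?Z. ?I x \<partial>lborel) = (\<integral>\<^sup>+ x. \<integral>\<^sup>+ t. ennreal ((theta k t F x)\<^sup>2 / t) * indicator {side N<..<side m0} t * indicator ?Z x \<partial>lborel \<partial>lborel)"
        by (subst nn_integral_multc[symmetric]) auto
      also have "\<dots> \<le> (\<integral>\<^sup>+ x. \<integral>\<^sup>+ t. 2 * (ennreal ((theta k t h x)\<^sup>2 / t) * indicator {0<..<side m0} t * indicator ?Q x) +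
       ennreal (2 * ?C3 * \<nu>) * (\<Sum>p\<in>St. ennreal (\<bar>theta k t (cz_bad F p) x\<bar> / t) * indicator {side N<..} t * indicator ?Z x) \<partial>lborel \<partial>lborel)"
        by (intro nn_integral_mono sq_le)
      also have "\<dots> = 2 * (\<integral>\<^sup>+ x\<in>?Q. energy h {0<..<side m0} x \<partial>lborel) +
        ennreal (2 * ?C3 * \<nu>) * (\<Sum>p\<in>St. \<integral>\<^sup>+ x\<in>?Z. (\<integral>\<^sup>+ t\<in>{side N<..}. ennreal (\<bar>theta k t (cz_bad F p) x\<bar> / t) \<partial>lborel) \<partial>lborel)"
        by (simp add: nn_integral_add nn_integral_cmult nn_integral_multc nn_integral_sum)
      also have "\<dots> \<le> 2 * ennreal (good_const CARD('n) \<alpha> C CT * (2 ^ D * A * \<nu>)\<^sup>2 * side m0 ^ CARD('n)) +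
        ennreal (2 * ?C3 * \<nu>) * (\<Sum>p\<in>St. ennreal (bad_const CARD('n) \<alpha> C * (2 * mass F (cell_of p))))"
      proof (intro add_mono mult_left_mono sum_mono)
        show "(\<integral>\<^sup>+ x\<in>?Q. energy h {0<..<side m0} x \<partial>lborel) \<le> 
          ennreal (good_const CARD('n) \<alpha> C CT * (2 ^ D * A * \<nu>)\<^sup>2 * side m0 ^ CARD('n))"
          unfolding cell_eq_cube using h_0 h_le by (intro good_part_bound) (auto simp: tri_eq_cube)
        fix p assume p: "p \<in> St"
        obtain y0 where y0: "y0 \<in> cell_of p" using cell_nonempty by blast
        have bad_supp: "y \<in> cell_of p" if "cz_bad F p y \<noteq> 0" for y
          using that by (auto simp: cz_bad_def indicator_def split: if_splits)
        have "(\<integral>\<^sup>+ x\<in>?Z. (\<integral>\<^sup>+ t\<in>{side N<..}. ennreal (\<bar>theta k t (cz_bad F p) x\<bar> / t) \<partial>lborel) \<partial>lborel)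
          \<le> ennreal (bad_const CARD('n) \<alpha> C * (LINT y|lborel. \<bar>cz_bad F p y\<bar>))"
        proof (rule bad_part_bound[where p = "side (fst p)" and ?y0.0 = y0])
          show "linf (y - y0) < side (fst p)" if "cz_bad F p y \<noteq> 0" for y
            using cell_dist[OF bad_supp[OF that] y0] .
          \<comment> \<open>A bad cell is separated from \<open>?Z\<close> by its dilate; any other
            stopping cell has generation \<open>N\<close>, whose side is the truncation
            scale.\<close>
          show "side (fst p) \<le> side N \<or> (\<forall>x\<in>?Z. \<forall>y. cz_bad F p y \<noteq> 0 \<longrightarrow> side (fst p) \<le> linf (x - y))"
          proof (cases "B (fst p) (snd p)")
            case True
            then have pb: "p \<in> Bad" using p by (simp add: Bad_def)
            have "side (fst p) \<le> linf (x - y)" if "x \<in> ?Z" "cz_bad F p y \<noteq> 0" for x y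
            proof -
              have "idx (fst p) y = snd p" using bad_supp[OF that(2)] by (simp add: cell_def)
              moreover have "x \<notin> tri_of p" using that(1) pb by (auto simp: \<Omega>_def)
              ultimately show ?thesis using tri_dist[of x "fst p" y] by (simp add: linf_minus_commute)
            qed
            then show ?thesis by blast
          next
            case False
            then show ?thesis using stops_cases[OF N p[unfolded St_def]] by simp
          qed
        qed (use cz_bad_props[OF F] in \<open>auto simp: less_imp_le\<close>)
        also have "\<dots> \<le> ennreal (bad_const CARD('n) \<alpha> C * (2 * mass F (cell_of p)))"
          using bad_const_pos cz_bad_props(3)[OF F, of p] by (intro ennreal_leI mult_left_mono) auto
        finally show "(\<integral>\<^sup>+ x\<in>?Z. (\<integral>\<^sup>+ t\<in>{side N<..}. ennreal (\<bar>theta k t (cz_bad F p) x\<bar> / t) \<partial>lborel) \<partial>lborel)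
          \<le> ennreal (bad_const CARD('n) \<alpha> C * (2 * mass F (cell_of p)))" .
      qed auto
      also have "(\<Sum>p\<in>St. ennreal (bad_const CARD('n) \<alpha> C * (2 * mass F (cell_of p)))) =
         ennreal (bad_const CARD('n) \<alpha> C * (2 * (\<Sum>p\<in>St. mass F (cell_of p))))"
        using bad_const_pos by (subst sum_ennreal) (auto simp: sum_distrib_left)
      also have "\<dots> \<le> ennreal (bad_const CARD('n) \<alpha> C * (2 * (\<nu> * side m0 ^ D)))"
        using bad_const_pos by (intro ennreal_leI mult_left_mono sum_mass) auto
      also have "2 * ennreal (good_const CARD('n) \<alpha> C CT * (2 ^ D * A * \<nu>)\<^sup>2 * side m0 ^ CARD('n)) +
        ennreal (2 * ?C3 * \<nu>) * ennreal (bad_const CARD('n) \<alpha> C * (2 * (\<nu> * side m0 ^ D))) =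
        ennreal (2 * (good_const CARD('n) \<alpha> C CT * (2 ^ D * A * \<nu>)\<^sup>2 * side m0 ^ CARD('n)) + (2 * ?C3 * \<nu>) * (bad_const CARD('n) \<alpha> C * (2 * (\<nu> * side m0 ^ D))))"
        using ennreal_combination3[of "good_const CARD('n) \<alpha> C CT * (2 ^ D * A * \<nu>)\<^sup>2 * side m0 ^ CARD('n)" 
             "bad_const CARD('n) \<alpha> C * (2 * (\<nu> * side m0 ^ D))" 0 "2 * ?C3 * \<nu>" 0] good_const_pos bad_const_pos C30 \<nu> by (simp add: less_imp_le)
      also have "2 * (good_const CARD('n) \<alpha> C CT * (2 ^ D * A * \<nu>)\<^sup>2 * side m0 ^ CARD('n)) + (2 * ?C3 * \<nu>) * (bad_const CARD('n) \<alpha> C * (2 * (\<nu> * side m0 ^ D)))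
         = exc_energy_const D \<alpha> C CT \<delta> * \<nu>\<^sup>2 * side m0 ^ D"
        by (simp add: exc_energy_const_def A_def D_def power_mult_distrib power2_eq_square algebra_simps)
      finally show ?thesis by (simp add: add_mono mult_left_mono)
    qed
    let ?LL = "exc_const D \<alpha> C CT \<delta>"
    have C60: "0 < exc_energy_const D \<alpha> C CT \<delta>" unfolding D_def by (rule exc_energy_const_pos[OF \<delta>])
    have LL0: "0 < ?LL" unfolding D_def by (rule exc_const_pos[OF \<delta>])
    \<comment> \<open>Markov's inequality for the energy spends the second half of
      \<open>\<delta>\<close>.\<close>
    define E2 where "E2 = {x \<in> ?Z. ennreal (?LL * \<nu>\<^sup>2) < ?I x}"
    have E2m [measurable]: "E2 \<in> sets borel"
    proof -
      have "E2 = ?Z \<inter> {x \<in> space borel. ennreal (?LL * \<nu>\<^sup>2) < ?I x}" by (auto simp: E2_def)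
      also have "\<dots> \<in> sets borel" by (intro sets.Int) measurable
      finally show ?thesis .
    qed
    have "emeasure lborel E2 \<le> ennreal (\<delta> / 2 * side m0 ^ D)"
    proof -
      let ?c = "ennreal (1 / (?LL * \<nu>\<^sup>2))"
      have "1 \<le> ?c * ?I x" if "x \<in> E2" for x
      proof -
        have "1 = ?c * ennreal (?LL * \<nu>\<^sup>2)" using LL0 \<nu> by (simp flip: ennreal_mult)
        also have "\<dots> \<le> ?c * ?I x" using that by (intro mult_left_mono) (auto simp: E2_def)
        finally show ?thesis .
      qed
      then have "emeasure lborel E2 \<le> emeasure lborel {x \<in> ?Z. 1 \<le> ?c * ?I x}"
        by (intro emeasure_mono) (auto simp: E2_def)
      also have "\<dots> \<le> ?c * (\<integral>\<^sup>+ x\<in>?Z. ?I x \<partial>lborel)"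
        by (rule nn_integral_Markov_inequality) measurable
      also have "\<dots> \<le> ?c * ennreal (exc_energy_const D \<alpha> C CT \<delta> * \<nu>\<^sup>2 * side m0 ^ D)"
        by (intro mult_left_mono total) auto
      also have "\<dots> = ennreal (\<delta> / 2 * side m0 ^ D)"
        using LL0 C60 \<nu> \<delta> by (subst ennreal_mult[symmetric]) (auto simp: exc_const_def less_imp_le)
      finally show ?thesis .
    qed
    show ?thesis
    proof (rule that[of "(\<Omega> \<inter> ?Q) \<union> E2"])
      show "(\<Omega> \<inter> ?Q) \<union> E2 \<in> sets borel" by measurable
      show "(\<Omega> \<inter> ?Q) \<union> E2 \<subseteq> ?Q" by (auto simp: E2_def)
      have "emeasure lborel ((\<Omega> \<inter> ?Q) \<union> E2) \<le> emeasure lborel (\<Omega> \<inter> ?Q) + emeasure lborel E2"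
        by (rule emeasure_subadditive) auto
      also have "\<dots> \<le> emeasure lborel \<Omega> + emeasure lborel E2" by (intro add_right_mono emeasure_mono) auto
      also have "\<dots> \<le> ennreal (\<delta> / 2 * side m0 ^ D) + ennreal (\<delta> / 2 * side m0 ^ D)"
        by (intro add_mono emeasure_\<Omega>) fact
      also have "\<dots> = ennreal (\<delta> * side m0 ^ CARD('n))"
        using \<delta> by (subst ennreal_plus[symmetric]) (auto simp: D_def less_imp_le)
      finally show "emeasure lborel ((\<Omega> \<inter> ?Q) \<union> E2) \<le> ennreal (\<delta> * side m0 ^ CARD('n))" .
      fix x assume x: "x \<in> ?Q - ((\<Omega> \<inter> ?Q) \<union> E2)"
      show "mass F (tri m (idx m x)) \<le> ctrl_const CARD('n) \<delta> * \<nu> * side m ^ CARD('n)" if "m0 \<le> m" "m \<le> N" for m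
        using ctrl[of x m] x that by (auto simp: D_def)
      show "?I x \<le> ennreal (exc_const CARD('n) \<alpha> C CT \<delta> * \<nu>\<^sup>2)"
        using x by (auto simp: E2_def D_def not_less)
    qed
  qed
qed

end

section \<open>The sparse recursion\<close>

text \<open>The solution \<open>K\<close> of \<open>K * (1 - 2 powr - \<alpha>) = 1\<close>, as
  required by \<open>weight_rate_absorb\<close>.\<close>

definition weight_rate :: "real \<Rightarrow> real" where
  "weight_rate \<alpha> = 1 / (1 - 2 powr - \<alpha>)"

text \<open>A cell will stop when the exceptional set fills more than \<open>1 / 2 ^ (d + 1)\<close>
  of it. With half of that threshold as the total share, the stopped cells fill at most half of the
  starting cell.\<close>

definition exc_frac :: "nat \<Rightarrow> real" where
  "exc_frac d = 1 / 2 ^ (d + 2)"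

text \<open>The three terms belong to the tail at scales below the side of the stopping cell, to the
  energy at the good point, and to the oscillation between the two points at scales above;
  \<open>exp (weight_rate \<alpha>)\<close> bounds the weight.\<close>

definition step_const :: "nat \<Rightarrow> real \<Rightarrow> real \<Rightarrow> real \<Rightarrow> real" where
  "step_const d \<alpha> C CT = exp (weight_rate \<alpha>) * (2 * (C * tail_const d \<alpha> * ctrl_const d (exc_frac d))\<^sup>2 / \<alpha> + 2 * exc_const d \<alpha> C CT (exc_frac d)
      + 2 * (C * avg_const d \<alpha> * ctrl_const d (exc_frac d))\<^sup>2 / \<alpha>)"

lemma weight_rate_pos: "0 < \<alpha> \<Longrightarrow> 0 < weight_rate \<alpha>"
  using two_powr_minus_less_1[of \<alpha>] by (simp add: weight_rate_def)

text \<open>As \<open>1 + s \<le> exp s\<close>, the choice of \<open>weight_rate\<close> makes the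
  exponents add up. The factor \<open>2 powr - \<alpha>\<close> stands for passing to a subcube of
  at most half the side.\<close>

lemma weight_rate_absorb:
  assumes "0 < \<alpha>" "0 \<le> s"
  shows "exp (weight_rate \<alpha> * (s * 2 powr - \<alpha>)) * (1 + s) \<le> exp (weight_rate \<alpha> * s)"
proof -
  have q: "1 - 2 powr - \<alpha> \<noteq> 0" using two_powr_minus_less_1[OF assms(1)] by linarith
  have "weight_rate \<alpha> * (1 - 2 powr - \<alpha>) = 1" using q by (simp add: weight_rate_def)
  then have "weight_rate \<alpha> * (s * 2 powr - \<alpha>) + s = weight_rate \<alpha> * s" by algebra
  then have "exp (weight_rate \<alpha> * s) = exp (weight_rate \<alpha> * (s * 2 powr - \<alpha>)) * exp s" by (metis exp_add)
  then show ?thesis using exp_ge_add_one_self[of s] by simp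
qed

lemma sum_square_weighted:
  fixes a b s :: real
  assumes "0 < s"
  shows "(a + b)\<^sup>2 \<le> (1 + s) * a\<^sup>2 + (1 + 1 / s) * b\<^sup>2"
proof -
  have "2 * (a * b) \<le> s * a\<^sup>2 + b\<^sup>2 / s"
  proof -
    have "0 \<le> (s * a - b)\<^sup>2 / s" using assms by simp
    also have "\<dots> = s * a\<^sup>2 - 2 * (a * b) + b\<^sup>2 / s"
      using assms by (simp add: power2_eq_square field_simps)
    finally show ?thesis by simp
  qed
  then show ?thesis by (simp add: power2_sum algebra_simps)
qed

lemma scale_split:
  fixes e :: real
  assumes "X \<le> s * A + Y" "0 \<le> e"
  shows "e * X \<le> (e * s) * A + e * Y"
  using mult_left_mono[OF assms] by (simp only: distrib_left mult.assoc)

lemma ennreal_add_mult: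
  assumes "0 \<le> x" "0 \<le> c" "0 \<le> w"
  shows "ennreal (x + c * w) = ennreal x + ennreal c * ennreal w"
  using assms by (simp add: ennreal_plus ennreal_mult)

lemma ennreal_mult_add_mult:
  assumes "0 \<le> p" "0 \<le> x" "0 \<le> c" "0 \<le> w"
  shows "ennreal (p * x + c * w) = ennreal p * ennreal x + ennreal c * ennreal w"
  using assms by (simp add: ennreal_plus ennreal_mult)

lemma ennreal_sum3_mult:
  assumes "0 \<le> c" "0 \<le> i" "0 \<le> e" "0 \<le> l" "0 \<le> c'"
  shows "ennreal c * ennreal i + ennreal e * ennreal l + ennreal c' * ennreal i = ennreal (c * i + e * l + c' * i)"
  using assms by (simp add: ennreal_plus ennreal_mult)

lemma exc_frac_pos [simp]: "0 < exc_frac d"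
  by (simp add: exc_frac_def)

context square_kernel_grid
begin

definition restr_tri :: "(real^'n \<Rightarrow> real) \<Rightarrow> nat \<Rightarrow> int^'n \<Rightarrow> real^'n \<Rightarrow> real" where
  "restr_tri f m n y = f y * indicator (tri m n) y"

text \<open>The mass over the dilate is divided by the measure of the cell itself; the factor
  \<open>3 ^ d\<close> relative to \<open>avg\<close> is paid once, at the very end.\<close>

definition tri_mean :: "(real^'n \<Rightarrow> real) \<Rightarrow> nat \<Rightarrow> int^'n \<Rightarrow> real" where
  "tri_mean f m n = mass f (tri m n) / side m ^ CARD('n)"

text \<open>Passing from \<open>Q\<close> to a subcube \<open>P\<close>, the weight grows by a factor of at least \<open>1 + (t / \<ell>P)\<^sup>\<alpha>\<close>; this absorbs
  the loss in \<open>(a + b)\<^sup>2 \<le> (1 + s) a\<^sup>2 + (1 + 1 / s) b\<^sup>2\<close> for \<open>s = (t / \<ell>P)\<^sup>\<alpha>\<close>, which would otherwise accumulate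
  over the generations.\<close>
definition weighted_energy :: "(real^'n \<Rightarrow> real) \<Rightarrow> nat \<Rightarrow> nat \<Rightarrow> int^'n \<Rightarrow> real^'n \<Rightarrow> ennreal" where
  "weighted_energy f N m n x = (\<integral>\<^sup>+ t\<in>{side N<..<side m}. 
     ennreal (exp (weight_rate \<alpha> * (t / side m) powr \<alpha>) * (theta k t (restr_tri f m n) x)\<^sup>2 / t) \<partial>lborel)"

lemma tri_mean_nonneg [simp]: "0 \<le> tri_mean f m n"
  by (simp add: tri_mean_def)

lemma integrable_restr: "integrable lborel f \<Longrightarrow> integrable lborel (restr_tri f m n)"
  unfolding restr_tri_def using integrable_mult_indicator[of "tri m n" lborel f] by (simp add: mult.commute)

lemma mass_restr:
  assumes "integrable lborel f"
  shows "mass (restr_tri f m n) (tri m n) = mass f (tri m n)"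
  by (intro mass_cong integrable_restr assms) (auto simp: restr_tri_def)

text \<open>At scales below \<open>side M\<close>, the function outside the dilate of the subcell is
  a small tail and the rest is the energy of the next generation. At scales above, \<open>x\<close>
  is exchanged for the good point \<open>x'\<close> of the same cell, where the energy is bounded
  outright.\<close>

lemma local_step:
  assumes f: "integrable lborel f" and M: "m0 \<le> M" "M \<le> N" and x: "idx m0 x = n0" and xx': "idx M x' = idx M x"
    and ctrl: "\<And>m. m0 \<le> m \<Longrightarrow> m \<le> M \<Longrightarrow> mass (restr_tri f m0 n0) (tri m (idx m x')) \<le> ctrl_const CARD('n) \<delta> * tri_mean f m0 n0 * side m ^ CARD('n)"
    and I: "energy (restr_tri f m0 n0) {side N<..<side m0} x' \<le> ennreal (exc_const CARD('n) \<alpha> C CT \<delta> * (tri_mean f m0 n0)\<^sup>2)"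
    and \<delta>: "\<delta> = exc_frac CARD('n)"
  shows "weighted_energy f N m0 n0 x \<le> ennreal (step_const CARD('n) \<alpha> C CT * (tri_mean f m0 n0)\<^sup>2) + weighted_energy f N M (idx M x) x"
proof (cases "m0 = M")
  case True
  then show ?thesis using x by simp
next
  case False
  then have m0M: "Suc m0 \<le> M" using M by simp
  define D where "D = CARD('n)"
  define F where "F = restr_tri f m0 n0"
  define P where "P = idx M x"
  define \<nu> where "\<nu> = tri_mean f m0 n0"
  let ?a = "\<lambda>t. theta k t (restr_tri f M P) x"
  let ?D1 = "C * tail_const D \<alpha> * ctrl_const D \<delta>" and ?D2 = "C * avg_const D \<alpha> * ctrl_const D \<delta>" and ?K = "weight_rate \<alpha>"
  note int_F = integrable_restr[OF f, of m0 n0, folded F_def]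
  have Fm [measurable]: "F \<in> borel_measurable borel" "restr_tri f M P \<in> borel_measurable borel"
    using int_F integrable_restr[OF f, of M P] by auto
  have \<delta>0: "0 < \<delta>" by (simp add: \<delta>)
  have \<nu>0: "0 \<le> \<nu>" by (simp add: \<nu>_def)
  \<comment> \<open>The mass bounds are given at \<open>x'\<close>; they hold at \<open>x\<close>
    because the two points share all cells up to generation \<open>M\<close>.\<close>
  have idx_same: "idx m x' = idx m x" if "m \<le> M" for m using idx_coarser[OF that xx'] .
  have ctrl': "mass F (tri m (idx m x)) \<le> (ctrl_const D \<delta> * \<nu>) * side m ^ CARD('n)" if "m0 \<le> m" "m \<le> M" for m
    using ctrl[OF that] idx_same[OF that(2)] by (simp add: F_def D_def \<nu>_def)
  have supp: "F y = 0" if "y \<notin> tri m0 (idx m0 x)" for y using that x by (simp add: F_def restr_tri_def)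
  have F_split: "F = (\<lambda>y. restr_tri f M P y + F y * indicator (- tri M (idx M x)) y)"
  proof
    fix y
    show "F y = restr_tri f M P y + F y * indicator (- tri M (idx M x)) y"
      using tri_coarser[OF M(1), of y x] x by (auto simp: F_def restr_tri_def P_def indicator_def)
  qed
  have int_tail: "integrable lborel (\<lambda>y. F y * indicator (- tri M (idx M x)) y)"
    using integrable_mult_indicator[of "- tri M (idx M x)" lborel F] int_F by (simp add: mult.commute)
  have D1: "0 \<le> ?D1" "0 \<le> ?D2"
    using C tail_const_pos[OF \<alpha>(1), of D] avg_const_pos[OF \<alpha>(1), of D] ctrl_const_pos[OF \<delta>0] by (auto simp: D_def)
  have inner: "exp (?K * (t / side m0) powr \<alpha>) * (theta k t F x)\<^sup>2 \<le>
      exp (?K * (t / side M) powr \<alpha>) * (?a t)\<^sup>2 + exp ?K * (2 * ?D1\<^sup>2 * \<nu>\<^sup>2) * (t / side M) powr \<alpha>"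
    if t: "0 < t" "t < side M" for t
  proof -
    define s where "s = (t / side M) powr \<alpha>"
    have s: "0 < s" "s \<le> 1" unfolding s_def using t \<alpha> by (auto intro!: powr_le1)
    define b where "b = theta k t (\<lambda>y. F y * indicator (- tri M (idx M x)) y) x"
    have split: "theta k t F x = ?a t + b"
      unfolding b_def by (subst F_split, rule theta_add[OF t(1) integrable_restr[OF f] int_tail])
    have "\<bar>b\<bar> \<le> C * tail_const CARD('n) \<alpha> * (ctrl_const D \<delta> * \<nu>) * (t / side M) powr \<alpha>"
      unfolding b_def by (rule theta_tail[OF int_F supp M(1) ctrl' t(1)])
    then have b: "\<bar>b\<bar> \<le> ?D1 * \<nu> * s" by (simp add: s_def D_def mult_ac)
    have b2: "b\<^sup>2 \<le> (?D1 * \<nu> * s)\<^sup>2" using b by (metis abs_ge_zero power2_abs power_mono)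
    \<comment> \<open>Since \<open>M\<close> is strictly finer than \<open>m0\<close>, the quotient
      \<open>t / side m0\<close> is at most half of \<open>t / side M\<close>; this is where
      \<open>2 powr - \<alpha>\<close> enters.\<close>
    have "(t / side m0) powr \<alpha> \<le> (t / side M * (1 / 2)) powr \<alpha>"
    proof (rule powr_mono2)
      have "2 * side M \<le> side m0" using side_antimono[OF m0M] side_Suc[of m0] by simp
      then show "t / side m0 \<le> t / side M * (1 / 2)" using t by (simp add: frac_le)
    qed (use \<alpha> t in auto)
    also have "\<dots> = s * 2 powr - \<alpha>"
      using t unfolding s_def by (simp only: powr_mult powr_divide powr_one_eq_one powr_minus_divide)
    finally have s0: "(t / side m0) powr \<alpha> \<le> s * 2 powr - \<alpha>" .
    have e1: "exp (?K * (t / side m0) powr \<alpha>) \<le> exp (?K * (s * 2 powr - \<alpha>))"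
      using s0 weight_rate_pos[OF \<alpha>(1)] by simp
    have "s * 2 powr - \<alpha> \<le> 1 * 1"
      using s two_powr_minus_less_1[OF \<alpha>(1)] by (intro mult_mono) auto
    then have "?K * (s * 2 powr - \<alpha>) \<le> ?K * 1" using weight_rate_pos[OF \<alpha>(1)] by (intro mult_left_mono) auto
    then have e2: "exp (?K * (t / side m0) powr \<alpha>) \<le> exp ?K" using e1 by (simp add: order_trans[OF e1])
    have "(theta k t F x)\<^sup>2 \<le> (1 + s) * (?a t)\<^sup>2 + (1 + 1 / s) * b\<^sup>2"
      unfolding split by (rule sum_square_weighted[OF s(1)])
    then have "exp (?K * (t / side m0) powr \<alpha>) * (theta k t F x)\<^sup>2 \<le>
       (exp (?K * (t / side m0) powr \<alpha>) * (1 + s)) * (?a t)\<^sup>2 + exp (?K * (t / side m0) powr \<alpha>) * ((1 + 1 / s) * b\<^sup>2)"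
      by (rule scale_split) simp
    also have "\<dots> \<le> exp (?K * s) * (?a t)\<^sup>2 + exp ?K * ((2 / s) * (?D1 * \<nu> * s)\<^sup>2)"
    proof (rule add_mono)
      have "exp (?K * (t / side m0) powr \<alpha>) * (1 + s) \<le> exp (?K * (s * 2 powr - \<alpha>)) * (1 + s)"
        using e1 s by (intro mult_right_mono) auto
      also have "\<dots> \<le> exp (?K * s)" using s by (intro weight_rate_absorb \<alpha>) auto
      finally show "(exp (?K * (t / side m0) powr \<alpha>) * (1 + s)) * (?a t)\<^sup>2 \<le> exp (?K * s) * (?a t)\<^sup>2"
        by (rule mult_right_mono) simp
      \<comment> \<open>As \<open>s \<le> 1\<close>, the factor \<open>1 + 1 / s\<close> is at most
        \<open>2 / s\<close>, while the tail is itself of order \<open>s\<close>: one power of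
        \<open>s\<close> is left, which is integrable against dt/t.\<close>
      show "exp (?K * (t / side m0) powr \<alpha>) * ((1 + 1 / s) * b\<^sup>2) \<le> exp ?K * ((2 / s) * (?D1 * \<nu> * s)\<^sup>2)"
        using e2 b2 s by (intro mult_mono) (auto simp: field_simps)
    qed
    also have "(2 / s) * (?D1 * \<nu> * s)\<^sup>2 = (2 * ?D1\<^sup>2 * \<nu>\<^sup>2) * s"
      using s by (simp add: power_mult_distrib power2_eq_square)
    finally show ?thesis by (simp add: s_def mult.assoc)
  qed
  have outer: "exp (?K * (t / side m0) powr \<alpha>) * (theta k t F x)\<^sup>2 \<le>
      exp ?K * 2 * (theta k t F x')\<^sup>2 + exp ?K * (2 * ?D2\<^sup>2 * \<nu>\<^sup>2) * (side M / t) powr \<alpha>"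
    if t: "side M \<le> t" "t < side m0" for t
  proof -
    have t0: "0 < t" using t side_pos[of M] by linarith
    define s where "s = (side M / t) powr \<alpha>"
    have s: "0 \<le> s" "s \<le> 1" unfolding s_def using t t0 \<alpha> by (auto intro!: powr_le1)
    define b where "b = theta k t F x - theta k t F x'"
    have "\<bar>b\<bar> \<le> C * avg_const CARD('n) \<alpha> * (ctrl_const D \<delta> * \<nu>) * (side M / t) powr \<alpha>"
      unfolding b_def using t by (intro theta_oscillation[OF int_F supp M(1) ctrl' _ _ xx']) auto
    then have b: "\<bar>b\<bar> \<le> ?D2 * \<nu> * s" by (simp add: s_def D_def mult_ac)
    then have "b\<^sup>2 \<le> (?D2 * \<nu> * s)\<^sup>2" by (metis abs_ge_zero power2_abs power_mono)
    also have "\<dots> = ?D2\<^sup>2 * \<nu>\<^sup>2 * (s * s)" by (simp add: power2_eq_square mult_ac)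
    also have "\<dots> \<le> ?D2\<^sup>2 * \<nu>\<^sup>2 * s"
      using s by (intro mult_left_mono mult_left_le) auto
    finally have b2: "b\<^sup>2 \<le> ?D2\<^sup>2 * \<nu>\<^sup>2 * s" .
    have "(theta k t F x)\<^sup>2 = (theta k t F x' + b)\<^sup>2" by (simp add: b_def)
    also have "\<dots> \<le> 2 * (theta k t F x')\<^sup>2 + 2 * b\<^sup>2"
      using two_mult_le_squares[of "theta k t F x'" b] by (simp add: power2_sum)
    finally have le: "(theta k t F x)\<^sup>2 \<le> 2 * (theta k t F x')\<^sup>2 + 2 * ?D2\<^sup>2 * \<nu>\<^sup>2 * s" using b2 by simp
    have "(t / side m0) powr \<alpha> \<le> 1" using t t0 \<alpha> by (intro powr_le1) auto
    then have "?K * (t / side m0) powr \<alpha> \<le> ?K * 1" using weight_rate_pos[OF \<alpha>(1)] by (intro mult_left_mono) auto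
    then have "exp (?K * (t / side m0) powr \<alpha>) \<le> exp ?K" by simp
    then have "exp (?K * (t / side m0) powr \<alpha>) * (theta k t F x)\<^sup>2 \<le> exp ?K * (2 * (theta k t F x')\<^sup>2 + 2 * ?D2\<^sup>2 * \<nu>\<^sup>2 * s)"
      using le by (intro mult_mono) auto
    then show ?thesis by (simp add: s_def distrib_left mult.assoc)
  qed
  let ?c1 = "exp ?K * (2 * ?D1\<^sup>2 * \<nu>\<^sup>2)" and ?c2 = "exp ?K * (2 * ?D2\<^sup>2 * \<nu>\<^sup>2)"
  let ?A = "\<lambda>t. ennreal (exp (?K * (t / side M) powr \<alpha>) * (?a t)\<^sup>2 / t) * indicator {side N<..<side M} t"
  let ?B = "\<lambda>t. ennreal ((t / side M) powr \<alpha> / t) * indicator {0<..<side M} t"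
  let ?E = "\<lambda>t. ennreal ((theta k t F x')\<^sup>2 / t) * indicator {side N<..<side m0} t"
  let ?H = "\<lambda>t. ennreal ((side M / t) powr \<alpha> / t) * indicator {side M..} t"
  have "weighted_energy f N m0 n0 x \<le> (\<integral>\<^sup>+ t. (?A t + ennreal ?c1 * ?B t) + (ennreal (exp ?K * 2) * ?E t + ennreal ?c2 * ?H t) \<partial>lborel)"
    unfolding weighted_energy_def F_def[symmetric]
  proof (rule nn_integral_mono)
    fix t :: real
    show "ennreal (exp (?K * (t / side m0) powr \<alpha>) * (theta k t F x)\<^sup>2 / t) * indicator {side N<..<side m0} t \<le>
      (?A t + ennreal ?c1 * ?B t) + (ennreal (exp ?K * 2) * ?E t + ennreal ?c2 * ?H t)"
    proof (cases "side N < t \<and> t < side m0")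
      case True
      then have t0: "0 < t" using side_pos[of N] by linarith
      show ?thesis
      proof (cases "t < side M")
        case tM: True
        have "exp (?K * (t / side m0) powr \<alpha>) * (theta k t F x)\<^sup>2 / t \<le>
          (exp (?K * (t / side M) powr \<alpha>) * (?a t)\<^sup>2 + ?c1 * (t / side M) powr \<alpha>) / t"
          using inner[OF t0 tM] t0 by (intro divide_right_mono) auto
        also have "\<dots> = exp (?K * (t / side M) powr \<alpha>) * (?a t)\<^sup>2 / t + ?c1 * ((t / side M) powr \<alpha> / t)"
          by (simp add: add_divide_distrib)
        finally have "ennreal (exp (?K * (t / side m0) powr \<alpha>) * (theta k t F x)\<^sup>2 / t) \<le> 
           ennreal (exp (?K * (t / side M) powr \<alpha>) * (?a t)\<^sup>2 / t + ?c1 * ((t / side M) powr \<alpha> / t))"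
          by (rule ennreal_leI)
        also have "\<dots> = ennreal (exp (?K * (t / side M) powr \<alpha>) * (?a t)\<^sup>2 / t) + ennreal ?c1 * ennreal ((t / side M) powr \<alpha> / t)"
          using t0 by (intro ennreal_add_mult) auto
        finally show ?thesis using True tM t0 by (simp add: add_increasing2)
      next
        case tM: False
        have "exp (?K * (t / side m0) powr \<alpha>) * (theta k t F x)\<^sup>2 / t \<le>
          (exp ?K * 2 * (theta k t F x')\<^sup>2 + ?c2 * (side M / t) powr \<alpha>) / t"
          using outer[of t] tM True t0 by (intro divide_right_mono) auto
        also have "\<dots> = exp ?K * 2 * ((theta k t F x')\<^sup>2 / t) + ?c2 * ((side M / t) powr \<alpha> / t)"
          by (simp add: add_divide_distrib)
        finally have "ennreal (exp (?K * (t / side m0) powr \<alpha>) * (theta k t F x)\<^sup>2 / t) \<le> 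
           ennreal (exp ?K * 2 * ((theta k t F x')\<^sup>2 / t) + ?c2 * ((side M / t) powr \<alpha> / t))"
          by (rule ennreal_leI)
        also have "\<dots> = ennreal (exp ?K * 2) * ennreal ((theta k t F x')\<^sup>2 / t) + ennreal ?c2 * ennreal ((side M / t) powr \<alpha> / t)"
          using t0 by (intro ennreal_mult_add_mult) auto
        finally show ?thesis using True tM t0 by simp
      qed
    qed simp
  qed
  also have "\<dots> = (weighted_energy f N M P x + ennreal ?c1 * (\<integral>\<^sup>+ t. ?B t \<partial>lborel)) + (ennreal (exp ?K * 2) * (\<integral>\<^sup>+ t. ?E t \<partial>lborel) + ennreal ?c2 * (\<integral>\<^sup>+ t. ?H t \<partial>lborel))"
    unfolding weighted_energy_def by (simp add: nn_integral_add nn_integral_cmult)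
  also have "\<dots> \<le> (weighted_energy f N M P x + ennreal ?c1 * ennreal (1 / \<alpha>)) + 
     (ennreal (exp ?K * 2) * ennreal (exc_const D \<alpha> C CT \<delta> * \<nu>\<^sup>2) + ennreal ?c2 * ennreal (1 / \<alpha>))"
    using I unfolding D_def \<nu>_def F_def
    by (intro add_mono mult_left_mono nn_integral_powr_near_0 nn_integral_powr_near_inf side_pos \<alpha>(1)) auto
  also have "\<dots> = weighted_energy f N M P x + (ennreal ?c1 * ennreal (1 / \<alpha>) + ennreal (exp ?K * 2) * ennreal (exc_const D \<alpha> C CT \<delta> * \<nu>\<^sup>2) + ennreal ?c2 * ennreal (1 / \<alpha>))"
    by (simp add: add.assoc)
  also have "ennreal ?c1 * ennreal (1 / \<alpha>) + ennreal (exp ?K * 2) * ennreal (exc_const D \<alpha> C CT \<delta> * \<nu>\<^sup>2) + ennreal ?c2 * ennreal (1 / \<alpha>)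
     = ennreal (?c1 * (1 / \<alpha>) + exp ?K * 2 * (exc_const D \<alpha> C CT \<delta> * \<nu>\<^sup>2) + ?c2 * (1 / \<alpha>))"
    using \<alpha> exc_const_pos[OF \<delta>0] by (intro ennreal_sum3_mult) (auto simp: D_def less_imp_le)
  also have "?c1 * (1 / \<alpha>) + exp ?K * 2 * (exc_const D \<alpha> C CT \<delta> * \<nu>\<^sup>2) + ?c2 * (1 / \<alpha>) = step_const D \<alpha> C CT * \<nu>\<^sup>2"
    by (simp add: step_const_def \<delta> D_def algebra_simps)
  finally show ?thesis by (simp add: P_def D_def \<nu>_def add.commute)
qed

text \<open>A cell stops when \<open>E\<close> fills more than \<open>1 / 2 ^ (D + 1)\<close> of it.
  Its parent did not stop, so \<open>E\<close> fills at most half of it and a good point remains; on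
  the other hand the stopped cells together measure at most \<open>2 ^ (D + 1)\<close> times
  \<open>E\<close>.\<close>

lemma sparse_step:
  assumes f: "integrable lborel f" and fb: "\<And>y. \<bar>f y\<bar> \<le> bf" and N: "m0 \<le> N"
  obtains P where "finite P" "\<And>p. p \<in> P \<Longrightarrow> m0 < fst p \<and> fst p \<le> N \<and> cell_of p \<subseteq> cell m0 n0"
    "disjoint_family_on (\<lambda>p. cell_of p) P"
    "emeasure lborel (\<Union>p\<in>P. cell_of p) \<le> ennreal (side m0 ^ CARD('n) / 2)"
    "\<And>x. x \<in> cell m0 n0 \<Longrightarrow> weighted_energy f N m0 n0 x \<le> ennreal (step_const CARD('n) \<alpha> C CT * (tri_mean f m0 n0)\<^sup>2)
        + (\<Sum>p\<in>P. weighted_energy f N (fst p) (snd p) x * indicator (cell_of p) x)"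
proof -
  let ?\<delta> = "exc_frac CARD('n)"
  define D where "D = CARD('n)"
  have rb: "\<bar>restr_tri f m0 n0 y\<bar> \<le> bf" for y
    using fb[of y] by (auto simp: restr_tri_def indicator_def)
  have rs: "restr_tri f m0 n0 y = 0" if "y \<notin> tri m0 n0" for y using that by (simp add: restr_tri_def)
  have mr: "mass (restr_tri f m0 n0) (tri m0 n0) / side m0 ^ CARD('n) = tri_mean f m0 n0"
    by (simp add: tri_mean_def mass_restr[OF f])
  obtain E where E [measurable]: "E \<in> sets borel" and EQ: "E \<subseteq> cell m0 n0" 
    and Em: "emeasure lborel E \<le> ennreal (?\<delta> * side m0 ^ CARD('n))"
    and ctrl: "\<And>x m. x \<in> cell m0 n0 - E \<Longrightarrow> m0 \<le> m \<Longrightarrow> m \<le> N \<Longrightarrow> 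
        mass (restr_tri f m0 n0) (tri m (idx m x)) \<le> ctrl_const CARD('n) ?\<delta> * tri_mean f m0 n0 * side m ^ CARD('n)"
    and I: "\<And>x. x \<in> cell m0 n0 - E \<Longrightarrow> 
      energy (restr_tri f m0 n0) {side N<..<side m0} x \<le> ennreal (exc_const CARD('n) \<alpha> C CT ?\<delta> * (tri_mean f m0 n0)\<^sup>2)"
    using exceptional_set[OF integrable_restr[OF f] rb rs N exc_frac_pos, of n0] unfolding mr by blast
  define B where "B m n \<longleftrightarrow> ennreal (side m ^ D / 2 ^ (D + 1)) < emeasure lborel (cell m n \<inter> E)" for m n
  define St where "St = stop_cells B m0 N (cell m0 n0)"
  define P where "P = {p \<in> St. B (fst p) (snd p)}"
  have sub: "cell_of p \<subseteq> cell m0 n0" if "p \<in> St" for p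
    using stops_subset_cell[OF N that[unfolded St_def]] .
  have lev: "m0 \<le> fst p" "fst p \<le> N" if "p \<in> St" for p
    using stops_level[OF N that[unfolded St_def]] by auto
  have finSt: "finite St" unfolding St_def by (rule finite_stops[OF N cell_subset_tri])
  then have finP: "finite P" by (simp add: P_def)
  have disj: "disjoint_family_on (\<lambda>p. cell_of p) P"
    by (rule disjoint_family_on_mono[OF _ disjoint_stops[OF N, of B "cell m0 n0"]]) (auto simp: P_def St_def)
  \<comment> \<open>The total share of \<open>E\<close> is below the threshold, so the recursion
    strictly descends.\<close>
  have not_top: "\<not> B m0 n0"
  proof -
    have "emeasure lborel (cell m0 n0 \<inter> E) \<le> ennreal (?\<delta> * side m0 ^ D)"
      using Em EQ by (simp add: Int_absorb1 D_def)
    also have "\<dots> \<le> ennreal (side m0 ^ D / 2 ^ (D + 1))"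
      by (intro ennreal_leI) (simp add: exc_frac_def D_def divide_right_mono frac_le)
    finally show ?thesis by (simp add: B_def not_less)
  qed
  have P_lev: "m0 < fst p" if "p \<in> P" for p
  proof (rule ccontr)
    assume "\<not> m0 < fst p"
    then have "fst p = m0" using lev[of p] that by (auto simp: P_def)
    moreover obtain z where "z \<in> cell_of p" using cell_nonempty by blast
    ultimately have "snd p = n0" using sub[of p] that by (auto simp: cell_def P_def)
    then show False using not_top that \<open>fst p = m0\<close> by (simp add: P_def)
  qed
  have small: "emeasure lborel (cell_of p \<inter> E) \<le> ennreal (side (fst p) ^ D / 2)" if p: "p \<in> St" for p
  proof (cases "fst p = m0")
    case True
    obtain z where "z \<in> cell_of p" using cell_nonempty by blast
    then have "snd p = n0" using sub[of p] True that by (auto simp: cell_def)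
    then have "emeasure lborel (cell_of p \<inter> E) \<le> ennreal (side m0 ^ D / 2 ^ (D + 1))"
      using not_top True by (simp add: B_def not_less)
    also have "\<dots> \<le> ennreal (side (fst p) ^ D / 2)"
      unfolding True by (intro ennreal_leI divide_left_mono) auto
    finally show ?thesis .
  next
    case False
    then obtain j where j: "fst p = Suc j" "m0 \<le> j" using lev[OF p] by (cases "fst p") auto
    obtain z where z: "z \<in> cell_of p" using cell_nonempty by blast
    then have iz: "idx (fst p) z = snd p" by (simp add: cell_def)
    have "\<not> B j (idx j z)" using stops_not_before[OF N p[unfolded St_def] z] j by simp
    then have parent: "emeasure lborel (cell j (idx j z) \<inter> E) \<le> ennreal (side j ^ D / 2 ^ (D + 1))"
      by (simp add: B_def not_less)
    have "cell_of p \<subseteq> cell j (idx j z)"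
      using cell_coarser[of j "fst p" z] j iz by simp
    then have "emeasure lborel (cell_of p \<inter> E) \<le> emeasure lborel (cell j (idx j z) \<inter> E)"
      by (intro emeasure_mono) auto
    from order_trans[OF this parent]
    have "emeasure lborel (cell_of p \<inter> E) \<le> ennreal (side j ^ D / 2 ^ (D + 1))" .
    also have "side j ^ D / 2 ^ (D + 1) = side (fst p) ^ D / 2"
      using j side_Suc[of j] by (simp add: power_mult_distrib)
    finally show ?thesis .
  qed
  have exists: "\<exists>x'. x' \<in> cell_of p - E" if p: "p \<in> St" for p
  proof (rule ccontr)
    assume "\<nexists>x'. x' \<in> cell_of p - E"
    then have "cell_of p \<inter> E = cell_of p" by blast
    then have "ennreal (side (fst p) ^ D) \<le> ennreal (side (fst p) ^ D / 2)"
      using small[OF p] by (simp add: emeasure_cell D_def)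
    then have "side (fst p) ^ D \<le> side (fst p) ^ D / 2" by (subst (asm) ennreal_le_iff) auto
    moreover have "0 < side (fst p) ^ D" by simp
    ultimately show False by linarith
  qed
  show thesis
  proof (rule that[OF finP _ disj])
    show "m0 < fst p \<and> fst p \<le> N \<and> cell_of p \<subseteq> cell m0 n0" if "p \<in> P" for p
      using P_lev[OF that] lev(2)[of p] sub[of p] that by (auto simp: P_def)
    have "emeasure lborel (\<Union>p\<in>P. cell_of p) = (\<Sum>p\<in>P. ennreal (side (fst p) ^ D))"
      by (subst sum_emeasure[OF _ disj finP, symmetric]) (auto simp: emeasure_cell D_def)
    also have "\<dots> \<le> (\<Sum>p\<in>P. ennreal (2 ^ (D + 1)) * emeasure lborel (cell_of p \<inter> E))"
    proof (rule sum_mono)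
      fix p assume "p \<in> P"
      then have "ennreal (side (fst p) ^ D / 2 ^ (D + 1)) \<le> emeasure lborel (cell_of p \<inter> E)"
        by (simp add: P_def B_def less_imp_le)
      then have "ennreal (2 ^ (D + 1)) * ennreal (side (fst p) ^ D / 2 ^ (D + 1)) \<le> ennreal (2 ^ (D + 1)) * emeasure lborel (cell_of p \<inter> E)"
        by (intro mult_left_mono) auto
      moreover have "ennreal (2 ^ (D + 1)) * ennreal (side (fst p) ^ D / 2 ^ (D + 1)) = ennreal (side (fst p) ^ D)"
        by (subst ennreal_mult[symmetric]) auto
      ultimately show "ennreal (side (fst p) ^ D) \<le> ennreal (2 ^ (D + 1)) * emeasure lborel (cell_of p \<inter> E)"
        by simp
    qed
    also have "\<dots> = ennreal (2 ^ (D + 1)) * emeasure lborel (\<Union>p\<in>P. cell_of p \<inter> E)"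
    proof -
      have disjE: "disjoint_family_on (\<lambda>p. cell_of p \<inter> E) P"
        using disj unfolding disjoint_family_on_def by blast
      show ?thesis unfolding sum_distrib_left[symmetric]
        by (subst sum_emeasure[OF _ disjE finP]) auto
    qed
    also have "\<dots> \<le> ennreal (2 ^ (D + 1)) * emeasure lborel E"
      by (intro mult_left_mono emeasure_mono) auto
    also have "\<dots> \<le> ennreal (2 ^ (D + 1)) * ennreal (?\<delta> * side m0 ^ CARD('n))"
      by (intro mult_left_mono Em) auto
    also have "\<dots> = ennreal (side m0 ^ CARD('n) / 2)"
      by (subst ennreal_mult[symmetric]) (auto simp: exc_frac_def D_def)
    finally show "emeasure lborel (\<Union>p\<in>P. cell_of p) \<le> ennreal (side m0 ^ CARD('n) / 2)" .
    fix x assume x: "x \<in> cell m0 n0"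
    then obtain p where p: "p \<in> St" "x \<in> cell_of p" 
      using stops_cover[OF x] unfolding St_def by blast
    obtain x' where x': "x' \<in> cell_of p" "x' \<notin> E" using exists[OF p(1)] by blast
    have x'Q: "x' \<in> cell m0 n0 - E" using x' sub[OF p(1)] by blast
    have ip: "idx (fst p) x = snd p" "idx (fst p) x' = snd p" using p x' by (auto simp: cell_def)
    have "weighted_energy f N m0 n0 x \<le> ennreal (step_const CARD('n) \<alpha> C CT * (tri_mean f m0 n0)\<^sup>2) + weighted_energy f N (fst p) (idx (fst p) x) x"
      using lev[OF p(1)] x ip
      by (intro local_step[OF f _ _ _ _ _ _ refl, where x' = x'] ctrl[OF x'Q] I[OF x'Q]) (auto simp: cell_def)
    also have "\<dots> \<le> ennreal (step_const CARD('n) \<alpha> C CT * (tri_mean f m0 n0)\<^sup>2)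
        + (\<Sum>p\<in>P. weighted_energy f N (fst p) (snd p) x * indicator (cell_of p) x)"
    proof (rule add_left_mono)
      show "weighted_energy f N (fst p) (idx (fst p) x) x \<le> (\<Sum>p\<in>P. weighted_energy f N (fst p) (snd p) x * indicator (cell_of p) x)"
      proof (cases "p \<in> P")
        case True
        have "weighted_energy f N (fst p) (idx (fst p) x) x = weighted_energy f N (fst p) (snd p) x * indicator (cell_of p) x"
          using p ip by simp
        also have "\<dots> \<le> (\<Sum>p\<in>P. weighted_energy f N (fst p) (snd p) x * indicator (cell_of p) x)"
          using True finP by (intro member_le_sum) auto
        finally show ?thesis .
      next
        case False
        \<comment> \<open>A cell of generation \<open>N\<close> has an empty range of scales, so its
          energy is 0 and the recursion ends there.\<close>
        then have "fst p = N" using stops_cases[OF N p(1)[unfolded St_def]] p(1) by (auto simp: P_def)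
        then show ?thesis by (simp add: weighted_energy_def)
      qed
    qed
    finally show "weighted_energy f N m0 n0 x \<le> ennreal (step_const CARD('n) \<alpha> C CT * (tri_mean f m0 n0)\<^sup>2)
        + (\<Sum>p\<in>P. weighted_energy f N (fst p) (snd p) x * indicator (cell_of p) x)" .
  qed
qed

text \<open>Induction on the number of generations left. Besides the pointwise bound it carries a
  packing condition, that the members strictly inside a member cover at most half of it, from which
  sparseness is read off later.\<close>

lemma sparse_family:
  assumes f: "integrable lborel f" and fb: "\<And>y. \<bar>f y\<bar> \<le> bf" and N: "m0 \<le> N"
  shows "\<exists>S. finite S \<and> (m0, n0) \<in> S \<and> (\<forall>p\<in>S. m0 \<le> fst p \<and> cell_of p \<subseteq> cell m0 n0) \<and>
    (\<forall>p\<in>S. emeasure lborel (\<Union>q\<in>{q\<in>S. cell_of q \<subset> cell_of p}. cell_of q) \<le> ennreal (side (fst p) ^ CARD('n) / 2)) \<and>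
    (\<forall>x\<in>cell m0 n0. weighted_energy f N m0 n0 x \<le> (\<Sum>p\<in>S. ennreal (step_const CARD('n) \<alpha> C CT * (tri_mean f (fst p) (snd p))\<^sup>2) * indicator (cell_of p) x))"
  using N
proof (induction "N - m0" arbitrary: m0 n0 rule: less_induct)
  case less
  let ?cell = cell_of
  let ?c = "\<lambda>p. ennreal (step_const CARD('n) \<alpha> C CT * (tri_mean f (fst p) (snd p))\<^sup>2)"
  obtain P where P: "finite P" "\<And>p. p \<in> P \<Longrightarrow> m0 < fst p \<and> fst p \<le> N \<and> ?cell p \<subseteq> cell m0 n0"
    "disjoint_family_on ?cell P" "emeasure lborel (\<Union>p\<in>P. ?cell p) \<le> ennreal (side m0 ^ CARD('n) / 2)"
    "\<And>x. x \<in> cell m0 n0 \<Longrightarrow> weighted_energy f N m0 n0 x \<le> ?c (m0, n0) + (\<Sum>p\<in>P. weighted_energy f N (fst p) (snd p) x * indicator (?cell p) x)"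
    unfolding fst_conv snd_conv by (rule sparse_step[OF f fb less.prems, of n0]) blast
  have "\<forall>p\<in>P. \<exists>S. finite S \<and> p \<in> S \<and> (\<forall>q\<in>S. fst p \<le> fst q \<and> ?cell q \<subseteq> ?cell p) \<and>
    (\<forall>q\<in>S. emeasure lborel (\<Union>q'\<in>{q'\<in>S. ?cell q' \<subset> ?cell q}. ?cell q') \<le> ennreal (side (fst q) ^ CARD('n) / 2)) \<and>
    (\<forall>x\<in>?cell p. weighted_energy f N (fst p) (snd p) x \<le> (\<Sum>q\<in>S. ?c q * indicator (?cell q) x))"
  proof
    fix p assume p: "p \<in> P"
    then have "N - fst p < N - m0" "fst p \<le> N" using P(2)[OF p] by auto
    from less.hyps[OF this, of "snd p"]
    show "\<exists>S. finite S \<and> p \<in> S \<and> (\<forall>q\<in>S. fst p \<le> fst q \<and> ?cell q \<subseteq> ?cell p) \<and>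
      (\<forall>q\<in>S. emeasure lborel (\<Union>q'\<in>{q'\<in>S. ?cell q' \<subset> ?cell q}. ?cell q') \<le> ennreal (side (fst q) ^ CARD('n) / 2)) \<and>
      (\<forall>x\<in>?cell p. weighted_energy f N (fst p) (snd p) x \<le> (\<Sum>q\<in>S. ?c q * indicator (?cell q) x))"
      by simp
  qed
  then obtain T where "\<forall>p\<in>P. finite (T p) \<and> p \<in> T p \<and> (\<forall>q\<in>T p. fst p \<le> fst q \<and> ?cell q \<subseteq> ?cell p) \<and>
    (\<forall>q\<in>T p. emeasure lborel (\<Union>q'\<in>{q'\<in>T p. ?cell q' \<subset> ?cell q}. ?cell q') \<le> ennreal (side (fst q) ^ CARD('n) / 2)) \<and>
    (\<forall>x\<in>?cell p. weighted_energy f N (fst p) (snd p) x \<le> (\<Sum>q\<in>T p. ?c q * indicator (?cell q) x))"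
    by (rule bchoice[THEN exE])
  then have T: "\<And>p. p \<in> P \<Longrightarrow> finite (T p)" "\<And>p. p \<in> P \<Longrightarrow> p \<in> T p"
    "\<And>p q. p \<in> P \<Longrightarrow> q \<in> T p \<Longrightarrow> fst p \<le> fst q" "\<And>p q. p \<in> P \<Longrightarrow> q \<in> T p \<Longrightarrow> ?cell q \<subseteq> ?cell p"
    "\<And>p q. p \<in> P \<Longrightarrow> q \<in> T p \<Longrightarrow> emeasure lborel (\<Union>q'\<in>{q'\<in>T p. ?cell q' \<subset> ?cell q}. ?cell q') \<le> ennreal (side (fst q) ^ CARD('n) / 2)"
    "\<And>p x. p \<in> P \<Longrightarrow> x \<in> ?cell p \<Longrightarrow> weighted_energy f N (fst p) (snd p) x \<le> (\<Sum>q\<in>T p. ?c q * indicator (?cell q) x)"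
    by blast+
  \<comment> \<open>A member of one family lies in no cell of \<open>P\<close> other than its own.
    Hence the sums over the families add up, and the packing condition of a member sees only its own
    family.\<close>
  have T_unique: "p = p'" if "p \<in> P" "p' \<in> P" "q \<in> T p" "?cell q \<subseteq> ?cell p'" for p p' q
  proof (rule ccontr)
    assume "p \<noteq> p'"
    then have "?cell p \<inter> ?cell p' = {}" using P(3) that by (auto simp: disjoint_family_on_def)
    then show False using T(4)[OF that(1,3)] that(4) cell_nonempty[of "fst q" "snd q"] by blast
  qed
  define S where "S = insert (m0, n0) (\<Union>p\<in>P. T p)"
  have T_sub: "?cell q \<subseteq> cell m0 n0" "m0 < fst q" if "p \<in> P" "q \<in> T p" for p q
    using T(3,4)[OF that] P(2)[OF that(1)] by auto
  have top: "(m0, n0) \<notin> (\<Union>p\<in>P. T p)" using T_sub(2) by fastforce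
  show ?case
  proof (intro exI[of _ S] conjI ballI)
    show "finite S" using P(1) T(1) by (simp add: S_def)
    show "(m0, n0) \<in> S" by (simp add: S_def)
    show "m0 \<le> fst p" if "p \<in> S" for p
    proof (cases "p = (m0, n0)")
      case False
      then obtain p0 where "p0 \<in> P" "p \<in> T p0" using \<open>p \<in> S\<close> by (auto simp: S_def)
      from T_sub(2)[OF this] show ?thesis by simp
    qed simp
    show "?cell p \<subseteq> cell m0 n0" if "p \<in> S" for p
    proof (cases "p = (m0, n0)")
      case False
      then obtain p0 where "p0 \<in> P" "p \<in> T p0" using \<open>p \<in> S\<close> by (auto simp: S_def)
      from T_sub(1)[OF this] show ?thesis .
    qed simp
    show "emeasure lborel (\<Union>q\<in>{q\<in>S. ?cell q \<subset> ?cell p}. ?cell q) \<le> ennreal (side (fst p) ^ CARD('n) / 2)" if p: "p \<in> S" for p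
    proof (cases "p = (m0, n0)")
      case True
      have "(\<Union>q\<in>{q\<in>S. ?cell q \<subset> ?cell p}. ?cell q) \<subseteq> (\<Union>p\<in>P. ?cell p)"
      proof (rule UN_least)
        fix q assume q: "q \<in> {q \<in> S. ?cell q \<subset> ?cell p}"
        then have "q \<noteq> (m0, n0)" using True by auto
        then obtain p1 where p1: "p1 \<in> P" "q \<in> T p1" using q by (auto simp: S_def)
        show "?cell q \<subseteq> (\<Union>p\<in>P. ?cell p)" using T(4)[OF p1] p1(1) by blast
      qed
      then have "emeasure lborel (\<Union>q\<in>{q\<in>S. ?cell q \<subset> ?cell p}. ?cell q) \<le> emeasure lborel (\<Union>p\<in>P. ?cell p)"
        using P(1) by (intro emeasure_mono) auto
      then show ?thesis using P(4) True by simp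
    next
      case False
      then obtain p0 where p0: "p0 \<in> P" "p \<in> T p0" using p by (auto simp: S_def)
      have "{q\<in>S. ?cell q \<subset> ?cell p} \<subseteq> {q\<in>T p0. ?cell q \<subset> ?cell p}"
      proof
        fix q assume q: "q \<in> {q\<in>S. ?cell q \<subset> ?cell p}"
        have "q \<noteq> (m0, n0)" using q T_sub(1)[OF p0] by auto
        then obtain p1 where p1: "p1 \<in> P" "q \<in> T p1" using q by (auto simp: S_def)
        have "?cell q \<subseteq> ?cell p0" using q T(4)[OF p0] by auto
        then have "p1 = p0" using T_unique[OF p1(1) p0(1) p1(2)] by simp
        then show "q \<in> {q\<in>T p0. ?cell q \<subset> ?cell p}" using p1 q by simp
      qed
      then have "emeasure lborel (\<Union>q\<in>{q\<in>S. ?cell q \<subset> ?cell p}. ?cell q) \<le> emeasure lborel (\<Union>q\<in>{q\<in>T p0. ?cell q \<subset> ?cell p}. ?cell q)"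
        using T(1)[OF p0(1)] by (intro emeasure_mono UN_mono sets.finite_UN) auto
      then show ?thesis using T(5)[OF p0] by (rule order_trans)
    qed
    fix x assume x: "x \<in> cell m0 n0"
    have "weighted_energy f N m0 n0 x \<le> ?c (m0, n0) + (\<Sum>p\<in>P. weighted_energy f N (fst p) (snd p) x * indicator (?cell p) x)" by (rule P(5)[OF x])
    also have "\<dots> \<le> ?c (m0, n0) + (\<Sum>p\<in>P. \<Sum>q\<in>T p. ?c q * indicator (?cell q) x)"
    proof (intro add_left_mono sum_mono)
      fix p assume p: "p \<in> P"
      show "weighted_energy f N (fst p) (snd p) x * indicator (?cell p) x \<le> (\<Sum>q\<in>T p. ?c q * indicator (?cell q) x)"
        using T(6)[OF p, of x] by (cases "x \<in> ?cell p") auto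
    qed
    also have "(\<Sum>p\<in>P. \<Sum>q\<in>T p. ?c q * indicator (?cell q) x) = (\<Sum>q\<in>(\<Union>p\<in>P. T p). ?c q * indicator (?cell q) x)"
    proof (rule sum.UNION_disjoint[symmetric])
      show "\<forall>i\<in>P. \<forall>j\<in>P. i \<noteq> j \<longrightarrow> T i \<inter> T j = {}" using T_unique T(4) by blast
    qed (use P(1) T(1) in auto)
    also have "?c (m0, n0) + \<dots> = (\<Sum>p\<in>S. ?c p * indicator (?cell p) x)"
      unfolding S_def using P(1) T(1) top x by (subst sum.insert) auto
    finally show "weighted_energy f N m0 n0 x \<le> (\<Sum>p\<in>S. ?c p * indicator (?cell p) x)" .
  qed
qed

end

section \<open>Dyadic lattices\<close>

text \<open>\<open>dyadic_desc\<close> and \<open>dyadic_lattice\<close> speak of sets; corner and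
  side have to be recovered from the set before descendants of descendants can be composed.\<close>

lemma cube_inject:
  fixes a b :: "real^'n"
  assumes eq: "cube a l = cube b s" and pos: "0 < l" "0 < s"
  shows "a = b" "l = s"
proof -
  have mem: "u \<in> cube u r" if "0 < r" for u :: "real^'n" and r using that by (simp add: cube_def)
  have "a \<in> cube b s" "b \<in> cube a l" using mem[of l a] mem[of s b] eq pos by auto
  then show ab: "a = b" unfolding vec_eq_iff by (auto simp: cube_def intro!: antisym)
  have "measure lborel (cube a l) = measure lborel (cube b s)" using eq by simp
  then have "l ^ CARD('n) = s ^ CARD('n)" using pos by (simp add: measure_cube)
  then show "l = s" using pos by (simp add: power_eq_iff_eq_base)
qed

text \<open>\<open>dyadic_desc\<close> on the level of corners and sides, where transitivity is
  plain arithmetic.\<close>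

definition subcube :: "real^'n \<Rightarrow> real \<Rightarrow> real^'n \<Rightarrow> real \<Rightarrow> bool" where
  "subcube a l b s \<longleftrightarrow> (\<exists>k. s = l / 2 ^ k \<and> (\<forall>i. \<exists>m::int. 0 \<le> m \<and> m < 2 ^ k \<and> b $ i = a $ i + s * of_int m))"

lemma dyadic_desc_iff_subcube:
  "dyadic_desc Q Q' \<longleftrightarrow> (\<exists>a l b s. l > 0 \<and> Q = cube a l \<and> Q' = cube b s \<and> subcube a l b s)"
  unfolding dyadic_desc_def subcube_def by blast

lemma subcube_refl: "subcube a l a l"
  unfolding subcube_def by (rule exI[of _ 0]) (auto intro!: exI[of _ "0::int"])

lemma subcube_pos: "subcube a l b s \<Longrightarrow> 0 < l \<Longrightarrow> 0 < s"
  by (auto simp: subcube_def)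

lemma subcube_trans:
  assumes "subcube a l b s" "subcube b s c u"
  shows "subcube a l c u"
proof -
  obtain k where k: "s = l / 2 ^ k" "\<And>i. \<exists>m::int. 0 \<le> m \<and> m < 2 ^ k \<and> b $ i = a $ i + s * of_int m"
    using assms(1) unfolding subcube_def by blast
  obtain j where j: "u = s / 2 ^ j" "\<And>i. \<exists>m::int. 0 \<le> m \<and> m < 2 ^ j \<and> c $ i = b $ i + u * of_int m"
    using assms(2) unfolding subcube_def by blast
  show ?thesis unfolding subcube_def
  proof (intro exI[of _ "k + j"] conjI allI)
    show "u = l / 2 ^ (k + j)" using j k by (simp add: power_add)
    fix i
    obtain m where m: "0 \<le> m" "m < 2 ^ k" "b $ i = a $ i + s * of_int m" using k by blast
    obtain m' where m': "0 \<le> m'" "m' < 2 ^ j" "c $ i = b $ i + u * of_int m'" using j by blast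
    show "\<exists>m::int. 0 \<le> m \<and> m < 2 ^ (k + j) \<and> c $ i = a $ i + u * of_int m"
    proof (intro exI[of _ "2 ^ j * m + m'"] conjI)
      show "0 \<le> 2 ^ j * m + m'" using m m' by simp
      have "2 ^ j * m + m' < 2 ^ j * m + 2 ^ j * 1" using m' by simp
      also have "\<dots> = 2 ^ j * (m + 1)" by (simp add: algebra_simps)
      also have "\<dots> \<le> 2 ^ j * 2 ^ k" using m by (intro mult_left_mono) auto
      finally show "2 ^ j * m + m' < 2 ^ (k + j)" by (simp add: power_add mult.commute)
      have "s = u * 2 ^ j" using j by simp
      then show "c $ i = a $ i + u * of_int (2 ^ j * m + m')" using m m' by (simp add: algebra_simps)
    qed
  qed
qed

text \<open>The total shift of the lower corner, in units of the initial side, after a number of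
  doublings: the steps from an odd \<open>i\<close> extend the cube downwards, those from an even
  \<open>i\<close> upwards.\<close>

fun offset :: "nat \<Rightarrow> real" where
  "offset 0 = 0"
| "offset (Suc i) = offset i + (if odd i then 2 ^ i else 0)"

lemma offset_even: "3 * offset (2 * i) = 2 * (4 ^ i - 1)"
proof (induction i)
  case (Suc i)
  have "offset (2 * Suc i) = offset (2 * i) + 2 ^ (2 * i + 1)" by simp
  moreover have "(2::real) ^ (2 * i + 1) = 2 * 4 ^ i" by (simp add: power_mult)
  ultimately show ?case using Suc by simp
qed simp

text \<open>Doubling a cube alternately towards the two opposite corners exhausts the whole space.\<close>
lemma dyadic_lattice_exists:
  fixes a :: "real^'n"
  assumes l: "0 < l"
  obtains D where "dyadic_lattice D" "\<And>b s. subcube a l b s \<Longrightarrow> cube b s \<in> D"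
proof -
  define c where "c i = (\<chi> v. a $ v - l * offset i)" for i
  define D where "D = {cube b s | i b s. subcube (c i) (l * 2 ^ i) b s}"
  have lpos: "0 < l * 2 ^ i" for i :: nat using l by simp
  have step: "subcube (c (Suc i)) (l * 2 ^ Suc i) (c i) (l * 2 ^ i)" for i
    unfolding subcube_def
  proof (intro exI[of _ "1::nat"] conjI allI)
    fix v
    show "\<exists>m::int. 0 \<le> m \<and> m < 2 ^ 1 \<and> c i $ v = c (Suc i) $ v + l * 2 ^ i * of_int m"
      by (rule exI[of _ "if odd i then 1 else 0"]) (simp add: c_def algebra_simps)
  qed simp
  have chain: "subcube (c j) (l * 2 ^ j) (c i) (l * 2 ^ i)" if "i \<le> j" for i j
    using that
  proof (induction j rule: dec_induct)
    case (step j)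
    then show ?case using subcube_trans[OF \<open>subcube (c (Suc j)) (l * 2 ^ Suc j) (c j) (l * 2 ^ j)\<close>] by blast
  qed (rule subcube_refl)
  show thesis
  proof (rule that[of D])
    show "cube b s \<in> D" if "subcube a l b s" for b s
    proof -
      have "c 0 = a" by (simp add: c_def vec_eq_iff)
      then have "subcube (c 0) (l * 2 ^ 0) b s" using that by simp
      then show ?thesis unfolding D_def by blast
    qed
    show "dyadic_lattice D"
      unfolding dyadic_lattice_def
    proof (intro conjI ballI allI impI)
      show "is_cube Q" if "Q \<in> D" for Q
        using that subcube_pos[OF _ lpos] unfolding D_def is_cube_def by blast
      show "Q' \<in> D" if Q: "Q \<in> D" and desc: "dyadic_desc Q Q'" for Q Q'
      proof -
        obtain i b s where Q1: "Q = cube b s" "subcube (c i) (l * 2 ^ i) b s" using Q by (auto simp: D_def)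
        obtain b' s' b2 s2 where Q2: "0 < s'" "Q = cube b' s'" "Q' = cube b2 s2" "subcube b' s' b2 s2"
          using desc by (auto simp: dyadic_desc_iff_subcube)
        have "b = b'" "s = s'" using cube_inject[of b s b' s'] Q1 Q2 subcube_pos[OF Q1(2) lpos] by auto
        then have "subcube (c i) (l * 2 ^ i) b2 s2" using subcube_trans[OF Q1(2)] Q2 by simp
        then show ?thesis using Q2 unfolding D_def by blast
      qed
      show "\<exists>Q\<in>D. dyadic_desc Q Q' \<and> dyadic_desc Q Q''" if Q': "Q' \<in> D" and Q'': "Q'' \<in> D" for Q' Q''
      proof -
        obtain i b s where 1: "Q' = cube b s" "subcube (c i) (l * 2 ^ i) b s" using Q' by (auto simp: D_def)
        obtain j b' s' where 2: "Q'' = cube b' s'" "subcube (c j) (l * 2 ^ j) b' s'" using Q'' by (auto simp: D_def)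
        let ?m = "max i j"
        have "subcube (c ?m) (l * 2 ^ ?m) b s" "subcube (c ?m) (l * 2 ^ ?m) b' s'"
          using subcube_trans[OF chain 1(2)] subcube_trans[OF chain 2(2)] by auto
        then have "dyadic_desc (cube (c ?m) (l * 2 ^ ?m)) Q'" "dyadic_desc (cube (c ?m) (l * 2 ^ ?m)) Q''"
          unfolding dyadic_desc_iff_subcube using 1 2 lpos by blast+
        moreover have "cube (c ?m) (l * 2 ^ ?m) \<in> D" unfolding D_def using subcube_refl by blast
        ultimately show ?thesis by blast
      qed
      show "\<exists>Q\<in>D. K \<subseteq> Q" if K: "compact K" for K
      proof -
        obtain R where R: "\<And>x. x \<in> K \<Longrightarrow> norm x \<le> R" using compact_imp_bounded[OF K] by (auto simp: bounded_iff)
        have xR: "\<bar>x $ v\<bar> \<le> R" if "x \<in> K" for x v using R[OF that] component_le_norm_cart[of x v] by linarith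
        define A where "A = Max (range (\<lambda>v. \<bar>a $ v\<bar>))"
        have A: "\<bar>a $ v\<bar> \<le> A" for v unfolding A_def by (intro Max_ge) auto
        obtain i :: nat where i: "(R + A) / l < i" using reals_Archimedean2 by blast
        then have li: "R + A < l * i" using l by (simp add: pos_divide_less_eq mult.commute)
        have bern: "1 + 3 * real i \<le> 4 ^ i" using Bernoulli_inequality[of 3 i] by (simp add: mult.commute)
        \<comment> \<open>After \<open>2 * i\<close> doublings the cube reaches at least
          \<open>l * i\<close> beyond the original corner in both directions of every axis.\<close>
        have o1: "real i \<le> offset (2 * i)" "real i \<le> 2 ^ (2 * i) - offset (2 * i)"
          using offset_even[of i] bern by (auto simp: power_mult)
        have l1: "l * i \<le> l * offset (2 * i)" "l * i \<le> l * (2 ^ (2 * i) - offset (2 * i))"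
          using o1 l by (auto intro!: mult_left_mono simp del: offset.simps)
        have "K \<subseteq> cube (c (2 * i)) (l * 2 ^ (2 * i))"
        proof
          fix x assume x: "x \<in> K"
          show "x \<in> cube (c (2 * i)) (l * 2 ^ (2 * i))"
            unfolding cube_def mem_Collect_eq
          proof
            fix v
            have "\<bar>x $ v\<bar> \<le> R" "\<bar>a $ v\<bar> \<le> A" using xR[OF x] A by auto
            then show "c (2 * i) $ v \<le> x $ v \<and> x $ v < c (2 * i) $ v + l * 2 ^ (2 * i)"
              using l1 li unfolding c_def vec_lambda_beta right_diff_distrib by linarith
          qed
        qed
        moreover have "cube (c (2 * i)) (l * 2 ^ (2 * i)) \<in> D" unfolding D_def using subcube_refl by blast
        ultimately show ?thesis by blast
      qed
    qed
  qed
qed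

text \<open>2 is invertible modulo 3, so \<open>2 ^ m * c\<close> meets all residues as
  \<open>c\<close> runs through three consecutive integers. The range from -3 to -1 will place the
  large cube so that it contains the dilates of all cells inside the top cell.\<close>

lemma residue_choice: "\<exists>c::int. -3 \<le> c \<and> c \<le> -1 \<and> 3 dvd (z - 2 ^ m * c)"
proof -
  have "(2::int) ^ m mod 3 = 1 \<or> (2::int) ^ m mod 3 = 2"
  proof (induction m)
    case (Suc m)
    then show ?case unfolding power_Suc by presburger
  qed simp
  then have "3 dvd (z - 2 ^ m * (-1)) \<or> 3 dvd (z - 2 ^ m * (-2)) \<or> 3 dvd (z - 2 ^ m * (-3 :: int))" by presburger
  then show ?thesis
  proof (elim disjE)
    assume "3 dvd (z - 2 ^ m * (-1))"
    then show ?thesis by (intro exI[of _ "-1"]) auto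
  next
    assume "3 dvd (z - 2 ^ m * (-2))"
    then show ?thesis by (intro exI[of _ "-2"]) auto
  next
    assume "3 dvd (z - 2 ^ m * (-3))"
    then show ?thesis by (intro exI[of _ "-3"]) auto
  qed
qed

context grid
begin

lemma cell_inject: "cell m n = cell m' n' \<Longrightarrow> m = m' \<and> n = n'"
proof -
  assume eq: "cell m n = cell m' n'"
  then have "side m = side m'" using cube_inject(2) side_pos unfolding cell_eq_cube by blast
  then have "(2::real) ^ m = 2 ^ m'" using L by (simp add: side_def)
  then have m: "m = m'" by simp
  obtain z where "z \<in> cell m n" using cell_nonempty by blast
  then show ?thesis using eq m by (auto simp: cell_def)
qed

lemma tri_inject:
  assumes "tri m n = tri m' n'"
  shows "m = m' \<and> n = n'"
proof -
  have pos: "0 < 3 * side j" for j by simp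
  from cube_inject[OF assms[unfolded tri_eq_cube] pos pos]
  have 1: "(\<chi> i. (\<chi> i. a $ i + side m * of_int (n $ i)) $ i - side m) = (\<chi> i. (\<chi> i. a $ i + side m' * of_int (n' $ i)) $ i - side m')"
    and "side m = side m'" by auto
  then have "(2::real) ^ m = 2 ^ m'" using L by (simp add: side_def)
  then have m: "m = m'" by simp
  with 1 have "n = n'" by (simp add: vec_eq_iff)
  with m show ?thesis by simp
qed

lemma cells_nested:
  assumes "cell m n \<inter> cell m' n' \<noteq> {}" "(m, n) \<noteq> (m', n')"
  shows "cell m n \<subset> cell m' n' \<or> cell m' n' \<subset> cell m n"
proof -
  obtain z where z: "idx m z = n" "idx m' z = n'" using assms(1) by (auto simp: cell_def)
  have "cell m n \<subseteq> cell m' n' \<or> cell m' n' \<subseteq> cell m n"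
    using cell_coarser[of m m' z] cell_coarser[of m' m z] z by (cases "m \<le> m'") auto
  then show ?thesis using cell_inject assms(2) by blast
qed

text \<open>Since 2 is a unit modulo 3, the dilates by 3 of the grid cubes inside the top cube split into
  finitely many classes, each of them consisting of dyadic descendants of one large cube.\<close>
lemma tri_subcube:
  assumes sub: "cell m n \<subseteq> cell 0 0"
  shows "\<exists>c :: int^'n. (\<forall>i. \<bar>c $ i - (\<chi> i. -2) $ i\<bar> \<le> 1) \<and>
     subcube (\<chi> i. a $ i + L * of_int (c $ i)) (6 * L) (\<chi> i. (\<chi> i. a $ i + side m * of_int (n $ i)) $ i - side m) (3 * side m)"
proof -
  obtain z where z: "z \<in> cell m n" using cell_nonempty by blast
  then have z': "idx m z = n" "idx 0 z = 0" using sub by (auto simp: cell_def)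
  have n: "0 \<le> n $ i" "n $ i < 2 ^ m" for i
  proof -
    have e: "\<lfloor>(z $ i - a $ i) / side 0\<rfloor> = 0" using z'(2) by (simp add: idx_def vec_eq_iff)
    then have "a $ i \<le> z $ i" "z $ i < a $ i + L" using floor_divide_iff[where u = "z $ i" and c = "a $ i" and m = 0 and z = 0] by (auto simp: side_def)
    then have "0 \<le> (z $ i - a $ i) / side m" "(z $ i - a $ i) / side m < L / side m" 
      by (auto intro!: divide_nonneg_pos divide_strict_right_mono)
    moreover have "L / side m = 2 ^ m" using L by (simp add: side_def)
    ultimately have "0 \<le> (z $ i - a $ i) / side m" "(z $ i - a $ i) / side m < 2 ^ m" by simp_all
    then have "0 \<le> \<lfloor>(z $ i - a $ i) / side m\<rfloor>" "\<lfloor>(z $ i - a $ i) / side m\<rfloor> < 2 ^ m"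
      by (auto simp: floor_less_iff)
    then show "0 \<le> n $ i" "n $ i < 2 ^ m" using z'(1) by (auto simp: idx_def)
  qed
  have "\<forall>i. \<exists>c::int. -3 \<le> c \<and> c \<le> -1 \<and> 3 dvd ((n $ i - 1) - 2 ^ m * c)" using residue_choice by blast
  then obtain c where c: "\<And>i. -3 \<le> c i \<and> c i \<le> -1 \<and> 3 dvd ((n $ i - 1) - 2 ^ m * c i)" by metis
  show ?thesis
  proof (intro exI[of _ "\<chi> i. c i"] conjI allI)
    show "\<bar>(\<chi> i. c i) $ i - (\<chi> i. -2) $ i\<bar> \<le> 1" for i using c[of i] by (simp add: abs_le_iff)
    show "subcube (\<chi> i. a $ i + L * of_int ((\<chi> i. c i) $ i)) (6 * L) (\<chi> i. (\<chi> i. a $ i + side m * of_int (n $ i)) $ i - side m) (3 * side m)"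
      unfolding subcube_def
    \<comment> \<open>The side \<open>6 * L\<close>, twice that of the dilated top cell, leaves room
      for the shift by \<open>c\<close>; hence one halving more than the generation
      \<open>m\<close>.\<close>
    proof (intro exI[of _ "m + 1"] conjI allI)
      show "3 * side m = 6 * L / 2 ^ (m + 1)" by (simp add: side_def)
      fix i
      obtain q where q: "(n $ i - 1) - 2 ^ m * c i = 3 * q" using c[of i] by (auto elim: dvdE)
      have p1: "(1::int) \<le> 2 ^ m" by simp
      have "2 ^ m * c i \<le> 2 ^ m * (-1)" by (rule mult_left_mono) (use c[of i] in auto)
      moreover have "2 ^ m * (-3) \<le> 2 ^ m * c i" by (rule mult_left_mono) (use c[of i] in auto)
      ultimately have bounds: "0 \<le> 3 * q" "3 * q < 3 * 2 ^ (m + 1)" using n[of i] q p1 by auto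
      have r: "L = 2 ^ m * side m" by (simp add: side_def)
      have "of_int (n $ i) - 1 - 2 ^ m * of_int (c i) = 3 * (of_int q :: real)"
        using arg_cong[OF q, of "of_int :: int \<Rightarrow> real"] by simp
      then have h: "side m * (of_int (n $ i) - 1 - 2 ^ m * of_int (c i)) = 3 * side m * of_int q" by simp
      have "side m * of_int (n $ i) - side m - (2 ^ m * side m) * of_int (c i) = side m * (of_int (n $ i) - 1 - 2 ^ m * of_int (c i))"
        by (simp add: right_diff_distrib)
      then have "side m * of_int (n $ i) - side m - L * of_int (c i) = 3 * side m * of_int q"
        unfolding h r[symmetric] .
      then have "side m * of_int (n $ i) - side m = L * of_int (c i) + 3 * side m * of_int q" by linarith
      then show "\<exists>j::int. 0 \<le> j \<and> j < 2 ^ (m + 1) \<and> (\<chi> i. (\<chi> i. a $ i + side m * of_int (n $ i)) $ i - side m) $ i =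
           (\<chi> i. a $ i + L * of_int ((\<chi> i. c i) $ i)) $ i + 3 * side m * of_int j"
        using bounds by (intro exI[of _ q]) simp
    qed
  qed
qed

end

section \<open>Sparse domination\<close>

text \<open>The second summand is for the scales \<open>t \<ge> L\<close>, where the square of
  \<open>(L / t) ^ d\<close> integrates to \<open>1 / (2 * d)\<close> against dt/t.\<close>

definition dom_const :: "nat \<Rightarrow> real \<Rightarrow> real \<Rightarrow> real \<Rightarrow> real" where
  "dom_const d \<alpha> C CT = step_const d \<alpha> C CT + C\<^sup>2 / (2 * real d)"

context square_kernel_grid
begin

lemma step_const_nonneg: "0 \<le> step_const CARD('n) \<alpha> C CT"
  using \<alpha> exc_const_pos[OF exc_frac_pos, of "CARD('n)"] unfolding step_const_def
  by (intro mult_nonneg_nonneg add_nonneg_nonneg) (auto simp: less_imp_le)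

lemma dom_const_pos: "0 < dom_const CARD('n) \<alpha> C CT"
  using step_const_nonneg C unfolding dom_const_def by (intro add_nonneg_pos) auto

lemma measurable_sqfun_sq [measurable]:
  assumes [measurable]: "f \<in> borel_measurable borel"
  shows "sqfun_sq k f \<in> borel_measurable borel"
  unfolding sqfun_sq_def by measurable

lemma idx_0_iff: "x \<in> cell 0 0 \<longleftrightarrow> x \<in> cube a L"
  unfolding cell_eq_cube by (simp add: side_def cube_def)

text \<open>The kernel is at most \<open>C * t powr - d\<close>, so \<open>theta\<close> sees only
  the total mass of \<open>f\<close> and decays like \<open>(L / t) ^ d\<close>. The top cell of the
  sparse family will absorb this term.\<close>

lemma large_t_bound:
  assumes f: "integrable lborel f" and supp: "\<And>y. y \<notin> cell 0 0 \<Longrightarrow> f y = 0"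
  shows "energy f {L..} x \<le> ennreal (C\<^sup>2 / (2 * real CARD('n)) * (tri_mean f 0 0)\<^sup>2)"
proof -
  note [measurable] = borel_measurable_integrable[OF f]
  have supp': "f y = 0" if "y \<notin> tri 0 0" for y using supp cell_subset_tri that by blast
  let ?\<nu> = "tri_mean f 0 0"
  have mass: "(\<integral>\<^sup>+ y. ennreal \<bar>f y\<bar> \<partial>lborel) = ennreal (?\<nu> * L ^ CARD('n))"
  proof -
    have "(\<integral>\<^sup>+ y. ennreal \<bar>f y\<bar> \<partial>lborel) = (\<integral>\<^sup>+ y\<in>tri 0 0. ennreal \<bar>f y\<bar> \<partial>lborel)"
      using supp' by (intro nn_integral_cong) (auto simp: indicator_def)
    also have "\<dots> = ennreal (mass f (tri 0 0))" by (rule emeasure_mass[symmetric]) (use f in auto)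
    also have "mass f (tri 0 0) = ?\<nu> * L ^ CARD('n)" using L by (simp add: tri_mean_def side_def)
    finally show ?thesis .
  qed
  have pt: "(theta k t f x)\<^sup>2 \<le> (C * ?\<nu>)\<^sup>2 * (L / t) powr (2 * real CARD('n))" if t: "L \<le> t" for t
  proof -
    have t0: "0 < t" using t L by linarith
    have "ennreal \<bar>theta k t f x\<bar> \<le> (\<integral>\<^sup>+ y. ennreal (C * t powr - real CARD('n)) * ennreal \<bar>f y\<bar> \<partial>lborel)"
    proof (rule order_trans[OF theta_le_nn_integral[OF t0] nn_integral_mono])
      fix y
      have "C * (pk \<alpha> t x y * \<bar>f y\<bar>) \<le> C * (t powr - real CARD('n) * \<bar>f y\<bar>)"
        using C by (intro mult_left_mono mult_right_mono pk_le t0 \<alpha>(1)) auto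
      then show "ennreal (C * (pk \<alpha> t x y * \<bar>f y\<bar>)) \<le> ennreal (C * t powr - real CARD('n)) * ennreal \<bar>f y\<bar>"
        using C by (simp add: ennreal_leI mult.assoc flip: ennreal_mult)
    qed
    also have "\<dots> = ennreal (C * t powr - real CARD('n) * (?\<nu> * L ^ CARD('n)))"
      using C L by (subst nn_integral_cmult) (auto simp: mass ennreal_mult[symmetric])
    also have "C * t powr - real CARD('n) * (?\<nu> * L ^ CARD('n)) = C * ?\<nu> * (L / t) powr real CARD('n)"
      using L t0 by (simp add: powr_divide powr_minus_divide powr_realpow)
    finally have "\<bar>theta k t f x\<bar> \<le> C * ?\<nu> * (L / t) powr real CARD('n)"
      using C by (subst (asm) ennreal_le_iff) auto
    then have "(theta k t f x)\<^sup>2 \<le> (C * ?\<nu> * (L / t) powr real CARD('n))\<^sup>2"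
      by (metis abs_ge_zero power2_abs power_mono)
    also have "\<dots> = (C * ?\<nu>)\<^sup>2 * (L / t) powr (2 * real CARD('n))"
      by (simp add: power_mult_distrib power2_eq_square flip: powr_add)
    finally show ?thesis .
  qed
  have "energy f {L..} x \<le>
    (\<integral>\<^sup>+ t. ennreal ((C * ?\<nu>)\<^sup>2) * (ennreal ((L / t) powr (2 * real CARD('n)) / t) * indicator {L..} t) \<partial>lborel)"
  proof (rule nn_integral_mono)
    fix t :: real
    show "ennreal ((theta k t f x)\<^sup>2 / t) * indicator {L..} t \<le> ennreal ((C * ?\<nu>)\<^sup>2) * (ennreal ((L / t) powr (2 * real CARD('n)) / t) * indicator {L..} t)"
    proof (cases "L \<le> t")
      case True
      then have t0: "0 < t" using L by linarith
      have "(theta k t f x)\<^sup>2 / t \<le> (C * ?\<nu>)\<^sup>2 * (L / t) powr (2 * real CARD('n)) / t"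
        using pt[OF True] t0 by (intro divide_right_mono) auto
      then show ?thesis using True t0 by (simp add: ennreal_leI flip: ennreal_mult)
    qed simp
  qed
  also have "\<dots> \<le> ennreal ((C * ?\<nu>)\<^sup>2) * ennreal (1 / (2 * real CARD('n)))"
    by (subst nn_integral_cmult) (auto intro!: mult_left_mono nn_integral_powr_near_inf L)
  also have "\<dots> = ennreal (C\<^sup>2 / (2 * real CARD('n)) * ?\<nu>\<^sup>2)"
    by (simp add: power_mult_distrib field_simps flip: ennreal_mult)
  finally show ?thesis .
qed

text \<open>A qualitative statement: the sup bound \<open>bf\<close> enters here, but does not reach
  the final constant. It makes \<open>sqfun\<close> meaningful on the support of \<open>g\<close>
  and allows half of a finite integral to be captured by a truncation.\<close>

lemma sqfun_sq_finite:
  assumes f: "integrable lborel f" and fb: "\<And>y. \<bar>f y\<bar> \<le> bf" and supp: "\<And>y. y \<notin> cell 0 0 \<Longrightarrow> f y = 0"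
  shows "(\<integral>\<^sup>+ x\<in>cell 0 0. sqfun_sq k f x \<partial>lborel) < \<infinity>"
proof -
  have fm [measurable]: "f \<in> borel_measurable borel" using f by auto
  have supp': "f y = 0" if "y \<notin> tri 0 0" for y using supp cell_subset_tri that by blast
  have split: "sqfun_sq k f x = energy f {0<..<L} x + energy f {L..} x" for x
  proof -
    have "sqfun_sq k f x = (\<integral>\<^sup>+ t. ennreal ((theta k t f x)\<^sup>2 / t) * indicator {0<..<L} t + ennreal ((theta k t f x)\<^sup>2 / t) * indicator {L..} t \<partial>lborel)"
      unfolding sqfun_sq_def using L by (intro nn_integral_cong) (auto simp: indicator_def)
    also have "\<dots> = energy f {0<..<L} x + energy f {L..} x"
      by (rule nn_integral_add) auto
    finally show ?thesis .
  qed
  have "(\<integral>\<^sup>+ x\<in>cell 0 0. sqfun_sq k f x \<partial>lborel) \<le> 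
    (\<integral>\<^sup>+ x. energy f {0<..<L} x * indicator (cell 0 0) x +
      ennreal (C\<^sup>2 / (2 * real CARD('n)) * (tri_mean f 0 0)\<^sup>2) * indicator (cell 0 0) x \<partial>lborel)"
    unfolding split distrib_right
    by (intro nn_integral_mono add_left_mono mult_right_mono large_t_bound[OF f supp]) auto
  also have "\<dots> = (\<integral>\<^sup>+ x\<in>cell 0 0. energy f {0<..<L} x \<partial>lborel) +
      ennreal (C\<^sup>2 / (2 * real CARD('n)) * (tri_mean f 0 0)\<^sup>2) * emeasure lborel (cell 0 0)"
    by (subst nn_integral_add) (auto simp: nn_integral_cmult_indicator)
  also have "\<dots> \<le> ennreal (good_const CARD('n) \<alpha> C CT * bf\<^sup>2 * side 0 ^ CARD('n)) + ennreal (C\<^sup>2 / (2 * real CARD('n)) * (tri_mean f 0 0)\<^sup>2) * ennreal (side 0 ^ CARD('n))"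
  proof (intro add_mono)
    have "(\<integral>\<^sup>+ x\<in>cell 0 0. energy f {0<..<side 0} x \<partial>lborel) \<le> ennreal (good_const CARD('n) \<alpha> C CT * bf\<^sup>2 * side 0 ^ CARD('n))"
      unfolding cell_eq_cube using supp' fb by (intro good_part_bound) (auto simp: tri_eq_cube)
    then show "(\<integral>\<^sup>+ x\<in>cell 0 0. energy f {0<..<L} x \<partial>lborel) \<le> ennreal (good_const CARD('n) \<alpha> C CT * bf\<^sup>2 * side 0 ^ CARD('n))"
      by (simp add: side_def)
  qed (simp add: emeasure_cell)
  also have "\<dots> < \<infinity>" by (simp add: ennreal_mult_less_top)
  finally show ?thesis .
qed

text \<open>The weight is at least 1, so the plain truncated energy is below the weighted one, and
  the pointwise bound of \<open>sparse_family\<close> can be integrated against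
  \<open>\<bar>g\<bar>\<close>.\<close>

lemma truncated_sparse_bound:
  assumes f: "integrable lborel f" and fb: "\<And>y. \<bar>f y\<bar> \<le> bf" and supp: "\<And>y. y \<notin> cell 0 0 \<Longrightarrow> f y = 0"
    and g: "integrable lborel g" and gsupp: "\<And>y. y \<notin> cell 0 0 \<Longrightarrow> g y = 0"
  obtains S where "finite S" "\<And>p. p \<in> S \<Longrightarrow> cell_of p \<subseteq> cell 0 0"
    "\<And>p. p \<in> S \<Longrightarrow> emeasure lborel (\<Union>q\<in>{q\<in>S. cell_of q \<subset> cell_of p}. cell_of q) \<le> ennreal (side (fst p) ^ CARD('n) / 2)"
    "(\<integral>\<^sup>+ x. ennreal \<bar>g x\<bar> * energy f {side N<..} x \<partial>lborel)
      \<le> ennreal (dom_const CARD('n) \<alpha> C CT) * (\<Sum>p\<in>S. ennreal ((tri_mean f (fst p) (snd p))\<^sup>2 * mass g (cell_of p)))"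
proof -
  have fm [measurable]: "f \<in> borel_measurable borel" using f by auto
  have gm [measurable]: "g \<in> borel_measurable borel" using g by auto
  have supp': "f y = 0" if "y \<notin> tri 0 0" for y using supp cell_subset_tri that by blast
  have restr_f: "restr_tri f 0 0 = f" using supp' by (auto simp: restr_tri_def indicator_def fun_eq_iff)
  let ?\<nu> = "\<lambda>p. tri_mean f (fst p) (snd p)" and ?cell = cell_of
  let ?c = "step_const CARD('n) \<alpha> C CT" and ?c' = "C\<^sup>2 / (2 * real CARD('n))"
  obtain S where S: "finite S" "(0, 0) \<in> S" "\<And>p. p \<in> S \<Longrightarrow> ?cell p \<subseteq> cell 0 0"
    "\<And>p. p \<in> S \<Longrightarrow> emeasure lborel (\<Union>q\<in>{q\<in>S. ?cell q \<subset> ?cell p}. ?cell q) \<le> ennreal (side (fst p) ^ CARD('n) / 2)"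
    "\<And>x. x \<in> cell 0 0 \<Longrightarrow> weighted_energy f N 0 0 x \<le> (\<Sum>p\<in>S. ennreal (?c * (?\<nu> p)\<^sup>2) * indicator (?cell p) x)"
    using sparse_family[OF f fb le0[of N], of 0] by blast
  have c0: "0 \<le> ?c" "0 \<le> ?c'" using step_const_nonneg by auto
  have pt: "energy f {side N<..} x \<le> ennreal (dom_const CARD('n) \<alpha> C CT) * (\<Sum>p\<in>S. ennreal ((?\<nu> p)\<^sup>2) * indicator (?cell p) x)"
    if x: "x \<in> cell 0 0" for x
  proof -
    have "energy f {side N<..} x \<le> 
      (\<integral>\<^sup>+ t. ennreal ((theta k t f x)\<^sup>2 / t) * indicator {side N<..<side 0} t + ennreal ((theta k t f x)\<^sup>2 / t) * indicator {L..} t \<partial>lborel)"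
      by (intro nn_integral_mono) (auto simp: indicator_def side_def)
    also have "\<dots> = energy f {side N<..<side 0} x + energy f {L..} x"
      by (rule nn_integral_add) auto
    also have "energy f {side N<..<side 0} x \<le> weighted_energy f N 0 0 x"
      unfolding weighted_energy_def restr_f
    proof (intro nn_integral_mono)
      fix t :: real
      show "ennreal ((theta k t f x)\<^sup>2 / t) * indicator {side N<..<side 0} t \<le> 
        ennreal (exp (weight_rate \<alpha> * (t / side 0) powr \<alpha>) * (theta k t f x)\<^sup>2 / t) * indicator {side N<..<side 0} t"
      proof (cases "side N < t")
        case True
        then have t0: "0 < t" using side_pos[of N] by linarith
        have "1 * (theta k t f x)\<^sup>2 \<le> exp (weight_rate \<alpha> * (t / side 0) powr \<alpha>) * (theta k t f x)\<^sup>2"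
          using weight_rate_pos[OF \<alpha>(1)] by (intro mult_right_mono) (auto simp: less_imp_le)
        then have "(theta k t f x)\<^sup>2 / t \<le> exp (weight_rate \<alpha> * (t / side 0) powr \<alpha>) * (theta k t f x)\<^sup>2 / t"
          using t0 by (intro divide_right_mono) auto
        then show ?thesis by (intro mult_right_mono ennreal_leI) auto
      qed simp
    qed
    also have "weighted_energy f N 0 0 x \<le> (\<Sum>p\<in>S. ennreal (?c * (?\<nu> p)\<^sup>2) * indicator (?cell p) x)" by (rule S(5)[OF x])
    also have "energy f {L..} x \<le> ennreal (?c' * (tri_mean f 0 0)\<^sup>2)"
      by (rule large_t_bound[OF f supp])
    \<comment> \<open>The pair \<open>(0, 0)\<close> belongs to \<open>S\<close>, and its term pays
      for the large scales.\<close>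
    also have "ennreal (?c' * (tri_mean f 0 0)\<^sup>2) \<le> ennreal ?c' * (\<Sum>p\<in>S. ennreal ((?\<nu> p)\<^sup>2) * indicator (?cell p) x)"
    proof -
      have "ennreal ((tri_mean f 0 0)\<^sup>2) = ennreal ((?\<nu> (0, 0))\<^sup>2) * indicator (?cell (0, 0)) x" using x by simp
      also have "\<dots> \<le> (\<Sum>p\<in>S. ennreal ((?\<nu> p)\<^sup>2) * indicator (?cell p) x)" 
        using S(1,2) by (intro member_le_sum) auto
      finally show ?thesis using c0 by (subst ennreal_mult) (auto intro: mult_left_mono)
    qed
    also have "(\<Sum>p\<in>S. ennreal (?c * (?\<nu> p)\<^sup>2) * indicator (?cell p) x) = ennreal ?c * (\<Sum>p\<in>S. ennreal ((?\<nu> p)\<^sup>2) * indicator (?cell p) x)"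
      using c0 by (simp add: sum_distrib_left ennreal_mult mult.assoc)
    finally show ?thesis
      using c0 by (simp add: dom_const_def ennreal_plus distrib_right add_mono)
  qed
  have "(\<integral>\<^sup>+ x. ennreal \<bar>g x\<bar> * energy f {side N<..} x \<partial>lborel) \<le>
    (\<integral>\<^sup>+ x. ennreal (dom_const CARD('n) \<alpha> C CT) * (\<Sum>p\<in>S. ennreal ((?\<nu> p)\<^sup>2) * (ennreal \<bar>g x\<bar> * indicator (?cell p) x)) \<partial>lborel)"
  proof (rule nn_integral_mono)
    fix x
    show "ennreal \<bar>g x\<bar> * energy f {side N<..} x \<le> 
      ennreal (dom_const CARD('n) \<alpha> C CT) * (\<Sum>p\<in>S. ennreal ((?\<nu> p)\<^sup>2) * (ennreal \<bar>g x\<bar> * indicator (?cell p) x))"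
    proof (cases "x \<in> cell 0 0")
      case True
      have "ennreal \<bar>g x\<bar> * energy f {side N<..} x \<le> 
        ennreal \<bar>g x\<bar> * (ennreal (dom_const CARD('n) \<alpha> C CT) * (\<Sum>p\<in>S. ennreal ((?\<nu> p)\<^sup>2) * indicator (?cell p) x))"
        by (intro mult_left_mono pt True) auto
      also have "\<dots> = ennreal (dom_const CARD('n) \<alpha> C CT) * (\<Sum>p\<in>S. ennreal ((?\<nu> p)\<^sup>2) * (ennreal \<bar>g x\<bar> * indicator (?cell p) x))"
        unfolding sum_distrib_left by (intro sum.cong refl) (simp only: mult_ac)
      finally show ?thesis .
    qed (simp add: gsupp)
  qed
  also have "\<dots> = ennreal (dom_const CARD('n) \<alpha> C CT) * (\<Sum>p\<in>S. ennreal ((?\<nu> p)\<^sup>2 * mass g (?cell p)))"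
    by (simp add: nn_integral_cmult nn_integral_sum emeasure_mass[OF g] ennreal_mult)
  finally show thesis using S by (intro that[of S]) auto
qed

lemma avg_tri:
  assumes "integrable lborel f"
  shows "avg f (tri m n) = mass f (tri m n) / (3 * side m) ^ CARD('n)"
  using emeasure_tri[of m n] by (simp add: avg_def mass_eq_integral[OF assms] measure_def)

lemma sparse_domination:
  fixes f g :: "real^'n \<Rightarrow> real"
  assumes f: "integrable lborel f" and fb: "\<And>y. \<bar>f y\<bar> \<le> bf" and supp: "\<And>y. y \<notin> cell 0 0 \<Longrightarrow> f y = 0"
    and g: "integrable lborel g" and gb: "\<And>y. \<bar>g y\<bar> \<le> bg" and gsupp: "\<And>y. y \<notin> cell 0 0 \<Longrightarrow> g y = 0"
  defines "W \<equiv> (\<integral>\<^sup>+ x. ennreal \<bar>g x\<bar> * sqfun_sq k f x \<partial>lborel)"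
  shows "W < \<infinity>" 
    and "\<exists>D S. dyadic_lattice D \<and> S \<subseteq> D \<and> sparse (1 / (2 * 3 ^ CARD('n))) S \<and>
       W \<le> ennreal (2 * 27 ^ CARD('n) * dom_const CARD('n) \<alpha> C CT) * (\<integral>\<^sup>+ Q. ennreal ((avg f Q)\<^sup>2 * avg g Q * measure lborel Q) \<partial>count_space S)"
proof -
  have fm [measurable]: "f \<in> borel_measurable borel" using f by auto
  have gm [measurable]: "g \<in> borel_measurable borel" using g by auto
  have bg: "0 \<le> bg" using gb[of undefined] by linarith
  let ?d = "CARD('n)"
  let ?\<nu> = "\<lambda>p. tri_mean f (fst p) (snd p)" and ?cell = cell_of and ?tri = "\<lambda>p. tri_of p"
  have "W \<le> (\<integral>\<^sup>+ x. ennreal bg * (sqfun_sq k f x * indicator (cell 0 0) x) \<partial>lborel)"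
    unfolding W_def
  proof (rule nn_integral_mono)
    fix x
    show "ennreal \<bar>g x\<bar> * sqfun_sq k f x \<le> ennreal bg * (sqfun_sq k f x * indicator (cell 0 0) x)"
      using gb[of x] gsupp[of x] by (cases "x \<in> cell 0 0") (auto intro!: mult_right_mono ennreal_leI)
  qed
  also have "\<dots> = ennreal bg * (\<integral>\<^sup>+ x\<in>cell 0 0. sqfun_sq k f x \<partial>lborel)" by (rule nn_integral_cmult) measurable
  also have "\<dots> < \<infinity>" using sqfun_sq_finite[OF f fb supp] by (simp add: ennreal_mult_less_top)
  finally show Wfin: "W < \<infinity>" .
  show "\<exists>D S. dyadic_lattice D \<and> S \<subseteq> D \<and> sparse (1 / (2 * 3 ^ ?d)) S \<and>
       W \<le> ennreal (2 * 27 ^ ?d * dom_const ?d \<alpha> C CT) * (\<integral>\<^sup>+ Q. ennreal ((avg f Q)\<^sup>2 * avg g Q * measure lborel Q) \<partial>count_space S)"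
  \<comment> \<open>For \<open>W = 0\<close> the empty family serves; otherwise \<open>W\<close> is
    finite and positive, so \<open>W / 2 < W\<close> and some truncation satisfies
    \<open>V N > W / 2\<close>.\<close>
  proof (cases "W = 0")
    case True
    obtain D :: "(real^'n) set set" where "dyadic_lattice D" by (rule dyadic_lattice_exists[OF L, of a]) blast
    moreover have "sparse (1 / (2 * 3 ^ ?d)) ({} :: (real^'n) set set)"
      by (simp add: sparse_def disjoint_family_on_def)
    ultimately show ?thesis
      by (rule_tac x = D in exI, rule_tac x = "{}" in exI) (simp add: True)
  next
    case False
    define V where "V N = (\<integral>\<^sup>+ x. ennreal \<bar>g x\<bar> * energy f {side N<..} x \<partial>lborel)" for N
    have "W = (SUP N. V N)"
    proof -
      have mono_s: "side n < t" if "m \<le> n" "side m < t" for m n t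
        using side_antimono[OF that(1)] that(2) by linarith
      have mono_t: "incseq (\<lambda>N t. ennreal ((theta k t f x)\<^sup>2 / t) * indicator {side N<..} t)" for x
        by (auto simp: incseq_def le_fun_def indicator_def dest: mono_s)
      have sq: "sqfun_sq k f x = (SUP N. energy f {side N<..} x)" for x
      proof -
        have "sqfun_sq k f x = (\<integral>\<^sup>+ t. (SUP N. ennreal ((theta k t f x)\<^sup>2 / t) * indicator {side N<..} t) \<partial>lborel)"
          unfolding sqfun_sq_def
        proof (rule nn_integral_cong)
          fix t :: real
          show "ennreal ((theta k t f x)\<^sup>2 / t) * indicator {0<..} t = (SUP N. ennreal ((theta k t f x)\<^sup>2 / t) * indicator {side N<..} t)"
          proof (cases "0 < t")
            case True
            obtain N where N: "side N < t"
            proof -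
              obtain N :: nat where "L / t < 2 ^ N" using real_arch_pow[of 2 "L / t"] by auto
              then have "side N < t" using True by (simp add: side_def field_simps)
              then show thesis by (rule that)
            qed
            show ?thesis
            proof (rule antisym)
              show "ennreal ((theta k t f x)\<^sup>2 / t) * indicator {0<..} t \<le> (SUP N. ennreal ((theta k t f x)\<^sup>2 / t) * indicator {side N<..} t)"
                using N True by (intro SUP_upper2[of N]) auto
            qed (use True in \<open>auto intro!: SUP_least simp: indicator_def\<close>)
          next
            case False
            then have "\<not> side N < t" for N using side_pos[of N] by linarith
            then show ?thesis using False by simp
          qed
        qed
        also have "\<dots> = (SUP N. energy f {side N<..} x)"
          by (rule nn_integral_monotone_convergence_SUP[OF mono_t]) measurable
        finally show ?thesis .
      qed
      have "W = (\<integral>\<^sup>+ x. (SUP N. ennreal \<bar>g x\<bar> * energy f {side N<..} x) \<partial>lborel)"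
        unfolding W_def sq by (simp add: SUP_mult_left_ennreal)
      also have "\<dots> = (SUP N. V N)"
        unfolding V_def
      proof (rule nn_integral_monotone_convergence_SUP)
        show "incseq (\<lambda>N x. ennreal \<bar>g x\<bar> * energy f {side N<..} x)"
          unfolding incseq_def le_fun_def
          by (intro allI impI mult_left_mono nn_integral_mono) (auto simp: indicator_def dest: mono_s)
      qed measurable
      finally show ?thesis .
    qed
    moreover obtain r where r: "W = ennreal r" "0 < r"
    proof -
      obtain r where r: "W = ennreal r" "0 \<le> r" using Wfin by (cases W) auto
      moreover have "r \<noteq> 0" using False r by auto
      ultimately show thesis by (intro that[of r]) auto
    qed
    then have "ennreal (r / 2) < W" by (simp add: ennreal_less_iff)
    ultimately obtain N where N: "ennreal (r / 2) < V N" by (auto simp: less_SUP_iff)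
    have W_half: "W = 2 * ennreal (r / 2)"
      using r ennreal_mult[of 2 "r / 2"] by simp
    obtain S where S: "finite S" "\<And>p. p \<in> S \<Longrightarrow> ?cell p \<subseteq> cell 0 0"
      "\<And>p. p \<in> S \<Longrightarrow> emeasure lborel (\<Union>q\<in>{q\<in>S. ?cell q \<subset> ?cell p}. ?cell q) \<le> ennreal (side (fst p) ^ ?d / 2)"
      "V N \<le> ennreal (dom_const ?d \<alpha> C CT) * (\<Sum>p\<in>S. ennreal ((?\<nu> p)\<^sup>2 * mass g (?cell p)))"
      using truncated_sparse_bound[OF f fb supp g gsupp, of N] unfolding V_def by blast
    define w where "w p = (avg f (?tri p))\<^sup>2 * avg g (?tri p) * measure lborel (?tri p)" for p
    have avg0: "0 \<le> avg u X" for u and X :: "(real^'n) set"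
      unfolding avg_def set_lebesgue_integral_def by (intro divide_nonneg_nonneg Bochner_Integration.integral_nonneg) auto
    have w0: "0 \<le> w p" for p unfolding w_def using avg0 by (intro mult_nonneg_nonneg) auto
    \<comment> \<open>\<open>tri_mean\<close> is \<open>3 ^ d\<close> times the average over the
      dilate, whence \<open>9 ^ d\<close>; the mass of \<open>g\<close> on the cell is enlarged to
      the dilate, so that all averages are over the same cube.\<close>
    have le_w: "(?\<nu> p)\<^sup>2 * mass g (?cell p) \<le> 9 ^ ?d * w p" for p
    proof -
      have tri_mean: "?\<nu> p = 3 ^ ?d * avg f (?tri p)"
        by (simp add: avg_tri[OF f] tri_mean_def power_mult_distrib)
      have "mass g (?cell p) \<le> mass g (?tri p)" by (intro mass_mono g cell_subset_tri) auto
      also have "\<dots> = avg g (?tri p) * measure lborel (?tri p)"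
        using emeasure_tri[of "fst p" "snd p"] by (simp add: avg_tri[OF g] measure_def power_mult_distrib)
      finally have "(?\<nu> p)\<^sup>2 * mass g (?cell p) \<le> (?\<nu> p)\<^sup>2 * (avg g (?tri p) * measure lborel (?tri p))"
        by (intro mult_left_mono) auto
      also have "\<dots> = (3 ^ ?d * 3 ^ ?d) * w p" unfolding tri_mean w_def by (simp add: power2_eq_square mult_ac)
      also have "(3::real) ^ ?d * 3 ^ ?d = 9 ^ ?d" by (simp flip: power_mult_distrib)
      finally show ?thesis .
    qed
    \<comment> \<open>The vectors with entries -3, -2 or -1, described as the neighbours of the
      constant vector -2 so that \<open>card_neighbours\<close> counts them.\<close>
    define Col where "Col = {c :: int^'n. \<forall>i. \<bar>c $ i - (\<chi> i. -2) $ i\<bar> \<le> 1}"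
    have Col: "finite Col" "real (card Col) = 3 ^ ?d"
      unfolding Col_def using finite_neighbours card_neighbours by blast+
    define base where "base c = (\<chi> i. a $ i + L * of_int (c $ i))" for c :: "int^'n"
    define corner where "corner p = (\<chi> i. (\<chi> i. a $ i + side (fst p) * of_int (snd p $ i)) $ i - side (fst p))" for p :: "nat \<times> (int^'n)"
    have tri_corner: "?tri p = cube (corner p) (3 * side (fst p))" for p
      unfolding corner_def by (rule tri_eq_cube)
    have "\<forall>p\<in>S. \<exists>c. c \<in> Col \<and> subcube (base c) (6 * L) (corner p) (3 * side (fst p))"
      using tri_subcube[OF S(2)] unfolding Col_def base_def corner_def by blast
    then obtain col where col: "\<And>p. p \<in> S \<Longrightarrow> col p \<in> Col \<and> subcube (base (col p)) (6 * L) (corner p) (3 * side (fst p))"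
      by metis
    define Sc where "Sc c = {p \<in> S. col p = c}" for c
    have Sc: "Sc c \<subseteq> S" "finite (Sc c)" for c using S(1) by (auto simp: Sc_def)
    define R where "R c = (\<Sum>p\<in>Sc c. w p)" for c
    have R0: "0 \<le> R c" for c unfolding R_def by (intro sum_nonneg w0)
    have Colne: "Col \<noteq> {}" using Col by auto
    \<comment> \<open>The class with the largest sum; it carries at least the share
      \<open>1 / 3 ^ d\<close> of the total.\<close>
    obtain c where c: "c \<in> Col" "\<And>c'. c' \<in> Col \<Longrightarrow> R c' \<le> R c"
    proof -
      have "Max (R ` Col) \<in> R ` Col" using Col(1) Colne by (intro Max_in) auto
      then obtain c where "c \<in> Col" "R c = Max (R ` Col)" by force
      then show thesis using Col(1) by (intro that[of c]) auto
    qed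
    have total: "(\<Sum>p\<in>S. w p) \<le> 3 ^ ?d * R c"
    proof -
      have "(\<Sum>p\<in>S. w p) = (\<Sum>c'\<in>Col. R c')"
        unfolding R_def Sc_def using S(1) Col(1) col by (intro sum.group[symmetric]) auto
      also have "\<dots> \<le> real (card Col) * R c" by (rule sum_bounded_above) (rule c(2))
      finally show ?thesis by (simp add: Col)
    qed
    obtain D where D: "dyadic_lattice D" "\<And>b s. subcube (base c) (6 * L) b s \<Longrightarrow> cube b s \<in> D"
      by (rule dyadic_lattice_exists[of "6 * L" "base c"]) (use L in simp, blast)
    define T where "T = ?tri ` Sc c"
    have inj: "inj_on ?tri (Sc c)" using tri_inject by (auto simp: inj_on_def prod_eq_iff)
    have TD: "T \<subseteq> D"
    proof
      fix Q assume "Q \<in> T"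
      then obtain p where p: "p \<in> Sc c" "Q = ?tri p" by (auto simp: T_def)
      then show "Q \<in> D" using col[of p] D(2) by (auto simp: Sc_def tri_corner)
    qed
    have sp: "sparse (1 / (2 * 3 ^ ?d)) T"
    proof -
      \<comment> \<open>The disjoint sets come from the cells and not from the overlapping dilates.
        Smaller members of all of \<open>S\<close> are removed, so the packing bound applies as it
        stands; disjointness holds because intersecting cells are nested.\<close>
      define E0 where "E0 p = ?cell p - (\<Union>q\<in>{q\<in>S. ?cell q \<subset> ?cell p}. ?cell q)" for p
      have E0m: "E0 p \<in> sets borel" for p unfolding E0_def using S(1) by (intro sets.Diff sets.finite_UN) auto
      have E0_disj: "E0 p \<inter> E0 q = {}" if "p \<in> S" "q \<in> S" "p \<noteq> q" for p q
      proof (cases "?cell p \<inter> ?cell q = {}")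
        case False
        then have "?cell p \<subset> ?cell q \<or> ?cell q \<subset> ?cell p" using that by (intro cells_nested) (auto simp: prod_eq_iff)
        then show ?thesis using that unfolding E0_def by blast
      qed (auto simp: E0_def)
      have E0_meas: "side (fst p) ^ ?d / 2 \<le> measure lborel (E0 p)" if p: "p \<in> S" for p
      proof -
        let ?U = "\<Union>q\<in>{q\<in>S. ?cell q \<subset> ?cell p}. ?cell q"
        have Um: "?U \<in> sets borel" using S(1) by (intro sets.finite_UN) auto
        have U: "measure lborel ?U \<le> side (fst p) ^ ?d / 2"
          unfolding measure_def by (rule enn2real_leI[OF _ S(3)[OF p]]) simp
        have "measure lborel (E0 p) = measure lborel (?cell p) - measure lborel ?U"
          unfolding E0_def using Um by (intro measure_Diff) (auto simp: emeasure_cell)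
        then show ?thesis using U by (simp add: measure_cell)
      qed
      \<comment> \<open>Sparseness is stated for the dilates as sets, so the index is recovered by
        injectivity.\<close>
      define E where "E Q = E0 (inv_into (Sc c) ?tri Q)" for Q
      have E_tri: "E (?tri p) = E0 p" if "p \<in> Sc c" for p
        unfolding E_def using inv_into_f_f[OF inj that] by simp
      show ?thesis unfolding sparse_def
      proof (intro exI[of _ E] conjI ballI)
        fix Q assume "Q \<in> T"
        then obtain p where p: "p \<in> Sc c" "Q = ?tri p" by (auto simp: T_def)
        have EQ: "E Q = E0 p" using E_tri p by simp
        have pS: "p \<in> S" using p Sc by blast
        have "E0 p \<subseteq> ?tri p" unfolding E0_def using cell_subset_tri[of "fst p" "snd p"] by blast
        then show "E Q \<subseteq> Q" using EQ p(2) by simp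
        show "E Q \<in> sets lebesgue" unfolding EQ using E0m[of p] by auto
        have "measure lebesgue Q = (3 * side (fst p)) ^ ?d"
          unfolding p(2) using emeasure_tri[of "fst p" "snd p"] by (simp add: measure_completion measure_def)
        \<comment> \<open>Half of a cell is the share \<open>1 / (2 * 3 ^ d)\<close> of its
          dilate.\<close>
        then have "1 / (2 * 3 ^ ?d) * measure lebesgue Q = side (fst p) ^ ?d / 2"
          by (simp add: power_mult_distrib)
        also have "\<dots> \<le> measure lborel (E0 p)" by (rule E0_meas[OF pS])
        also have "\<dots> = measure lebesgue (E Q)" unfolding EQ using E0m[of p] by (simp add: measure_completion)
        finally show "1 / (2 * 3 ^ ?d) * measure lebesgue Q \<le> measure lebesgue (E Q)" .
      next
        show "disjoint_family_on E T"
          unfolding disjoint_family_on_def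
        proof (intro ballI impI)
          fix Q Q' assume "Q \<in> T" "Q' \<in> T" "Q \<noteq> Q'"
          then obtain p q where "p \<in> Sc c" "Q = ?tri p" "q \<in> Sc c" "Q' = ?tri q" "p \<noteq> q" by (auto simp: T_def)
          then show "E Q \<inter> E Q' = {}" using E_tri E0_disj Sc(1) by (metis subsetD)
        qed
      qed
    qed
    have sumT: "(\<integral>\<^sup>+ Q. ennreal ((avg f Q)\<^sup>2 * avg g Q * measure lborel Q) \<partial>count_space T) = ennreal (R c)"
    proof -
      have "(\<integral>\<^sup>+ Q. ennreal ((avg f Q)\<^sup>2 * avg g Q * measure lborel Q) \<partial>count_space T) = (\<Sum>Q\<in>T. ennreal ((avg f Q)\<^sup>2 * avg g Q * measure lborel Q))"
        using Sc(2) by (intro nn_integral_count_space_finite) (simp add: T_def)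
      also have "\<dots> = (\<Sum>p\<in>Sc c. ennreal (w p))" unfolding T_def sum.reindex[OF inj] by (simp add: w_def)
      also have "\<dots> = ennreal (R c)" unfolding R_def using w0 by (intro sum_ennreal) auto
      finally show ?thesis .
    qed
    have Cf: "0 \<le> dom_const ?d \<alpha> C CT" using dom_const_pos by (rule less_imp_le)
    have "(\<Sum>p\<in>S. ennreal ((?\<nu> p)\<^sup>2 * mass g (?cell p))) \<le> (\<Sum>p\<in>S. ennreal (9 ^ ?d * w p))"
      by (intro sum_mono ennreal_leI le_w)
    also have "\<dots> = ennreal (9 ^ ?d * (\<Sum>p\<in>S. w p))"
      using w0 by (subst sum_ennreal) (auto simp: sum_distrib_left)
    also have "\<dots> \<le> ennreal (9 ^ ?d * (3 ^ ?d * R c))" by (intro ennreal_leI mult_left_mono total) auto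
    finally have "V N \<le> ennreal (dom_const ?d \<alpha> C CT) * ennreal (9 ^ ?d * (3 ^ ?d * R c))"
      using S(4) by (meson mult_left_mono order_trans zero_le)
    moreover have "W \<le> 2 * V N" unfolding W_half using N by (intro mult_left_mono) auto
    ultimately have "W \<le> 2 * (ennreal (dom_const ?d \<alpha> C CT) * ennreal (9 ^ ?d * (3 ^ ?d * R c)))"
      by (meson mult_left_mono order_trans zero_le)
    also have "\<dots> = ennreal (2 * (dom_const ?d \<alpha> C CT * (9 ^ ?d * (3 ^ ?d * R c))))"
      using Cf R0[of c] by (simp add: ennreal_mult)
    also have "2 * (dom_const ?d \<alpha> C CT * (9 ^ ?d * (3 ^ ?d * R c))) = (2 * 27 ^ ?d * dom_const ?d \<alpha> C CT) * R c"
    proof -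
      have "(9::real) ^ ?d * 3 ^ ?d = 27 ^ ?d" by (simp flip: power_mult_distrib)
      then show ?thesis by (simp add: mult_ac)
    qed
    also have "ennreal \<dots> = ennreal (2 * 27 ^ ?d * dom_const ?d \<alpha> C CT) * ennreal (R c)"
      using Cf R0[of c] by (intro ennreal_mult) auto
    finally have "W \<le> ennreal (2 * 27 ^ ?d * dom_const ?d \<alpha> C CT) * (\<integral>\<^sup>+ Q. ennreal ((avg f Q)\<^sup>2 * avg g Q * measure lborel Q) \<partial>count_space T)"
      unfolding sumT .
    then show ?thesis using D(1) TD sp by blast
  qed
qed

end

lemma Linfty_cpt_props:
  assumes "Linfty_cpt f"
  shows "integrable lborel f" "\<exists>b. \<forall>y. \<bar>f y\<bar> \<le> b" "\<exists>R. \<forall>y. f y \<noteq> 0 \<longrightarrow> norm y \<le> R"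
proof -
  obtain b K where fm: "f \<in> borel_measurable lborel" and b: "\<And>x. \<bar>f x\<bar> \<le> b" and K: "compact K" "\<And>x. x \<notin> K \<Longrightarrow> f x = 0"
    using assms by (auto simp: Linfty_cpt_def)
  have "emeasure lborel K < \<infinity>" using K by (intro emeasure_bounded_finite compact_imp_bounded)
  then have "integrable lborel (indicator K :: _ \<Rightarrow> real)" using K by (intro integrable_real_indicator) (auto intro: borel_compact)
  then show "integrable lborel f"
  proof (rule Bochner_Integration.integrable_bound[OF integrable_mult_right[of b]])
    show "AE x in lborel. norm (f x) \<le> norm (b * indicator K x)"
      using b K(2) order_trans[OF b abs_ge_self] by (auto simp: indicator_def)
  qed (rule fm)
  show "\<exists>b. \<forall>y. \<bar>f y\<bar> \<le> b" using b by blast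
  show "\<exists>R. \<forall>y. f y \<noteq> 0 \<longrightarrow> norm y \<le> R"
    using compact_imp_bounded[OF K(1)] K(2) by (auto simp: bounded_iff)
qed

theorem theorem1p1:
  fixes \<alpha> C CT :: real
  assumes "0 < \<alpha>" and "\<alpha> \<le> 1" and "C > 0" and "CT > 0"
  shows "\<exists>\<tau> C'. 0 < \<tau> \<and> \<tau> < 1 \<and> C' > 0 \<and>
    (\<forall>k :: real \<Rightarrow> real^'n \<Rightarrow> real^'n \<Rightarrow> real.
       kernel_cond \<alpha> C k \<longrightarrow> testing_cond CT k \<longrightarrow>
       (\<forall>f g. Linfty_cpt f \<longrightarrow> Linfty_cpt g \<longrightarrow>
          (\<exists>D S. dyadic_lattice D \<and> S \<subseteq> D \<and> sparse \<tau> S \<and>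
             (AE x in lborel. g x \<noteq> 0 \<longrightarrow> sqfun_sq k f x < \<infinity>) \<and>
             integrable lborel (\<lambda>x. (sqfun k f x)\<^sup>2 * g x) \<and>
             ennreal \<bar>LINT x|lborel. (sqfun k f x)\<^sup>2 * g x\<bar> \<le>
               ennreal C' * (\<integral>\<^sup>+ Q. ennreal ((avg f Q)\<^sup>2 * avg g Q * measure lborel Q)
                               \<partial>count_space S))))"
proof -
  let ?d = "CARD('n)"
  \<comment> \<open>\<open>dom_const_pos\<close> is available only once a kernel is fixed; the
    maximum with 1 makes the constant positive beforehand.\<close>
  let ?\<tau> = "1 / (2 * 3 ^ ?d) :: real" and ?C' = "max 1 (2 * 27 ^ ?d * dom_const ?d \<alpha> C CT)"
  show ?thesis
  proof (rule exI[of _ ?\<tau>], rule exI[of _ ?C'], intro conjI allI impI)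
    have "1 * 1 < 2 * (3::real) ^ ?d" by (intro mult_strict_mono') auto
    then show "0 < ?\<tau>" "?\<tau> < 1" by auto
    show "0 < ?C'" by simp
    fix k :: "real \<Rightarrow> real^'n \<Rightarrow> real^'n \<Rightarrow> real" and f g :: "real^'n \<Rightarrow> real"
    assume k: "kernel_cond \<alpha> C k" "testing_cond CT k" and fg: "Linfty_cpt f" "Linfty_cpt g"
    obtain bf Rf where f: "\<And>y. \<bar>f y\<bar> \<le> bf" "\<And>y. f y \<noteq> 0 \<Longrightarrow> norm y \<le> Rf" using Linfty_cpt_props(2,3)[OF fg(1)] by blast
    obtain bg Rg where g: "\<And>y. \<bar>g y\<bar> \<le> bg" "\<And>y. g y \<noteq> 0 \<Longrightarrow> norm y \<le> Rg" using Linfty_cpt_props(2,3)[OF fg(2)] by blast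
    note fi = Linfty_cpt_props(1)[OF fg(1)] and gi = Linfty_cpt_props(1)[OF fg(2)]
    \<comment> \<open>The top cell of the grid is to contain the supports of both functions; the
      summand 1 keeps them strictly inside the half-open cube.\<close>
    define R where "R = 1 + max 0 (max Rf Rg)"
    have R: "0 < R" "Rf < R" "Rg < R" by (auto simp: R_def)
    interpret square_kernel_grid k \<alpha> C CT "\<chi> i. - R" "2 * R"
      using assms k R by unfold_locales auto
    have in_cell: "y \<in> cell 0 0" if "norm y < R" for y :: "real^'n"
      unfolding idx_0_iff cube_def mem_Collect_eq
    proof
      fix i
      have "\<bar>y $ i\<bar> < R" using component_le_norm_cart[of y i] that by linarith
      then show "(\<chi> i. - R) $ i \<le> y $ i \<and> y $ i < (\<chi> i. - R) $ i + 2 * R" by auto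
    qed
    have fs: "f y = 0" if "y \<notin> cell 0 0" for y using f(2)[of y] in_cell[of y] R that by force
    have gs: "g y = 0" if "y \<notin> cell 0 0" for y using g(2)[of y] in_cell[of y] R that by force
    have [measurable]: "f \<in> borel_measurable borel" "g \<in> borel_measurable borel" using fi gi by auto
    let ?W = "\<integral>\<^sup>+ x. ennreal \<bar>g x\<bar> * sqfun_sq k f x \<partial>lborel"
    note dom = sparse_domination[OF fi f(1) fs gi g(1) gs]
    obtain D S where DS: "dyadic_lattice D" "S \<subseteq> D" "sparse ?\<tau> S"
      "?W \<le> ennreal (2 * 27 ^ ?d * dom_const ?d \<alpha> C CT) * (\<integral>\<^sup>+ Q. ennreal ((avg f Q)\<^sup>2 * avg g Q * measure lborel Q) \<partial>count_space S)"
      using dom(2) by blast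
    have sq: "(sqfun k f x)\<^sup>2 = enn2real (sqfun_sq k f x)" for x
      by (simp add: sqfun_def)
    have sqm [measurable]: "(\<lambda>x. (sqfun k f x)\<^sup>2) \<in> borel_measurable borel" unfolding sq by measurable
    have AE: "AE x in lborel. g x \<noteq> 0 \<longrightarrow> sqfun_sq k f x < \<infinity>"
    proof -
      have "AE x in lborel. sqfun_sq k f x * indicator (cell 0 0) x \<noteq> \<infinity>"
        using sqfun_sq_finite[OF fi f(1) fs] by (intro nn_integral_PInf_AE) auto
      then show ?thesis
      proof eventually_elim
        case (elim x)
        then show ?case using gs[of x] by (cases "x \<in> cell 0 0") (auto simp: less_top)
      qed
    qed
    \<comment> \<open>\<open>enn2real\<close> sends infinity to 0, so the real integrand is
      dominated by the extended one and not simply equal to it.\<close>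
    have normW: "(\<integral>\<^sup>+ x. ennreal (norm ((sqfun k f x)\<^sup>2 * g x)) \<partial>lborel) \<le> ?W"
    proof (rule nn_integral_mono)
      fix x
      have "ennreal (norm ((sqfun k f x)\<^sup>2 * g x)) = ennreal (enn2real (sqfun_sq k f x)) * ennreal \<bar>g x\<bar>"
        unfolding sq by (simp add: abs_mult ennreal_mult)
      also have "\<dots> \<le> sqfun_sq k f x * ennreal \<bar>g x\<bar>"
        by (intro mult_right_mono) (cases "sqfun_sq k f x", auto)
      finally show "ennreal (norm ((sqfun k f x)\<^sup>2 * g x)) \<le> ennreal \<bar>g x\<bar> * sqfun_sq k f x" by (simp add: mult.commute)
    qed
    have int: "integrable lborel (\<lambda>x. (sqfun k f x)\<^sup>2 * g x)"
      using le_less_trans[OF normW dom(1)] by (intro integrableI_bounded) auto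
    have "ennreal \<bar>LINT x|lborel. (sqfun k f x)\<^sup>2 * g x\<bar> \<le> (\<integral>\<^sup>+ x. ennreal (norm ((sqfun k f x)\<^sup>2 * g x)) \<partial>lborel)"
      using integral_norm_bound_ennreal[OF int] by simp
    also have "\<dots> \<le> ?W" by (rule normW)
    also have "\<dots> \<le> ennreal ?C' * (\<integral>\<^sup>+ Q. ennreal ((avg f Q)\<^sup>2 * avg g Q * measure lborel Q) \<partial>count_space S)"
      by (rule order_trans[OF DS(4)]) (intro mult_right_mono ennreal_leI, auto)
    finally have "ennreal \<bar>LINT x|lborel. (sqfun k f x)\<^sup>2 * g x\<bar> \<le> ennreal ?C' * (\<integral>\<^sup>+ Q. ennreal ((avg f Q)\<^sup>2 * avg g Q * measure lborel Q) \<partial>count_space S)" .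
    then show "\<exists>D S. dyadic_lattice D \<and> S \<subseteq> D \<and> sparse ?\<tau> S \<and>
             (AE x in lborel. g x \<noteq> 0 \<longrightarrow> sqfun_sq k f x < \<infinity>) \<and>
             integrable lborel (\<lambda>x. (sqfun k f x)\<^sup>2 * g x) \<and>
             ennreal \<bar>LINT x|lborel. (sqfun k f x)\<^sup>2 * g x\<bar> \<le>
               ennreal ?C' * (\<integral>\<^sup>+ Q. ennreal ((avg f Q)\<^sup>2 * avg g Q * measure lborel Q) \<partial>count_space S)"
      using DS(1-3) AE int by blast
  qed
qed

end
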